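(* Let $\lambda\in(0,2)$ and let $q\in\mathbb{N}$, $q>1$. There exists a semi-infinite Jacobi matrix $J$ with coefficients $a_n\equiv1$, $b_n\in\mathbb{R}$ ($n\ge1$) such that $\sup_n|b_n|<\infty$, $$\sum_{n=1}^\infty|b_{n+q}-b_n|^2<\infty,$$ the set of right limits of $J$ is $\mathcal{R}=\{J(1,\beta)\mid\beta\in[-\lambda,\lambda]\}$, and $$\bigcap_{J^{(r)}\in\mathcal{R}} q\text{-int}(\sigma(J^{(r)}))=\Sigma_{\mathrm{ac}}(J)\neq\bigcap_{J^{(r)}\in\mathcal{R}}\sigma(J^{(r)}),$$ where equality and non-equality are understood modulo sets of Lebesgue measure zero.
   Context: The semi-infinite Jacobi matrix $J$ with coefficients $a_n>0$, $b_n\in\mathbb{R}$ is the tridiagonal matrix with diagonal entries $b_1,b_2,\dots$ and off-diagonal entries $a_1,a_2,\dots$, acting on $\ell^2(\mathbb{N})$, $\mathbb{N}=\{1,2,\dots\}$. Its canonical spectral measure $\mu$ is the spectral measure of $\delta_1$: $\int x^n\,d\mu(x)=\langle\delta_1,J^n\delta_1\rangle$, $n\ge0$. Write the Lebesgue decomposition $d\mu=f(x)\,dx+d\mu_{\mathrm{s}}$; the essential support of the a.c. spectrum is $\Sigma_{\mathrm{ac}}(J)=\{x\in\mathbb{R}\mid f(x)>0\}$, viewed as an equivalence class modulo sets of Lebesgue measure zero. A two-sided Jacobi matrix $J^{(r)}$ on $\ell^2(\mathbb{Z})$ with coefficients $a^{(r)}_n>0$, $b^{(r)}_n\in\mathbb{R}$,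 $n\in\mathbb{Z}$, is a right limit of $J$ if there is a sequence of integers $n_j\to+\infty$ with $\lim_j a_{n+n_j}=a_n^{(r)}$ and $\lim_j b_{n+n_j}=b_n^{(r)}$ for all $n\in\mathbb{Z}$. $J(1,\beta)$ denotes the two-sided Jacobi matrix with constant coefficients $a_n\equiv1$, $b_n\equiv\beta$, $n\in\mathbb{Z}$. For a two-sided $q$-periodic Jacobi matrix $J^{(r)}$, its $q$-discriminant is $\Delta^{(r)}(z)=\operatorname{tr}\big(A(a_q^{(r)},b_q^{(r)};z)\cdots A(a_1^{(r)},b_1^{(r)};z)\big)$ where $A(a,b;z)=\begin{pmatrix}\frac{z-b}{a}&-\frac1a\\ a&0\end{pmatrix}$, one has $\sigma(J^{(r)})=\{x\in\mathbb{R}\mid\Delta^{(r)}(x)\in[-2,2]\}$, and $q\text{-int}(\sigma(J^{(r)}))=\{x\in\mathbb{R}\mid\Delta^{(r)}(x)\in(-2,2)\}$. In the present situation, $\bigcap_{\mathcal{R}}\sigma(J^{(r)})=[-2+\lambda,2-\lambda]$ and $\bigcap_{\mathcal{R}}q\text{-int}(\sigma(J^{(r)}))=(-2+\lambda,2-\lambda)\setminus\bigcup_{j=1}^{q-1}[z_j-\lambda,z_j+\lambda]$ with $z_j=2\cos\big(\frac{(q-j)\pi}{q}\big)$. *)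

theory Defs
  imports "HOL-Analysis.Analysis"
begin

section \<open>Semi-infinite Jacobi matrices\<close>

text \<open>The coefficients of a semi-infinite Jacobi matrix are functions on \<^typ>\<open>nat\<close> of which only
  the values at indices \<open>n \<ge> 1\<close> matter. Vectors are likewise indexed by \<open>n \<ge> 1\<close>; the entry at
  index 0 is a dummy.\<close>

definition jacobi_half :: "(nat \<Rightarrow> real) \<Rightarrow> (nat \<Rightarrow> real) \<Rightarrow> (nat \<Rightarrow> real) \<Rightarrow> nat \<Rightarrow> real" where
  "jacobi_half a b u n =
     (if n = 0 then 0
      else (if n = 1 then 0 else a (n - 1) * u (n - 1)) + b n * u n + a n * u (n + 1))"

definition delta1 :: "nat \<Rightarrow> real" where
  "delta1 n = (if n = 1 then 1 else 0)"

text \<open>\<open>J\<^sup>k \<delta>\<^sub>1\<close> is finitely supported and its inner product with \<open>\<delta>\<^sub>1\<close> is its entry at index 1.\<close>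

definition jacobi_moment :: "(nat \<Rightarrow> real) \<Rightarrow> (nat \<Rightarrow> real) \<Rightarrow> nat \<Rightarrow> real" where
  "jacobi_moment a b k = (jacobi_half a b ^^ k) delta1 1"

text \<open>For bounded coefficients the moments determine the measure uniquely.\<close>

definition spectral_measure_of :: "(nat \<Rightarrow> real) \<Rightarrow> (nat \<Rightarrow> real) \<Rightarrow> real measure \<Rightarrow> bool" where
  "spectral_measure_of a b \<mu> \<longleftrightarrow>
     finite_measure \<mu> \<and> sets \<mu> = sets borel \<and>
     (\<forall>k. integrable \<mu> (\<lambda>x. x ^ k) \<and> (\<integral>x. x ^ k \<partial>\<mu>) = jacobi_moment a b k)"

definition lebesgue_decomposition ::
    "real measure \<Rightarrow> (real \<Rightarrow> ennreal) \<Rightarrow> real measure \<Rightarrow> bool" where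
  "lebesgue_decomposition \<mu> f \<mu>s \<longleftrightarrow>
     f \<in> borel_measurable borel \<and> sets \<mu>s = sets borel \<and>
     (\<exists>N \<in> null_sets lborel. emeasure \<mu>s (- N) = 0) \<and>
     (\<forall>A \<in> sets borel. emeasure \<mu> A = emeasure (density lborel f) A + emeasure \<mu>s A)"

text \<open>\<open>S\<close> is a representative of \<open>\<Sigma>\<^sub>a\<^sub>c(J)\<close>. The spectral measure of a bounded \<open>J\<close> and its Lebesgue
  decomposition exist and are unique (the density up to null sets), so representatives exist and
  any two of them differ by a Lebesgue null set.\<close>

definition is_Sigma_ac :: "(nat \<Rightarrow> real) \<Rightarrow> (nat \<Rightarrow> real) \<Rightarrow> real set \<Rightarrow> bool" where
  "is_Sigma_ac a b S \<longleftrightarrow>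
     (\<exists>\<mu> f \<mu>s. spectral_measure_of a b \<mu> \<and> lebesgue_decomposition \<mu> f \<mu>s \<and> S = {x. f x > 0})"

definition eq_mod_null :: "real set \<Rightarrow> real set \<Rightarrow> bool" where
  "eq_mod_null A B \<longleftrightarrow> (AE x in lborel. x \<in> A \<longleftrightarrow> x \<in> B)"

section \<open>Two-sided Jacobi matrices\<close>

text \<open>A two-sided Jacobi matrix is identified with its pair of coefficient sequences.\<close>

type_synonym jacobi2 = "(int \<Rightarrow> real) \<times> (int \<Rightarrow> real)"

definition const_jacobi :: "real \<Rightarrow> real \<Rightarrow> jacobi2" where
  "const_jacobi \<alpha> \<beta> = (\<lambda>_. \<alpha>, \<lambda>_. \<beta>)"

text \<open>The truncation \<^const>\<open>nat\<close> is harmless: \<open>n + N j \<ge> 1\<close> for all sufficiently large \<open>j\<close>.\<close>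

definition right_limits :: "(nat \<Rightarrow> real) \<Rightarrow> (nat \<Rightarrow> real) \<Rightarrow> jacobi2 set" where
  "right_limits a b =
     {(a', b'). (\<forall>n. a' n > 0) \<and>
        (\<exists>N :: nat \<Rightarrow> int. filterlim N at_top sequentially \<and>
           (\<forall>n. (\<lambda>j. a (nat (n + N j))) \<longlonglongrightarrow> a' n) \<and>
           (\<forall>n. (\<lambda>j. b (nat (n + N j))) \<longlonglongrightarrow> b' n))}"

definition l2Z :: "(int \<Rightarrow> complex) set" where
  "l2Z = {u. (\<lambda>n. (cmod (u n))\<^sup>2) summable_on UNIV}"

definition l2Z_norm :: "(int \<Rightarrow> complex) \<Rightarrow> real" where
  "l2Z_norm u = sqrt (\<Sum>\<^sub>\<infinity>n. (cmod (u n))\<^sup>2)"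

definition jacobi_shifted :: "jacobi2 \<Rightarrow> complex \<Rightarrow> (int \<Rightarrow> complex) \<Rightarrow> int \<Rightarrow> complex" where
  "jacobi_shifted J z u n =
     of_real (fst J (n - 1)) * u (n - 1) + (of_real (snd J n) - z) * u n
       + of_real (fst J n) * u (n + 1)"

text \<open>For bounded coefficients: \<open>J - z\<close> is a bijection of \<open>\<ell>\<^sup>2(\<int>)\<close> with bounded inverse.\<close>

definition jacobi_resolvent_set :: "jacobi2 \<Rightarrow> complex set" where
  "jacobi_resolvent_set J =
     {z. bij_betw (jacobi_shifted J z) l2Z l2Z \<and>
         (\<exists>C. \<forall>u \<in> l2Z. l2Z_norm u \<le> C * l2Z_norm (jacobi_shifted J z u))}"

text \<open>As \<open>J\<close> is self-adjoint its spectrum is real, so it is taken to be a set of real numbers.\<close>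

definition jacobi_spectrum :: "jacobi2 \<Rightarrow> real set" where
  "jacobi_spectrum J = {x. complex_of_real x \<notin> jacobi_resolvent_set J}"

definition transfer_step :: "real \<Rightarrow> real \<Rightarrow> real \<Rightarrow> real^2^2" where
  "transfer_step a b x = vector [vector [(x - b) / a, - 1 / a], vector [a, 0]]"

primrec transfer :: "jacobi2 \<Rightarrow> nat \<Rightarrow> real \<Rightarrow> real^2^2" where
  "transfer J 0 x = mat 1"
| "transfer J (Suc n) x =
     transfer_step (fst J (int (Suc n))) (snd J (int (Suc n))) x ** transfer J n x"

definition discriminant :: "jacobi2 \<Rightarrow> nat \<Rightarrow> real \<Rightarrow> real" where
  "discriminant J q x = trace (transfer J q x)"

text \<open>The \<open>q\<close>-interior of the spectrum, meaningful for \<open>q\<close>-periodic \<open>J\<close>.\<close>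

definition q_int_spectrum :: "nat \<Rightarrow> jacobi2 \<Rightarrow> real set" where
  "q_int_spectrum q J = {x. discriminant J q x \<in> {-2<..<2}}"

end

theory Submission
  imports Defs "HOL-Complex_Analysis.Complex_Analysis" "HOL-Probability.Probability"
begin

text \<open>Write \<open>p\<^sub>n\<close> for the orthogonal polynomials of \<open>J\<close> and let the potential on the \<open>m\<close>-th block of \<open>q\<close> sites be the
  constant \<open>g\<close> plus a bump \<open>e\<close> on its first site, where \<open>(g, e)\<close> is a curve evaluated at a very slow time: \<open>g\<close> oscillates
  over \<open>[-\<lambda>, \<lambda>]\<close> forever while \<open>e\<close> decreases to 0, but more slowly than the increments of \<open>g\<close>. At each integer
  time the curve rests on a long plateau.

  Where every constant right limit is \<open>q\<close>-elliptic, the \<open>q\<close>-step transfer matrices vary with square summable first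
  and summable second differences. Correcting the invariant quadratic form by the solution of a cohomological equation
  shows that the \<open>p\<^sub>n\<close> stay bounded. Since \<open>dx / (\<pi> (p\<^sub>n\<^sub>+\<^sub>1\<^sup>2 + p\<^sub>n\<^sup>2))\<close> has the first \<open>n\<close> moments of \<open>J\<close>
  (a contour integral over the upper half plane), a weak limit of these measures is the spectral measure,
  and it dominates a multiple of Lebesgue measure there.

  If \<open>x - \<beta>\<close> is an interior band touching point for some \<open>\<beta>\<close> strictly inside \<open>[-\<lambda>, \<lambda>]\<close>, the bump opens a gap of width
  comparable to \<open>e\<close>, so \<open>x\<close> lies in the gap of infinitely many plateaus, as it also does
  if \<open>\<bar>x\<bar> > 2 - \<lambda>\<close>. On a plateau of \<open>n\<close> blocks the product of the norms of the
  incoming and outgoing vectors is at least \<open>n \<bar>w(x)\<bar>\<close> for a nonzero polynomial \<open>w\<close> that depends only on the past, and these norms are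
  square integrable. Choosing \<open>n\<close> after \<open>w\<close> makes the spectral measure of the gap small
  off a set of small Lebesgue measure, and Borel-Cantelli removes the absolutely continuous part.\<close>

section \<open>Orthogonal polynomials and Carmona measures\<close>

text \<open>A potential that sweeps \<open>[-\<lambda>, \<lambda>]\<close> forever has unbounded
  variation, so the first order perturbation terms of the solutions are not summable. They are
  removed by a correction, and what survives is of second order; hence the interest in second
  differences. The clock is built for this: it moves at speed \<open>2^(-k)\<close> for
  \<open>2^k\<close> steps, so the speed is square summable and its jumps are summable, while
  resting costs nothing. The plateau lengths thus stay free in the stability argument and can be
  dictated by the gap argument alone.

  The bump answers another obstacle. For a constant potential the \<open>q\<close>-step matrix at a
  zero of \<open>cheb q\<close> is plus or minus the identity, so all interior gaps are closed. A
  bump on one site of each group opens them, to the right of the touching point. The plateau values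
  of \<open>g\<close> must not jump over this window, which is why the bump decays like the square
  root of the step size of \<open>g\<close>.\<close>

fun orth_poly :: "(nat \<Rightarrow> real) \<Rightarrow> nat \<Rightarrow> real poly" where
  "orth_poly b 0 = 0"
| "orth_poly b (Suc 0) = 1"
| "orth_poly b (Suc (Suc n)) = [:- b (Suc n), 1:] * orth_poly b (Suc n) - orth_poly b n"

abbreviation orth :: "(nat \<Rightarrow> real) \<Rightarrow> nat \<Rightarrow> real \<Rightarrow> real" where
  "orth b n x \<equiv> poly (orth_poly b n) x"

lemma orth_Suc_Suc: "orth b (Suc (Suc n)) x = (x - b (Suc n)) * orth b (Suc n) x - orth b n x"
  by (simp add: algebra_simps)

lemma orth_rec: "n \<ge> 1 \<Longrightarrow> x * orth b n x = orth b (n + 1) x + b n * orth b n x + orth b (n - 1) x"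
  by (cases n) (auto simp: algebra_simps)

text \<open>Two consecutive zeros would run down the recurrence to \<open>p_0 = 0\<close> and
  \<open>p_1 = 1\<close>.\<close>

lemma orth_consecutive_nonzero: "orth b (Suc n) x \<noteq> 0 \<or> orth b n x \<noteq> 0"
  by (induction n) (auto simp: orth_Suc_Suc simp del: orth_poly.simps(3))

text \<open>\<open>p_n\<close> sees only \<open>b_1, ..., b_(n-1)\<close>. This causality later
  allows a plateau length to be chosen after the polynomials that precede it.\<close>

lemma orth_cong: "(\<And>i. 1 \<le> i \<Longrightarrow> i < n \<Longrightarrow> b i = b' i) \<Longrightarrow> orth_poly b n = orth_poly b' n"
proof (induction n rule: less_induct)
  case (less n)
  consider "n = 0" | "n = Suc 0" | m where "n = Suc (Suc m)"
    by (metis not0_implies_Suc)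
  then show ?case
    using less.IH less.prems by cases auto
qed

lemma degree_orth_poly: "degree (orth_poly b n) \<le> n - 1"
proof (induction b n rule: orth_poly.induct)
  case (3 b n)
  have "degree ([:- b (Suc n), 1:] * orth_poly b (Suc n)) \<le> 1 + n"
    by (rule order.trans[OF degree_mult_le]) (use 3 in auto)
  then show ?case
    using 3 by (auto intro!: degree_diff_le)
qed auto

text \<open>With \<open>u\<^sub>j = weyl b n z (n + 1 - j)\<close>, the sequence \<open>u\<close> solves the Jacobi eigenvalue equation
  with the dissipative boundary condition \<open>u\<^sub>n\<^sub>+\<^sub>1 = - \<i> u\<^sub>n\<close>.\<close>

fun weyl :: "(nat \<Rightarrow> real) \<Rightarrow> nat \<Rightarrow> complex \<Rightarrow> nat \<Rightarrow> complex" where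
  "weyl b n z 0 = - \<i>"
| "weyl b n z (Suc 0) = 1"
| "weyl b n z (Suc (Suc i)) = (z - of_real (b (n - i))) * weyl b n z (Suc i) - weyl b n z i"

text \<open>The Wronskian of the solution with its conjugate starts at -1 and loses
  \<open>Im z * |u|^2\<close> at each step (Green's formula), so the solution has no zero in the
  closed half plane. The dissipative boundary value supplies the sign.\<close>

lemma weyl_Im: "Im (weyl b n z i * cnj (weyl b n z (Suc i))) \<le> - 1" if "Im z \<ge> 0"
proof (induction i)
  case (Suc i)
  have "Im (weyl b n z (Suc i) * cnj (weyl b n z (Suc (Suc i)))) =
    Im (weyl b n z i * cnj (weyl b n z (Suc i))) - Im z * (cmod (weyl b n z (Suc i)))\<^sup>2"
    unfolding cmod_power2 by (simp add: algebra_simps power2_eq_square)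
  moreover have "Im z * (cmod (weyl b n z (Suc i)))\<^sup>2 \<ge> 0"
    using that by simp
  ultimately show ?case using Suc by linarith
qed simp

lemma weyl_nonzero: "Im z \<ge> 0 \<Longrightarrow> weyl b n z (Suc i) \<noteq> 0"
  using weyl_Im[of z b n i] by auto

text \<open>The Wronskian of \<open>p\<close> and the Weyl solution is the same at both ends: at
  site 0, where \<open>p_0 = 0\<close>, and at site \<open>n\<close>, where the boundary values are
  \<open>1\<close> and \<open>- \<i>\<close>.\<close>

lemma weyl_eq_orth: "weyl b n (of_real x) (Suc n) = of_real (orth b (Suc n) x) + \<i> * of_real (orth b n x)"
proof -
  have "j \<le> n \<Longrightarrow> of_real (orth b (Suc j) x) * weyl b n (of_real x) (Suc n - j)
     - of_real (orth b j x) * weyl b n (of_real x) (n - j) = weyl b n (of_real x) (Suc n)" for j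
  proof (induction j)
    case (Suc j)
    define i where "i = n - Suc j"
    have i: "n - j = Suc i" "Suc n - j = Suc (Suc i)" "Suc n - Suc j = Suc i" "n - i = Suc j"
      using Suc.prems by (auto simp: i_def)
    show ?case
      using Suc.IH Suc.prems unfolding i orth_Suc_Suc weyl.simps(3)
      by (simp add: i i_def[symmetric] algebra_simps)
  qed simp
  from this[of n] show ?thesis by (simp add: algebra_simps)
qed

lemma weyl_norm: "(cmod (weyl b n (of_real x) (Suc n)))\<^sup>2 = (orth b (Suc n) x)\<^sup>2 + (orth b n x)\<^sup>2"
  unfolding weyl_eq_orth cmod_power2 by simp

text \<open>For real \<open>x\<close> the left-hand side, as a sequence in \<open>j\<close>,
  satisfies the real recurrence of \<open>p\<close>. It is 0 at \<open>j = 0\<close> and, by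
  constancy of the Wronskian, -1 at \<open>j = 1\<close>.\<close>

lemma weyl_Im_orth:
  assumes "j \<le> n"
  shows "Im (weyl b n (of_real x) (Suc n - j) * cnj (weyl b n (of_real x) (Suc n))) = - orth b j x"
proof -
  let ?w = "weyl b n (of_real x)"
  have X: "Im (?w i * cnj (?w (Suc i))) = - 1" for i
  proof (induction i)
    case (Suc i)
    have "Im (?w (Suc i) * cnj (?w (Suc (Suc i)))) = Im (?w i * cnj (?w (Suc i)))"
      by (simp add: algebra_simps)
    then show ?case using Suc by linarith
  qed simp
  have "j \<le> n \<Longrightarrow> Im (?w (Suc n - j) * cnj (?w (Suc n))) = - orth b j x \<and>
     Im (?w (n - j) * cnj (?w (Suc n))) = - orth b (Suc j) x"
  proof (induction j)
    case 0
    have "Im (?w (Suc n) * cnj (?w (Suc n))) = 0"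
      by (simp only: complex_mult_cnj Im_complex_of_real)
    then show ?case using X[of n] by simp
  next
    case (Suc j)
    define i where "i = n - Suc j"
    have i: "n - j = Suc i" "Suc n - j = Suc (Suc i)" "Suc n - Suc j = Suc i" "n - i = Suc j"
      using Suc.prems by (auto simp: i_def)
    have e: "?w i = (of_real x - of_real (b (Suc j))) * ?w (Suc i) - ?w (Suc (Suc i))"
      by (simp add: i)
    have "Im (?w i * cnj (?w (Suc n))) = (x - b (Suc j)) * Im (?w (Suc i) * cnj (?w (Suc n))) -
      Im (?w (Suc (Suc i)) * cnj (?w (Suc n)))"
      unfolding e by (simp add: algebra_simps)
    then show ?case
      using Suc unfolding i orth_Suc_Suc i_def[symmetric] by simp
  qed
  with assms show ?thesis by simp
qed

section \<open>Contour integration over the upper half plane\<close>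

lemma weyl_holomorphic: "(\<lambda>z. weyl b n z i) holomorphic_on S"
  by (induction i rule: induct_nat_012) (auto intro!: holomorphic_intros)

lemma weyl_asymptotics: "((\<lambda>z. weyl b n z (Suc i) / z ^ i) \<longlongrightarrow> 1) at_infinity"
proof (induction i rule: induct_nat_012)
  case 0
  show ?case by simp
next
  case 1
  have "((\<lambda>z::complex. 1 - (of_real (b n) - \<i>) / z) \<longlongrightarrow> 1 - 0) at_infinity"
    by (intro tendsto_intros tendsto_divide_0[OF tendsto_const] filterlim_ident)
  then have "((\<lambda>z::complex. 1 - (of_real (b n) - \<i>) / z) \<longlongrightarrow> 1) at_infinity" by simp
  then show ?case
    by (rule Lim_transform_eventually)
       (use eventually_not_equal_at_infinity[of "0::complex"] in eventually_elim, auto simp: field_simps)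
next
  case (ge2 i)
  have "((\<lambda>z. (1 - of_real (b (n - Suc i)) / z) * (weyl b n z (Suc (Suc i)) / z ^ Suc i)
      - (weyl b n z (Suc i) / z ^ i) * (1 / (z * z))) \<longlongrightarrow> (1 - 0) * 1 - 1 * 0) at_infinity"
    by (intro tendsto_intros ge2 tendsto_divide_0[OF tendsto_const] filterlim_ident
        filterlim_at_infinity_times)
  then have "((\<lambda>z. (1 - of_real (b (n - Suc i)) / z) * (weyl b n z (Suc (Suc i)) / z ^ Suc i)
      - (weyl b n z (Suc i) / z ^ i) * (1 / (z * z))) \<longlongrightarrow> 1) at_infinity" by simp
  then show ?case
  proof (rule Lim_transform_eventually)
    show "\<forall>\<^sub>F z in at_infinity. (1 - of_real (b (n - Suc i)) / z) * (weyl b n z (Suc (Suc i)) / z ^ Suc i)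
      - (weyl b n z (Suc i) / z ^ i) * (1 / (z * z)) = weyl b n z (Suc (Suc (Suc i))) / z ^ Suc (Suc i)"
      using eventually_not_equal_at_infinity[of "0::complex"]
    proof eventually_elim
      case (elim z)
      show ?case
        unfolding weyl.simps(3)[of b n z "Suc i"] using elim
        by (simp del: weyl.simps add: field_simps)
    qed
  qed
qed

text \<open>The segment and the half circle above it bound a region without singularities, and a
  function close to \<open>c / z\<close> contributes \<open>\<i> * pi * c\<close> along the half
  circle in the limit.\<close>

lemma upper_half_plane_integral:
  fixes g :: "complex \<Rightarrow> complex"
  assumes hol: "g holomorphic_on {z. Im z \<ge> 0}"
    and lim: "((\<lambda>z. z * g z) \<longlongrightarrow> c) at_infinity"
  shows "((\<lambda>R. integral {-R..R} (\<lambda>x. g (of_real x))) \<longlongrightarrow> - (\<i> * pi * c)) at_top"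
proof (rule tendstoI)
  fix e :: real assume e: "e > 0"
  \<comment> \<open>Half of the allowed error, spread over a half circle of length
    \<open>pi * R\<close>.\<close>
  define e' where "e' = e / (2 * pi)"
  have e': "e' > 0" using e by (simp add: e'_def)
  from tendstoD[OF lim e'] obtain B where B: "\<And>z. norm z \<ge> B \<Longrightarrow> dist (z * g z) c < e'"
    by (auto simp: eventually_at_infinity)
  have "dist (integral {-R..R} (\<lambda>x. g (of_real x))) (- (\<i> * pi * c)) < e" if R: "R > max B 0" for R
  proof -
    have R0: "R > 0" "R \<ge> B" using R by auto
    let ?l = "linepath (of_real (-R)) (of_real R) :: real \<Rightarrow> complex"
    let ?p = "part_circlepath 0 R 0 pi"
    have conv: "convex {z. Im z \<ge> 0}"
      by (rule convex_halfspace_Im_ge)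
    have im_l: "path_image ?l \<subseteq> {z. Im z \<ge> 0}"
      unfolding path_image_linepath
      by (rule closed_segment_subset) (auto intro: conv)
    have im_p: "path_image ?p \<subseteq> {z. Im z \<ge> 0}"
      using R0 by (auto simp: path_image_part_circlepath Im_exp sin_ge_zero)
    have im_p': "path_image ?p \<subseteq> sphere 0 R"
      using R0 by (intro path_image_part_circlepath_subset) auto
    have contg: "continuous_on {z. Im z \<ge> 0} g"
      using hol by (rule holomorphic_on_imp_continuous_on)
    have int_l: "g contour_integrable_on ?l"
      by (intro contour_integrable_continuous_linepath continuous_on_subset[OF contg])
         (use im_l in auto)
    have int_p: "g contour_integrable_on ?p"
      by (intro contour_integrable_continuous_part_circlepath continuous_on_subset[OF contg] im_p)
    have ends: "pathfinish ?l = pathstart ?p" "pathfinish ?p = pathstart ?l"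
      by (auto simp: exp_pi_i')
    have "(g has_contour_integral 0) (?l +++ ?p)"
      by (rule Cauchy_theorem_convex_simple[OF hol conv])
         (use im_l im_p ends in \<open>auto simp: path_image_join intro!: valid_path_join\<close>)
    then have "contour_integral ?l g + contour_integral ?p g = 0"
      using contour_integral_join[OF int_l int_p] ends contour_integral_unique by auto
    then have sum: "contour_integral ?l g = - contour_integral ?p g"
      by (simp add: add_eq_0_iff2)
    have l: "contour_integral ?l g = integral {-R..R} (\<lambda>x. g (of_real x))"
      using R0 by (subst contour_integral_linepath_Reals_eq) auto
    have c: "((\<lambda>z. c / z) has_contour_integral (\<i> * pi * c)) ?p"
    proof (subst has_contour_integral_part_circlepath_iff)
      have "((\<lambda>t. \<i> * c) has_integral (pi - 0) *\<^sub>R (\<i> * c)) {0..pi}"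
        using has_integral_const_real[of "\<i> * c" 0 pi] by simp
      also have "(pi - 0) *\<^sub>R (\<i> * c) = \<i> * pi * c"
        by (simp add: scaleR_conv_of_real)
      finally show "((\<lambda>t. c / (0 + of_real R * cis t) * of_real R * \<i> * cis t) has_integral (\<i> * pi * c)) {0..pi}"
        using R0 by (simp add: field_simps)
    qed simp
    have "((\<lambda>z. g z - c / z) has_contour_integral (contour_integral ?p g - \<i> * pi * c)) ?p"
      by (intro has_contour_integral_diff c has_contour_integral_integral int_p)
    then have "cmod (contour_integral ?p g - \<i> * pi * c) \<le> (e' / R) * R * (pi - 0)"
    proof (rule has_contour_integral_bound_part_circlepath)
      fix z assume "z \<in> path_image ?p"
      then have z: "norm z = R" using im_p' by auto
      then have z0: "z \<noteq> 0" using R0 by auto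
      have "g z - c / z = (z * g z - c) / z"
        using z0 by (simp add: field_simps)
      then have "cmod (g z - c / z) = cmod (z * g z - c) / R"
        using z by (simp add: norm_divide)
      also have "\<dots> \<le> e' / R"
        using B[of z] z R0 by (intro divide_right_mono) (auto simp: dist_norm)
      finally show "cmod (g z - c / z) \<le> e' / R" .
    qed (use e' R0 in auto)
    also have "\<dots> = e / 2"
      using R0 by (simp add: e'_def)
    also have "\<dots> < e" using e by simp
    finally have "cmod (contour_integral ?p g - \<i> * pi * c) < e" .
    then show ?thesis
      using sum unfolding l by (simp add: dist_norm norm_minus_commute)
  qed
  then show "\<forall>\<^sub>F R in at_top. dist (integral {-R..R} (\<lambda>x. g (of_real x))) (- (\<i> * pi * c)) < e"
    using eventually_gt_at_top[of "max B 0"] by (auto elim!: eventually_mono)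
qed

text \<open>By \<open>weyl_norm\<close> this is the squared modulus of the Weyl solution at site 0;
  it is the denominator of the Carmona density.\<close>

definition orth_norm2 :: "(nat \<Rightarrow> real) \<Rightarrow> nat \<Rightarrow> real \<Rightarrow> real" where
  "orth_norm2 b n x = (orth b (Suc n) x)\<^sup>2 + (orth b n x)\<^sup>2"

lemma orth_norm2_pos: "orth_norm2 b n x > 0"
  using orth_consecutive_nonzero[of b n x] by (auto simp: orth_norm2_def sum_power2_gt_zero_iff)

lemma orth_norm2_weyl: "orth_norm2 b n x = (cmod (weyl b n (of_real x) (Suc n)))\<^sup>2"
  by (simp only: orth_norm2_def weyl_norm)

lemma continuous_on_orth_norm2 [continuous_intros]: "continuous_on S (orth_norm2 b n)"
  unfolding orth_norm2_def by (intro continuous_intros)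

lemma measurable_orth_norm2 [measurable]: "orth_norm2 b n \<in> borel_measurable borel"
  by (intro borel_measurable_continuous_onI continuous_intros)

lemma measurable_orth [measurable]: "orth b n \<in> borel_measurable borel"
  by (intro borel_measurable_continuous_onI continuous_intros)

text \<open>The quotient of the Weyl solution at the sites \<open>j\<close> and 0 is holomorphic on
  the closed half plane and behaves like \<open>z^(-j)\<close>, so only \<open>j = 1\<close> leaves
  a contribution on the half circle. Its imaginary part on the real line is the integrand up to
  sign.\<close>

lemma orth_integral_limit:
  assumes "1 \<le> j" "j \<le> n"
  shows "((\<lambda>R. integral {-R..R} (\<lambda>x. orth b j x / orth_norm2 b n x)) \<longlongrightarrow> (if j = 1 then pi else 0)) at_top"
proof -
  define g where "g = (\<lambda>z. weyl b n z (Suc n - j) / weyl b n z (Suc n))"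
  define c where "c = (if j = 1 then 1 else 0 :: complex)"
  have hol: "g holomorphic_on {z. Im z \<ge> 0}"
    unfolding g_def using weyl_nonzero by (intro holomorphic_intros weyl_holomorphic) auto
  have lim0: "((\<lambda>z::complex. 1 / z ^ (j - 1)) \<longlongrightarrow> c) at_infinity"
  proof (cases "j = 1")
    case False
    then have "((\<lambda>z::complex. 1 / z ^ (j - 1)) \<longlongrightarrow> 0) at_infinity"
      using assms by (intro tendsto_divide_0[OF tendsto_const] filterlim_power_at_infinity filterlim_ident) auto
    then show ?thesis using False by (simp add: c_def)
  qed (simp add: c_def)
  have "((\<lambda>z. (weyl b n z (Suc (n - j)) / z ^ (n - j)) / (weyl b n z (Suc n) / z ^ n) * (1 / z ^ (j - 1)))
    \<longlongrightarrow> 1 / 1 * c) at_infinity"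
    by (intro tendsto_intros weyl_asymptotics lim0) auto
  then have "((\<lambda>z. (weyl b n z (Suc (n - j)) / z ^ (n - j)) / (weyl b n z (Suc n) / z ^ n) * (1 / z ^ (j - 1)))
    \<longlongrightarrow> c) at_infinity" by simp
  then have lim: "((\<lambda>z. z * g z) \<longlongrightarrow> c) at_infinity"
  proof (rule Lim_transform_eventually)
    show "\<forall>\<^sub>F z in at_infinity. weyl b n z (Suc (n - j)) / z ^ (n - j) / (weyl b n z (Suc n) / z ^ n) *
        (1 / z ^ (j - 1)) = z * g z"
      using eventually_not_equal_at_infinity[of "0::complex"]
    proof eventually_elim
      case (elim z)
      obtain l where j: "j = Suc l" using assms by (cases j) auto
      obtain k where n: "n = Suc l + k" using assms j by (metis le_add_diff_inverse)
      have "Suc n - j = Suc (n - j)" using assms by simp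
      then show ?case
        using elim unfolding g_def by (simp add: j n power_add field_simps del: weyl.simps)
    qed
  qed
  have gc: "continuous_on S (\<lambda>x. g (complex_of_real x))" for S
    by (rule continuous_on_compose2[OF holomorphic_on_imp_continuous_on[OF hol]])
       (auto intro!: continuous_intros)
  have Img: "- Im (g (complex_of_real x)) = orth b j x / orth_norm2 b n x" for x
    using weyl_Im_orth[OF assms(2), of b x]
    unfolding g_def orth_norm2_weyl Im_divide' by simp
  have eq: "- Im (integral {-R..R} (\<lambda>x. g (of_real x))) = integral {-R..R} (\<lambda>x. orth b j x / orth_norm2 b n x)" for R
  proof -
    have "((\<lambda>x. g (of_real x)) has_integral (integral {-R..R} (\<lambda>x. g (of_real x)))) {-R..R}"
      by (intro integrable_integral integrable_continuous_real gc)
    from has_integral_neg[OF has_integral_Im[OF this]]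
    show ?thesis
      unfolding Img by (simp add: integral_unique)
  qed
  have "((\<lambda>R. - Im (integral {-R..R} (\<lambda>x. g (of_real x)))) \<longlongrightarrow> - Im (- (\<i> * pi * c))) at_top"
    by (intro tendsto_intros upper_half_plane_integral[OF hol lim])
  then show ?thesis unfolding eq by (simp add: c_def split: if_splits)
qed

lemma integrable_Cauchy_kernel: "integrable lborel (\<lambda>x::real. 1 / (1 + x\<^sup>2))"
  using integrable_inverse_1_plus_square
  by (simp add: set_integrable_def einterval_def inverse_eq_divide)

text \<open>The denominator grows like \<open>x^(2 n)\<close>, which leaves a decay of order at
  least \<open>x^(-2)\<close>.\<close>

lemma integrable_power_div_orth_norm2:
  assumes k: "k + 2 \<le> 2 * n"
  shows "integrable lborel (\<lambda>x. x ^ k / orth_norm2 b n x)"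
proof -
  have "((\<lambda>z. cmod (weyl b n z (Suc n) / z ^ n)) \<longlongrightarrow> cmod 1) at_infinity"
    by (intro tendsto_intros weyl_asymptotics)
  then have "\<forall>\<^sub>F z in at_infinity. cmod (weyl b n z (Suc n) / z ^ n) > 1 / 2"
    by (rule order_tendstoD) simp
  then obtain X0 where X0: "\<And>z. norm z \<ge> X0 \<Longrightarrow> cmod (weyl b n z (Suc n) / z ^ n) > 1 / 2"
    by (auto simp: eventually_at_infinity)
  define X where "X = max X0 1"
  \<comment> \<open>Here the denominator is at least \<open>x^(2 n) / 4\<close> and
    \<open>1 + x^2\<close> is at most \<open>2 * x^2\<close>, whence the 8.\<close>
  have big: "\<bar>x ^ k / orth_norm2 b n x\<bar> \<le> 8 / (1 + x\<^sup>2)" if x: "\<bar>x\<bar> \<ge> X" for x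
  proof -
    have x1: "\<bar>x\<bar> \<ge> 1" using x by (simp add: X_def)
    have "(1 / 2)\<^sup>2 \<le> (cmod (weyl b n (of_real x) (Suc n) / of_real x ^ n))\<^sup>2"
      using X0[of "of_real x"] x by (intro power_mono) (auto simp: X_def)
    also have "\<dots> = orth_norm2 b n x / (\<bar>x\<bar> ^ n)\<^sup>2"
      unfolding orth_norm2_weyl norm_divide norm_power by (simp add: power_divide)
    finally have "(\<bar>x\<bar> ^ n)\<^sup>2 \<le> 4 * orth_norm2 b n x"
      using x1 by (simp add: field_simps power_divide)
    moreover have "\<bar>x\<bar> ^ k * \<bar>x\<bar> ^ 2 \<le> (\<bar>x\<bar> ^ n)\<^sup>2"
      using k x1 unfolding power_mult[symmetric] power_add[symmetric]
      by (intro power_increasing) auto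
    ultimately have "\<bar>x\<bar> ^ k * \<bar>x\<bar> ^ 2 \<le> 4 * orth_norm2 b n x" by linarith
    moreover have "\<bar>x\<bar> ^ k * 1 \<le> \<bar>x\<bar> ^ k * \<bar>x\<bar> ^ 2"
      using one_le_power[OF x1, of 2] by (intro mult_left_mono) auto
    ultimately have "\<bar>x\<bar> ^ k * (1 + x\<^sup>2) \<le> 8 * orth_norm2 b n x"
      by (simp add: algebra_simps)
    then show ?thesis
      using orth_norm2_pos[of b n x] by (simp add: field_simps abs_mult power_abs add_pos_nonneg)
  qed
  have "bounded ((\<lambda>x. x ^ k / orth_norm2 b n x) ` {-X..X})"
    by (intro compact_imp_bounded compact_continuous_image continuous_intros)
       (use orth_norm2_pos[of b n] in \<open>auto simp: less_imp_neq[THEN not_sym]\<close>)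
  then obtain M where "M > 0" and "\<forall>y\<in>(\<lambda>x. x ^ k / orth_norm2 b n x) ` {-X..X}. norm y \<le> M"
    unfolding bounded_pos by blast
  then have M: "\<And>x. x \<in> {-X..X} \<Longrightarrow> \<bar>x ^ k / orth_norm2 b n x\<bar> \<le> M"
    by (simp del: abs_divide)
  define K where "K = max 8 (M * (1 + X\<^sup>2))"
  have all: "\<bar>x ^ k / orth_norm2 b n x\<bar> \<le> K * (1 / (1 + x\<^sup>2))" for x
  proof (cases "\<bar>x\<bar> \<ge> X")
    case True
    have "8 * (1 / (1 + x\<^sup>2)) \<le> K * (1 / (1 + x\<^sup>2))"
      by (intro mult_right_mono) (auto simp: K_def)
    then show ?thesis using big[OF True] by simp
  next
    case False
    then have "x\<^sup>2 \<le> X\<^sup>2" by (intro abs_le_square_iff[THEN iffD1]) (auto simp: X_def)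
    then have "M * (1 + x\<^sup>2) \<le> M * (1 + X\<^sup>2)" using \<open>M > 0\<close> by simp
    then have "M \<le> K * (1 / (1 + x\<^sup>2))"
      by (simp add: field_simps K_def add_pos_nonneg)
    moreover have "\<bar>x ^ k / orth_norm2 b n x\<bar> \<le> M"
      by (rule M) (use False in auto)
    ultimately show ?thesis by (rule order.trans[rotated])
  qed
  show ?thesis
  proof (rule Bochner_Integration.integrable_bound)
    show "integrable lborel (\<lambda>x. K * (1 / (1 + x\<^sup>2)))"
      by (intro integrable_mult_right integrable_Cauchy_kernel)
    show "AE x in lborel. norm (x ^ k / orth_norm2 b n x) \<le> norm (K * (1 / (1 + x\<^sup>2)))"
      unfolding real_norm_def by (rule AE_I2) (rule order.trans[OF all abs_ge_self])
  qed measurable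
qed

lemma lborel_integral_eq_limit:
  fixes f :: "real \<Rightarrow> real"
  assumes f: "integrable lborel f" and lim: "((\<lambda>R. integral {-R..R} f) \<longlongrightarrow> l) at_top"
  shows "(\<integral>x. f x \<partial>lborel) = l"
proof (rule LIMSEQ_unique)
  show "(\<lambda>i. \<integral>x. indicator {- real i..real i} x *\<^sub>R f x \<partial>lborel) \<longlonglongrightarrow> (\<integral>x. f x \<partial>lborel)"
  proof (rule integral_dominated_convergence[where w = "\<lambda>x. norm (f x)"])
    show "AE x in lborel. (\<lambda>i. indicator {- real i..real i} x *\<^sub>R f x) \<longlonglongrightarrow> f x"
    proof (rule AE_I2)
      fix x :: real
      have "\<forall>\<^sub>F i in sequentially. f x = indicator {- real i..real i} x *\<^sub>R f x"
        using eventually_ge_at_top[of "nat \<lceil>\<bar>x\<bar>\<rceil>"]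
        by eventually_elim (auto simp: indicator_def nat_le_iff ceiling_le_iff)
      then show "(\<lambda>i. indicator {- real i..real i} x *\<^sub>R f x) \<longlonglongrightarrow> f x"
        by (rule Lim_transform_eventually[OF tendsto_const])
    qed
  qed (use f in \<open>auto simp: indicator_def\<close>)
  have "(\<integral>x. indicator {- real i..real i} x *\<^sub>R f x \<partial>lborel) = integral {- real i..real i} f" for i
  proof -
    have "set_integrable lborel {- real i..real i} f"
      unfolding set_integrable_def by (intro integrable_mult_indicator f) auto
    from set_borel_integral_eq_integral(2)[OF this] show ?thesis
      by (simp add: set_lebesgue_integral_def)
  qed
  then show "(\<lambda>i. \<integral>x. indicator {- real i..real i} x *\<^sub>R f x \<partial>lborel) \<longlonglongrightarrow> l"
    using filterlim_compose[OF lim filterlim_real_sequentially] by simp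
qed

definition carmona :: "(nat \<Rightarrow> real) \<Rightarrow> nat \<Rightarrow> real measure" where
  "carmona b n = density lborel (\<lambda>x. ennreal (1 / (pi * orth_norm2 b n x)))"

lemma sets_carmona [simp, measurable_cong]: "sets (carmona b n) = sets borel"
  by (simp add: carmona_def)

lemma space_carmona [simp]: "space (carmona b n) = UNIV"
  by (simp add: carmona_def)

lemma carmona_integrable_iff:
  "f \<in> borel_measurable borel \<Longrightarrow>
    integrable (carmona b n) f \<longleftrightarrow> integrable lborel (\<lambda>x. 1 / (pi * orth_norm2 b n x) * f x :: real)"
  unfolding carmona_def
  by (subst integrable_density) (auto simp: orth_norm2_pos less_imp_le)

lemma carmona_integral:
  "f \<in> borel_measurable borel \<Longrightarrow>
    integral\<^sup>L (carmona b n) f = (\<integral>x. 1 / (pi * orth_norm2 b n x) * f x \<partial>lborel :: real)"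
  unfolding carmona_def
  by (subst integral_density) (auto simp: orth_norm2_pos less_imp_le)

lemma carmona_integrable_power: "k + 2 \<le> 2 * n \<Longrightarrow> integrable (carmona b n) (\<lambda>x. x ^ k)"
proof -
  assume "k + 2 \<le> 2 * n"
  then have "integrable lborel (\<lambda>x. 1 / pi * (x ^ k / orth_norm2 b n x))"
    by (intro integrable_mult_right integrable_power_div_orth_norm2)
  then show ?thesis
    by (subst carmona_integrable_iff) (auto simp: field_simps)
qed

lemma carmona_integrable_poly:
  assumes "degree p + 2 \<le> 2 * n"
  shows "integrable (carmona b n) (poly p)"
proof -
  have "integrable (carmona b n) (\<lambda>x. \<Sum>i\<le>degree p. coeff p i * x ^ i)"
    using assms by (intro Bochner_Integration.integrable_sum integrable_mult_right carmona_integrable_power) auto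
  moreover have "poly p = (\<lambda>x. \<Sum>i\<le>degree p. coeff p i * x ^ i)"
    by (rule ext) (simp add: poly_altdef)
  ultimately show ?thesis by simp
qed

lemma carmona_integral_orth:
  assumes "1 \<le> j" "j \<le> n"
  shows "integrable (carmona b n) (orth b j)"
    and "(\<integral>x. orth b j x \<partial>carmona b n) = (if j = 1 then 1 else 0)"
proof -
  show int: "integrable (carmona b n) (orth b j)"
    using assms degree_orth_poly[of b j] by (intro carmona_integrable_poly) linarith
  have "integrable lborel (\<lambda>x. pi * (1 / (pi * orth_norm2 b n x) * orth b j x))"
    using int by (intro integrable_mult_right) (subst (asm) carmona_integrable_iff, auto)
  then have "integrable lborel (\<lambda>x. orth b j x / orth_norm2 b n x)" by simp
  from lborel_integral_eq_limit[OF this orth_integral_limit[OF assms]]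
  have "(\<integral>x. orth b j x / orth_norm2 b n x \<partial>lborel) = (if j = 1 then pi else 0)" .
  moreover have "(\<integral>x. orth b j x \<partial>carmona b n) = (\<integral>x. 1 / pi * (orth b j x / orth_norm2 b n x) \<partial>lborel)"
    by (subst carmona_integral) (auto simp: field_simps intro!: Bochner_Integration.integral_cong)
  moreover have "\<dots> = 1 / pi * (\<integral>x. orth b j x / orth_norm2 b n x \<partial>lborel)"
    by (rule integral_mult_right_zero)
  ultimately have "(\<integral>x. orth b j x \<partial>carmona b n) = 1 / pi * (if j = 1 then pi else 0)"
    by (simp only:)
  then show "(\<integral>x. orth b j x \<partial>carmona b n) = (if j = 1 then 1 else 0)"
    by (auto simp del: orth_poly.simps)
qed

lemma real_distribution_carmona: "n \<ge> 1 \<Longrightarrow> real_distribution (carmona b n)"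
proof -
  assume n: "n \<ge> 1"
  have "integrable (carmona b n) (\<lambda>x. 1 :: real)" "(\<integral>x. 1 \<partial>carmona b n) = (1::real)"
    using carmona_integral_orth[of 1 n b] n by auto
  moreover from this(1) have "finite_measure (carmona b n)"
    by (auto intro!: finite_measureI simp: integrable_iff_bounded)
  ultimately have "measure (carmona b n) UNIV = 1"
    by simp
  then have "prob_space (carmona b n)"
    using \<open>finite_measure (carmona b n)\<close>
    by (intro prob_spaceI) (simp add: finite_measure.emeasure_eq_measure)
  then show ?thesis
    by (simp add: real_distribution_def real_distribution_axioms_def)
qed

section \<open>Moments in the basis of orthogonal polynomials\<close>

abbreviation jacobi_vec :: "(nat \<Rightarrow> real) \<Rightarrow> nat \<Rightarrow> nat \<Rightarrow> real" where
  "jacobi_vec b k \<equiv> (jacobi_half (\<lambda>_. 1) b ^^ k) delta1"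

lemma jacobi_vec_0: "jacobi_vec b k 0 = 0"
  by (cases k) (auto simp: delta1_def jacobi_half_def)

lemma jacobi_vec_eq_0: "j > Suc k \<Longrightarrow> jacobi_vec b k j = 0"
  by (induction k arbitrary: j) (auto simp: delta1_def jacobi_half_def)

text \<open>Multiplication by \<open>x\<close> acts on the coefficients in the basis
  \<open>p_j\<close> as \<open>J\<close> itself, because \<open>J\<close> is symmetric. Hence
  \<open>x^k\<close> has the coefficients of \<open>J^k\<close> applied to \<open>delta1\<close>,
  which vanish beyond the index \<open>k + 1\<close>.\<close>

lemma power_orth_expansion:
  assumes "N > k"
  shows "x ^ k = (\<Sum>j=1..N. jacobi_vec b k j * orth b j x)"
  using assms
proof (induction k arbitrary: N)
  case 0
  have "(\<Sum>j=1..N. jacobi_vec b 0 j * orth b j x) = (\<Sum>j\<in>{1}. jacobi_vec b 0 j * orth b j x)"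
    using 0 by (intro sum.mono_neutral_right) (auto simp: delta1_def)
  then show ?case by (simp add: delta1_def)
next
  case (Suc k)
  let ?c = "jacobi_vec b k" and ?p = "\<lambda>j. orth b j x"
  \<comment> \<open>At \<open>j = 1\<close> the missing left neighbour may be written as the entry
    0, which always vanishes.\<close>
  have c: "jacobi_vec b (Suc k) j = ?c (j - 1) + b j * ?c j + ?c (j + 1)" if "j \<ge> 1" for j
    using that jacobi_vec_0[where b = b and k = k] by (auto simp: jacobi_half_def)
  have "x ^ Suc k = x * (\<Sum>j=1..N. ?c j * ?p j)"
    using Suc.IH[of N] Suc.prems by simp
  also have "\<dots> = (\<Sum>j=1..N. ?c j * (x * ?p j))"
    unfolding sum_distrib_left by (intro sum.cong refl) (simp only: mult_ac)
  also have "\<dots> = (\<Sum>j=1..N. ?c j * (?p (j + 1) + b j * ?p j + ?p (j - 1)))"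
    by (intro sum.cong refl) (simp add: orth_rec del: orth_poly.simps(3))
  also have "\<dots> = (\<Sum>j=1..N. ?c j * ?p (j + 1)) + (\<Sum>j=1..N. b j * ?c j * ?p j) + (\<Sum>j=1..N. ?c j * ?p (j - 1))"
    by (simp add: sum.distrib[symmetric] algebra_simps del: orth_poly.simps(3))
  also have "(\<Sum>j=1..N. ?c j * ?p (j + 1)) = (\<Sum>j=2..Suc N. ?c (j - 1) * ?p j)"
    using sum.shift_bounds_cl_Suc_ivl[of "\<lambda>j. ?c (j - 1) * ?p j" 1 N]
    by (simp add: numeral_2_eq_2 del: orth_poly.simps(3))
  also have "\<dots> = (\<Sum>j=1..N. ?c (j - 1) * ?p j)"
    using Suc.prems by (intro sum.mono_neutral_cong) (auto simp: jacobi_vec_0 jacobi_vec_eq_0 not_le less_Suc_eq_le le_Suc_eq)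
  also have "(\<Sum>j=1..N. ?c j * ?p (j - 1)) = (\<Sum>j=0..N-1. ?c (j + 1) * ?p j)"
    using Suc.prems sum.shift_bounds_cl_Suc_ivl[of "\<lambda>j. ?c j * ?p (j - 1)" 0 "N - 1"] by simp
  also have "\<dots> = (\<Sum>j=1..N. ?c (j + 1) * ?p j)"
    using Suc.prems by (intro sum.mono_neutral_cong) (auto simp: jacobi_vec_eq_0 not_less_eq_eq)
  finally show ?case
    by (simp add: c sum.distrib[symmetric] algebra_simps del: orth_poly.simps(3) funpow.simps)
qed

lemma moment_eqI:
  assumes "N > k" and int: "\<And>j. 1 \<le> j \<Longrightarrow> j \<le> N \<Longrightarrow> integrable M (orth b j)"
    and val: "\<And>j. 1 \<le> j \<Longrightarrow> j \<le> N \<Longrightarrow> (\<integral>x. orth b j x \<partial>M) = (if j = 1 then 1 else 0)"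
  shows "(\<integral>x. x ^ k \<partial>M) = jacobi_moment (\<lambda>_. 1) b k"
proof -
  have "(\<integral>x. x ^ k \<partial>M) = (\<Sum>j=1..N. jacobi_vec b k j * (\<integral>x. orth b j x \<partial>M))"
    unfolding power_orth_expansion[OF assms(1), of _ b]
    by (subst Bochner_Integration.integral_sum) (auto intro!: integrable_mult_right int)
  also have "\<dots> = (\<Sum>j=1..N. if j = 1 then jacobi_vec b k 1 else 0)"
    by (intro sum.cong refl) (subst val, auto)
  finally show ?thesis using assms(1) by (simp add: jacobi_moment_def)
qed

lemma carmona_moment: "k < n \<Longrightarrow> (\<integral>x. x ^ k \<partial>carmona b n) = jacobi_moment (\<lambda>_. 1) b k"
  by (rule moment_eqI[of k n]) (auto intro: carmona_integral_orth simp: carmona_integral_orth)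

section \<open>Existence of the spectral measure\<close>

lemma clamp_error:
  fixes y B :: real
  assumes "B > 0"
  shows "\<bar>y - max (- B) (min B y)\<bar> \<le> y\<^sup>2 / B"
proof (cases "\<bar>y\<bar> \<le> B")
  case True
  then show ?thesis using assms by (auto simp: max_def min_def)
next
  case False
  have "\<bar>y - max (- B) (min B y)\<bar> \<le> \<bar>y\<bar>"
    using assms by (auto simp: max_def min_def)
  also have "\<bar>y\<bar> * B \<le> \<bar>y\<bar> * \<bar>y\<bar>"
    using False by (intro mult_left_mono) auto
  then have "\<bar>y\<bar> \<le> y\<^sup>2 / B"
    using assms by (simp add: field_simps power2_eq_square)
  finally show ?thesis .
qed

text \<open>Weak convergence alone controls only bounded functions. A common second moment of
  \<open>x^k\<close> makes the tails uniformly small: clamping \<open>x^k\<close> at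
  \<open>B\<close> changes every integral by at most \<open>m2 / B\<close>.\<close>

lemma weak_conv_moment:
  assumes \<nu>: "\<And>i. real_distribution (\<nu> i)" and M: "real_distribution M"
    and conv: "weak_conv_m \<nu> M"
    and int: "\<forall>\<^sub>F i in sequentially. integrable (\<nu> i) (\<lambda>x. x ^ k) \<and> integrable (\<nu> i) (\<lambda>x. (x ^ k)\<^sup>2)"
    and mom: "\<forall>\<^sub>F i in sequentially. (\<integral>x. x ^ k \<partial>\<nu> i) = m"
    and mom2: "\<forall>\<^sub>F i in sequentially. (\<integral>x. (x ^ k)\<^sup>2 \<partial>\<nu> i) = m2"
  shows "integrable M (\<lambda>x. x ^ k)" and "(\<integral>x. x ^ k \<partial>M) = m"
proof -
  interpret M: real_distribution M by fact
  interpret \<nu>: real_distribution "\<nu> i" for i by fact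
  have ev: "\<forall>\<^sub>F i in sequentially. integrable (\<nu> i) (\<lambda>x. x ^ k) \<and> integrable (\<nu> i) (\<lambda>x. (x ^ k)\<^sup>2) \<and>
      (\<integral>x. x ^ k \<partial>\<nu> i) = m \<and> (\<integral>x. (x ^ k)\<^sup>2 \<partial>\<nu> i) = m2"
    using int mom mom2 by eventually_elim simp
  have m2: "m2 \<ge> 0"
    using eventually_happens[OF mom2] by (auto intro: Bochner_Integration.integral_nonneg)
  \<comment> \<open>The limit inherits the second moment bound through bounded truncations, to which
    Fatou's lemma is then applied.\<close>
  have trunc: "(\<integral>x. min (real n) ((x ^ k)\<^sup>2) \<partial>M) \<le> m2" for n
  proof (rule tendsto_upperbound)
    show "(\<lambda>i. \<integral>x. min (real n) ((x ^ k)\<^sup>2) \<partial>\<nu> i) \<longlonglongrightarrow> (\<integral>x. min (real n) ((x ^ k)\<^sup>2) \<partial>M)"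
      by (rule weak_conv_imp_integral_bdd_continuous_conv[OF _ _ conv, of _ "real n"])
         (auto intro!: continuous_intros M \<nu>)
    show "\<forall>\<^sub>F i in sequentially. (\<integral>x. min (real n) ((x ^ k)\<^sup>2) \<partial>\<nu> i) \<le> m2"
      using ev
    proof eventually_elim
      case (elim i)
      have "(\<integral>x. min (real n) ((x ^ k)\<^sup>2) \<partial>\<nu> i) \<le> (\<integral>x. (x ^ k)\<^sup>2 \<partial>\<nu> i)"
      proof (rule integral_mono)
        show "integrable (\<nu> i) (\<lambda>x. min (real n) ((x ^ k)\<^sup>2))"
          by (intro \<nu>.integrable_const_bound[where B = "real n"]) auto
      qed (use elim in auto)
      then show ?case using elim by simp
    qed
  qed simp
  have "integrable M (\<lambda>x. (x ^ k)\<^sup>2) \<and> (\<integral>x. (x ^ k)\<^sup>2 \<partial>M) \<le> m2"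
  proof -
    have lim: "(\<lambda>n. ennreal (min (real n) ((x ^ k)\<^sup>2))) \<longlonglongrightarrow> ennreal ((x ^ k)\<^sup>2)" for x :: real
    proof (rule tendsto_ennrealI, rule Lim_transform_eventually[OF tendsto_const])
      show "\<forall>\<^sub>F n in sequentially. (x ^ k)\<^sup>2 = min (real n) ((x ^ k)\<^sup>2)"
        using eventually_ge_at_top[of "nat \<lceil>(x ^ k)\<^sup>2\<rceil>"]
        by eventually_elim (auto simp: min_def nat_le_iff ceiling_le_iff)
    qed
    have "(\<integral>\<^sup>+x. ennreal ((x ^ k)\<^sup>2) \<partial>M) = (\<integral>\<^sup>+x. liminf (\<lambda>n. ennreal (min (real n) ((x ^ k)\<^sup>2))) \<partial>M)"
      using lim_imp_Liminf[OF sequentially_bot lim] by simp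
    also have "\<dots> \<le> liminf (\<lambda>n. \<integral>\<^sup>+x. ennreal (min (real n) ((x ^ k)\<^sup>2)) \<partial>M)"
      by (rule nn_integral_liminf) measurable
    also have "\<dots> \<le> liminf (\<lambda>n. ennreal m2)"
    proof (intro Liminf_mono always_eventually allI)
      fix n
      have "(\<integral>\<^sup>+x. ennreal (min (real n) ((x ^ k)\<^sup>2)) \<partial>M) = ennreal (\<integral>x. min (real n) ((x ^ k)\<^sup>2) \<partial>M)"
        by (intro nn_integral_eq_integral M.integrable_const_bound[where B = "real n"]) auto
      also have "\<dots> \<le> ennreal m2" using trunc by (rule ennreal_leI)
      finally show "(\<integral>\<^sup>+x. ennreal (min (real n) ((x ^ k)\<^sup>2)) \<partial>M) \<le> ennreal m2" .
    qed
    also have "\<dots> = ennreal m2" by (simp add: Liminf_const)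
    finally have le: "(\<integral>\<^sup>+x. ennreal ((x ^ k)\<^sup>2) \<partial>M) \<le> ennreal m2" .
    have i: "integrable M (\<lambda>x. (x ^ k)\<^sup>2)"
      by (rule integrableI_nonneg) (use le_less_trans[OF le ennreal_less_top] in auto)
    with le m2 show ?thesis
      by (simp add: nn_integral_eq_integral)
  qed
  then have M2: "integrable M (\<lambda>x. (x ^ k)\<^sup>2)" "(\<integral>x. (x ^ k)\<^sup>2 \<partial>M) \<le> m2" by auto
  show M1: "integrable M (\<lambda>x. x ^ k)"
    by (rule M.square_integrable_imp_integrable[OF _ M2(1)]) measurable
  have bound: "\<bar>(\<integral>x. x ^ k \<partial>N) - (\<integral>x. max (- B) (min B (x ^ k)) \<partial>N)\<bar> \<le> m2 / B"
    if "real_distribution N" "integrable N (\<lambda>x. x ^ k)" "integrable N (\<lambda>x. (x ^ k)\<^sup>2)"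
      "(\<integral>x. (x ^ k)\<^sup>2 \<partial>N) \<le> m2" "B > 0" for N B
  proof -
    interpret N: real_distribution N by fact
    have i: "integrable N (\<lambda>x. max (- B) (min B (x ^ k)))"
      using \<open>B > 0\<close> by (intro N.integrable_const_bound[where B = B]) auto
    have "\<bar>(\<integral>x. x ^ k \<partial>N) - (\<integral>x. max (- B) (min B (x ^ k)) \<partial>N)\<bar> =
        \<bar>\<integral>x. x ^ k - max (- B) (min B (x ^ k)) \<partial>N\<bar>"
      using that i by simp
    also have "\<dots> \<le> (\<integral>x. \<bar>x ^ k - max (- B) (min B (x ^ k))\<bar> \<partial>N)"
      by (rule integral_abs_bound)
    also have "\<dots> \<le> (\<integral>x. (x ^ k)\<^sup>2 / B \<partial>N)"
      using that i clamp_error[OF \<open>B > 0\<close>] by (intro integral_mono) auto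
    also have "\<dots> \<le> m2 / B"
      using that by (simp add: divide_right_mono)
    finally show ?thesis .
  qed
  have close: "\<bar>(\<integral>x. x ^ k \<partial>M) - m\<bar> \<le> 2 * m2 / B" if "B > 0" for B
  proof -
    have "(\<lambda>i. \<integral>x. max (- B) (min B (x ^ k)) \<partial>\<nu> i) \<longlonglongrightarrow> (\<integral>x. max (- B) (min B (x ^ k)) \<partial>M)"
      using \<open>B > 0\<close>
      by (intro weak_conv_imp_integral_bdd_continuous_conv[OF \<nu> M conv, of _ B])
         (auto intro!: continuous_intros)
    then have "(\<lambda>i. \<bar>m - (\<integral>x. max (- B) (min B (x ^ k)) \<partial>\<nu> i)\<bar>) \<longlonglongrightarrow> \<bar>m - (\<integral>x. max (- B) (min B (x ^ k)) \<partial>M)\<bar>"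
      by (intro tendsto_intros)
    moreover have "\<forall>\<^sub>F i in sequentially. \<bar>m - (\<integral>x. max (- B) (min B (x ^ k)) \<partial>\<nu> i)\<bar> \<le> m2 / B"
      using ev by eventually_elim (use bound[OF \<nu> _ _ _ \<open>B > 0\<close>] in auto)
    ultimately have "\<bar>m - (\<integral>x. max (- B) (min B (x ^ k)) \<partial>M)\<bar> \<le> m2 / B"
      by (rule tendsto_upperbound) simp
    moreover have "\<bar>(\<integral>x. x ^ k \<partial>M) - (\<integral>x. max (- B) (min B (x ^ k)) \<partial>M)\<bar> \<le> m2 / B"
      using bound[OF M M1 M2 that] .
    moreover have "2 * m2 / B = m2 / B + m2 / B" by simp
    ultimately show ?thesis by linarith
  qed
  have "((\<lambda>B. 2 * m2 / B) \<longlongrightarrow> 0) at_top"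
    by (intro tendsto_divide_0[OF tendsto_const] filterlim_at_top_imp_at_infinity filterlim_ident)
  then have "\<bar>(\<integral>x. x ^ k \<partial>M) - m\<bar> \<le> 0"
    by (rule tendsto_lowerbound)
       (auto intro!: eventually_mono[OF eventually_gt_at_top[of 0]] close)
  then show "(\<integral>x. x ^ k \<partial>M) = m" by simp
qed

text \<open>Comparison on continuous test functions passes to the weak limit. It extends to closed
  sets by approximating their indicators, and then to Borel sets by inner regularity.\<close>

lemma weak_conv_density_lower_bound:
  assumes \<nu>: "\<And>i. real_distribution (\<nu> i)" and M: "real_distribution M"
    and conv: "weak_conv_m \<nu> M"
    and dens: "\<And>i. \<nu> i = density lborel (\<lambda>x. ennreal (f i x))"
    and f: "\<And>i. f i \<in> borel_measurable borel" "\<And>i x. f i x \<ge> 0"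
    and lower: "\<forall>\<^sub>F i in sequentially. \<forall>x\<in>{c..d}. \<kappa> \<le> f i x" and \<kappa>: "\<kappa> \<ge> 0"
    and A: "A \<in> sets borel" "A \<subseteq> {c..d}"
  shows "ennreal \<kappa> * emeasure lborel A \<le> emeasure M A"
proof -
  interpret M: real_distribution M by fact
  interpret \<nu>: real_distribution "\<nu> i" for i by fact
  define \<rho> where "\<rho> = density lborel (\<lambda>x. ennreal (\<kappa> * indicator {c..d} x))"
  have [simp, measurable_cong]: "sets \<rho> = sets borel" and [simp]: "space \<rho> = UNIV" by (auto simp: \<rho>_def)
  have \<rho>_A: "emeasure \<rho> B = ennreal \<kappa> * emeasure lborel (B \<inter> {c..d})" if "B \<in> sets borel" for B
  proof -
    have "emeasure \<rho> B = (\<integral>\<^sup>+x. ennreal \<kappa> * indicator (B \<inter> {c..d}) x \<partial>lborel)"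
      unfolding \<rho>_def using that
      by (subst emeasure_density) (auto intro!: nn_integral_cong simp: indicator_def)
    also have "\<dots> = ennreal \<kappa> * emeasure lborel (B \<inter> {c..d})"
      using that by (subst nn_integral_cmult_indicator) auto
    finally show ?thesis .
  qed
  have fin: "emeasure \<rho> UNIV \<noteq> \<infinity>"
    by (subst \<rho>_A) (auto simp: ennreal_mult_eq_top_iff emeasure_lborel_Icc_eq)
  interpret \<rho>: finite_measure \<rho>
    by standard (use fin in simp)
  have test: "(\<integral>x. \<phi> x \<partial>\<rho>) \<le> (\<integral>x. \<phi> x \<partial>M)"
    if \<phi>: "\<And>x. isCont \<phi> x" "\<And>x. 0 \<le> \<phi> x" "\<And>x. \<phi> x \<le> 1" for \<phi> :: "real \<Rightarrow> real"
  proof (rule tendsto_lowerbound)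
    have [measurable]: "\<phi> \<in> borel_measurable borel"
      using \<phi>(1) by (intro borel_measurable_continuous_onI continuous_at_imp_continuous_on) auto
    show "(\<lambda>i. \<integral>x. \<phi> x \<partial>\<nu> i) \<longlonglongrightarrow> (\<integral>x. \<phi> x \<partial>M)"
      using \<phi> by (intro weak_conv_imp_integral_bdd_continuous_conv[OF \<nu> M conv, of _ 1]) auto
    show "\<forall>\<^sub>F i in sequentially. (\<integral>x. \<phi> x \<partial>\<rho>) \<le> (\<integral>x. \<phi> x \<partial>\<nu> i)"
      using lower
    proof eventually_elim
      case (elim i)
      have [measurable]: "f i \<in> borel_measurable borel" by (rule f)
      have i1: "integrable \<rho> \<phi>"
        using \<phi> by (intro \<rho>.integrable_const_bound[where B = 1]) auto
      have i2: "integrable (\<nu> i) \<phi>"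
        using \<phi> by (intro \<nu>.integrable_const_bound[where B = 1]) auto
      have "(\<integral>x. \<phi> x \<partial>\<rho>) = (\<integral>x. (\<kappa> * indicator {c..d} x) * \<phi> x \<partial>lborel)"
        unfolding \<rho>_def using \<kappa> by (subst integral_density) auto
      also have "\<dots> \<le> (\<integral>x. f i x * \<phi> x \<partial>lborel)"
      proof (rule integral_mono)
        show "integrable lborel (\<lambda>x. (\<kappa> * indicator {c..d} x) * \<phi> x)"
          using i1 \<kappa> unfolding \<rho>_def by (subst (asm) integrable_density) auto
        show "integrable lborel (\<lambda>x. f i x * \<phi> x)"
          using i2 f unfolding dens by (subst (asm) integrable_density) auto
        show "\<kappa> * indicator {c..d} x * \<phi> x \<le> f i x * \<phi> x" for x
          using elim \<phi> f(2)[of i x] by (intro mult_right_mono) (auto simp: indicator_def)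
      qed
      also have "\<dots> = (\<integral>x. \<phi> x \<partial>\<nu> i)"
        unfolding dens using f by (subst integral_density) auto
      finally show ?case .
    qed
  qed simp
  have closed_le: "emeasure \<rho> K \<le> emeasure M K" if K: "closed K" for K
  proof (cases "K = {}")
    case False
    \<comment> \<open>Continuous cutoffs of growing slope that tend to the indicator of the closed
      set \<open>K\<close>.\<close>
    define \<phi> where "\<phi> = (\<lambda>n x. max 0 (1 - real n * infdist x K))"
    have lim: "(\<lambda>n. \<phi> n x) \<longlonglongrightarrow> indicator K x" for x
    proof (cases "x \<in> K")
      case False
      then have "infdist x K > 0"
        using K \<open>K \<noteq> {}\<close> infdist_pos_not_in_closed by blast
      then obtain n0 :: nat where n0: "1 < real n0 * infdist x K"
        using reals_Archimedean3 by blast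
      have "\<forall>\<^sub>F n in sequentially. indicator K x = \<phi> n x"
        using eventually_ge_at_top[of n0]
      proof eventually_elim
        case (elim n)
        then have "real n0 * infdist x K \<le> real n * infdist x K"
          by (intro mult_right_mono) (auto simp: infdist_nonneg)
        then show ?case using n0 False by (auto simp: \<phi>_def)
      qed
      then show ?thesis by (rule Lim_transform_eventually[OF tendsto_const])
    qed (auto simp: \<phi>_def)
    have \<phi>: "isCont (\<phi> n) x" "0 \<le> \<phi> n x" "\<phi> n x \<le> 1" for n x
      by (auto simp: \<phi>_def infdist_nonneg intro!: continuous_intros)
    have [measurable]: "\<phi> n \<in> borel_measurable borel" for n
      using \<phi>(1) by (intro borel_measurable_continuous_onI continuous_at_imp_continuous_on) auto
    have dct: "(\<lambda>n. \<integral>x. \<phi> n x \<partial>N) \<longlonglongrightarrow> (\<integral>x. indicator K x \<partial>N :: real)"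
      if "finite_measure N" "sets N = sets borel" for N
    proof -
      interpret N: finite_measure N by fact
      have [measurable_cong]: "sets N = sets borel" by fact
      have [measurable]: "K \<in> sets borel" using K by simp
      show ?thesis
        by (rule integral_dominated_convergence[where w = "\<lambda>_. 1"])
           (use \<phi> lim in \<open>auto simp: abs_of_nonneg\<close>)
    qed
    have "(\<integral>x. indicator K x \<partial>\<rho>) \<le> (\<integral>x. indicator K x \<partial>M :: real)"
      by (rule LIMSEQ_le[OF dct dct])
         (use test[OF \<phi>] in \<open>auto simp: \<rho>.finite_measure_axioms M.finite_measure_axioms\<close>)
    then have "measure \<rho> K \<le> measure M K" using K by simp
    then show ?thesis
      by (simp add: \<rho>.emeasure_eq_measure M.emeasure_eq_measure ennreal_leI)
  qed simp
  have "emeasure \<rho> A = (SUP K\<in>{K. K \<subseteq> A \<and> compact K}. emeasure \<rho> K)"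
    using fin A by (intro inner_regular) auto
  also have "\<dots> \<le> emeasure M A"
  proof (rule SUP_least)
    fix K assume "K \<in> {K. K \<subseteq> A \<and> compact K}"
    then have "emeasure \<rho> K \<le> emeasure M K" "K \<subseteq> A"
      using closed_le compact_imp_closed by auto
    moreover have "emeasure M K \<le> emeasure M A"
      using \<open>K \<subseteq> A\<close> A by (intro emeasure_mono) auto
    ultimately show "emeasure \<rho> K \<le> emeasure M A" by order
  qed
  finally show ?thesis
    using \<rho>_A[OF A(1)] A(2) by (simp add: Int_absorb2)
qed

text \<open>The bounded second moment gives tightness, and along a weakly convergent subsequence
  every moment is eventually constant. The density bound is part of the statement because it is a
  property of this limit; \<open>N\<close> is free so that the bound can be read off at the ends of
  groups of \<open>q\<close> sites.\<close>

theorem carmona_limit: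
  assumes N: "strict_mono N"
  obtains \<mu> where "spectral_measure_of (\<lambda>_. 1) b \<mu>" "real_distribution \<mu>"
    "\<And>A c d C. A \<in> sets borel \<Longrightarrow> A \<subseteq> {c..d} \<Longrightarrow> C > 0 \<Longrightarrow>
       (\<forall>\<^sub>F i in sequentially. \<forall>x\<in>{c..d}. orth_norm2 b (N i) x \<le> C) \<Longrightarrow>
       ennreal (1 / (pi * C)) * emeasure lborel A \<le> emeasure \<mu> A"
proof -
  \<comment> \<open>The shift guarantees \<open>N (i + 3) > 2\<close>, so that already the first
    measure has the correct second moment.\<close>
  define \<nu> where "\<nu> = (\<lambda>i. carmona b (N (i + 3)))"
  have N3: "N (i + 3) \<ge> i + 3" for i
    using N by (rule strict_mono_imp_increasing)
  have rd: "real_distribution (\<nu> i)" for i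
    unfolding \<nu>_def using N3[of i] by (intro real_distribution_carmona) linarith
  interpret \<nu>: real_distribution "\<nu> i" for i by (rule rd)
  define m2 where "m2 = jacobi_moment (\<lambda>_. 1) b 2"
  have i2: "integrable (\<nu> i) (\<lambda>x. x ^ 2)" and m2: "(\<integral>x. x ^ 2 \<partial>\<nu> i) = m2" for i
    unfolding \<nu>_def m2_def using N3[of i] by (auto intro!: carmona_integrable_power carmona_moment)
  have m2_nonneg: "m2 \<ge> 0" unfolding m2[of 0, symmetric] by simp
  have tight: "tight \<nu>"
    unfolding tight_def
  proof (intro conjI allI impI rd)
    fix e :: real assume e: "e > 0"
    \<comment> \<open>The summand 1 makes Chebyshev's inequality strict and keeps \<open>B\<close>
      positive when \<open>m2 = 0\<close>.\<close>
    define B where "B = sqrt (m2 / e) + 1"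
    have B: "B > 0" "B\<^sup>2 > m2 / e"
    proof -
      show "B > 0" using e m2_nonneg by (simp add: B_def add_nonneg_pos)
      have "sqrt (m2 / e) \<ge> 0" using e m2_nonneg by simp
      then have "B\<^sup>2 > (sqrt (m2 / e))\<^sup>2" unfolding B_def by (intro power_strict_mono) auto
      then show "B\<^sup>2 > m2 / e" using e m2_nonneg by simp
    qed
    show "\<exists>a b. a < b \<and> (\<forall>n. 1 - e < measure (\<nu> n) {a<..b})"
    proof (intro exI conjI allI)
      show "- B < B" using B by simp
      fix i
      have "measure (\<nu> i) {x\<in>space (\<nu> i). B\<^sup>2 \<le> x ^ 2} \<le> (\<integral>x. x ^ 2 \<partial>\<nu> i) / B\<^sup>2"
        using B by (intro integral_Markov_inequality_measure[where A = UNIV] i2) auto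
      also have "\<dots> < e" using B e by (simp add: m2 field_simps)
      finally have lt: "measure (\<nu> i) {x. B\<^sup>2 \<le> x ^ 2} < e" by simp
      have sub: "- {-B<..B} \<subseteq> {x. B\<^sup>2 \<le> x ^ 2}"
        using B by (auto simp: abs_le_square_iff[symmetric])
      have "measure (\<nu> i) (- {-B<..B}) \<le> measure (\<nu> i) {x. B\<^sup>2 \<le> x ^ 2}"
        by (rule \<nu>.finite_measure_mono[OF sub]) auto
      with lt have "measure (\<nu> i) (- {-B<..B}) < e" by linarith
      then show "1 - e < measure (\<nu> i) {-B<..B}"
        using \<nu>.prob_compl[of "{-B<..B}" i] by (simp add: Compl_eq_Diff_UNIV)
    qed
  qed
  from tight_imp_convergent_subsubsequence[OF this strict_mono_id]
  obtain r \<mu> where r: "strict_mono (r :: nat \<Rightarrow> nat)" and \<mu>: "real_distribution \<mu>"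
    and conv: "weak_conv_m (\<nu> \<circ> r) \<mu>" by (auto simp: id_def comp_def)
  interpret \<mu>: real_distribution \<mu> by fact
  have rd': "real_distribution ((\<nu> \<circ> r) i)" for i using rd by simp
  have grow: "\<forall>\<^sub>F i in sequentially. k \<le> N (r i + 3)" for k
    using eventually_ge_at_top[of k]
  proof eventually_elim
    case (elim i)
    show ?case
      using elim strict_mono_imp_increasing[OF r, of i] N3[of "r i"] by linarith
  qed
  have mom: "integrable \<mu> (\<lambda>x. x ^ k)" "(\<integral>x. x ^ k \<partial>\<mu>) = jacobi_moment (\<lambda>_. 1) b k" for k
  proof -
    have 1: "\<forall>\<^sub>F i in sequentially. integrable ((\<nu> \<circ> r) i) (\<lambda>x. x ^ k) \<and> integrable ((\<nu> \<circ> r) i) (\<lambda>x. (x ^ k)\<^sup>2)"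
      using grow[of "2 * k + 2"]
      by eventually_elim (auto simp: \<nu>_def power_mult[symmetric] intro!: carmona_integrable_power)
    have 2: "\<forall>\<^sub>F i in sequentially. (\<integral>x. x ^ k \<partial>((\<nu> \<circ> r) i)) = jacobi_moment (\<lambda>_. 1) b k"
      using grow[of "2 * k + 2"]
      by eventually_elim (auto simp: \<nu>_def intro!: carmona_moment)
    have 3: "\<forall>\<^sub>F i in sequentially. (\<integral>x. (x ^ k)\<^sup>2 \<partial>((\<nu> \<circ> r) i)) = jacobi_moment (\<lambda>_. 1) b (k * 2)"
      using grow[of "2 * k + 2"]
      by eventually_elim (auto simp: \<nu>_def power_mult[symmetric] intro!: carmona_moment)
    show "integrable \<mu> (\<lambda>x. x ^ k)" "(\<integral>x. x ^ k \<partial>\<mu>) = jacobi_moment (\<lambda>_. 1) b k"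
      by (rule weak_conv_moment[OF rd' \<mu> conv 1 2 3])+
  qed
  show thesis
  proof
    show "spectral_measure_of (\<lambda>_. 1) b \<mu>"
      using mom \<mu>.finite_measure_axioms by (auto simp: spectral_measure_of_def)
    fix A c d and C :: real
    assume A: "A \<in> sets borel" "A \<subseteq> {c..d}" and C: "C > 0"
      and bd: "\<forall>\<^sub>F i in sequentially. \<forall>x\<in>{c..d}. orth_norm2 b (N i) x \<le> C"
    show "ennreal (1 / (pi * C)) * emeasure lborel A \<le> emeasure \<mu> A"
    proof (rule weak_conv_density_lower_bound[OF rd' \<mu> conv _ _ _ _ _ A,
          where f = "\<lambda>i x. 1 / (pi * orth_norm2 b (N (r i + 3)) x)"])
      have "filterlim (\<lambda>i. r i + 3) at_top sequentially"
        by (rule filterlim_at_top_mono[OF filterlim_ident])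
           (intro always_eventually allI le_trans[OF strict_mono_imp_increasing[OF r] le_add1])
      from eventually_compose_filterlim[OF bd this]
      show "\<forall>\<^sub>F i in sequentially. \<forall>x\<in>{c..d}. 1 / (pi * C) \<le> 1 / (pi * orth_norm2 b (N (r i + 3)) x)"
        by eventually_elim (use C in \<open>auto simp: orth_norm2_pos intro!: divide_left_mono mult_pos_pos\<close>)
    qed (use C in \<open>auto simp: \<nu>_def carmona_def orth_norm2_pos less_imp_le\<close>)
  qed (rule \<mu>)
qed

section \<open>Orthonormality in the spectral measure\<close>

lemma spectral_integrable_poly:
  assumes "spectral_measure_of a b \<mu>"
  shows "integrable \<mu> (poly p)"
proof -
  have "integrable \<mu> (\<lambda>x. \<Sum>i\<le>degree p. coeff p i * x ^ i)"
    using assms by (intro Bochner_Integration.integrable_sum integrable_mult_right) (auto simp: spectral_measure_of_def)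
  moreover have "poly p = (\<lambda>x. \<Sum>i\<le>degree p. coeff p i * x ^ i)"
    by (rule ext) (simp add: poly_altdef)
  ultimately show ?thesis by simp
qed

text \<open>Only the moments of \<open>\<mu>\<close> matter, and for \<open>j \<le> n\<close> the polynomial \<open>orth b j\<close> has
  the same integral against the Carmona measure.\<close>

lemma spectral_integral_orth:
  assumes \<mu>: "spectral_measure_of (\<lambda>_. 1) b \<mu>" and "j \<ge> 1"
  shows "(\<integral>x. orth b j x \<partial>\<mu>) = (if j = 1 then 1 else 0)"
proof -
  define n where "n = j"
  let ?p = "orth_poly b j"
  have deg: "degree ?p < n" using degree_orth_poly[of b j] assms(2) unfolding n_def by linarith
  have eq: "poly ?p = (\<lambda>x. \<Sum>i\<le>degree ?p. coeff ?p i * x ^ i)"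
    by (rule ext) (simp add: poly_altdef)
  have "(\<integral>x. orth b j x \<partial>\<mu>) = (\<Sum>i\<le>degree ?p. coeff ?p i * jacobi_moment (\<lambda>_. 1) b i)"
    unfolding eq using \<mu> by (subst Bochner_Integration.integral_sum) (auto simp: spectral_measure_of_def)
  also have "\<dots> = (\<integral>x. orth b j x \<partial>carmona b n)"
    unfolding eq using deg
    by (subst Bochner_Integration.integral_sum) (auto simp: carmona_moment intro!: carmona_integrable_power)
  also have "\<dots> = (if j = 1 then 1 else 0)"
    using assms by (intro carmona_integral_orth) (auto simp: n_def)
  finally show ?thesis .
qed

text \<open>The recurrence moves a factor \<open>x\<close> from \<open>p_(i+1)\<close> to
  \<open>p_j\<close>, which lowers \<open>i\<close> at the price of neighbouring values of
  \<open>j\<close>; at the bottom \<open>p_j\<close> is integrated alone.\<close>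

lemma spectral_orthonormal:
  assumes \<mu>: "spectral_measure_of (\<lambda>_. 1) b \<mu>" and "j \<ge> 1"
  shows "(\<integral>x. orth b i x * orth b j x \<partial>\<mu>) = (if i = j then 1 else 0)"
  using assms(2)
proof (induction i arbitrary: j rule: induct_nat_012)
  case 0
  then show ?case by simp
next
  case 1
  then show ?case using spectral_integral_orth[OF \<mu>, of j] by auto
next
  case (ge2 i)
  let ?S = "\<lambda>i j. (\<integral>x. orth b i x * orth b j x \<partial>\<mu>)"
  have int: "integrable \<mu> (\<lambda>x. orth b i x * orth b j x)" for i j
    using spectral_integrable_poly[OF \<mu>, of "orth_poly b i * orth_poly b j"] by (simp add: poly_mult[abs_def])
  have "orth b (Suc (Suc i)) x * orth b j x = orth b (Suc i) x * orth b (j + 1) x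
     + (b j - b (Suc i)) * (orth b (Suc i) x * orth b j x)
     + orth b (Suc i) x * orth b (j - 1) x - orth b i x * orth b j x" for x
  proof -
    have "orth b (Suc (Suc i)) x * orth b j x = orth b (Suc i) x * (x * orth b j x)
      - b (Suc i) * orth b (Suc i) x * orth b j x - orth b i x * orth b j x"
      unfolding orth_Suc_Suc by (simp add: algebra_simps)
    then show ?thesis
      unfolding orth_rec[OF \<open>j \<ge> 1\<close>] by (simp add: algebra_simps del: orth_poly.simps)
  qed
  then have "?S (Suc (Suc i)) j = ?S (Suc i) (j + 1) + (b j - b (Suc i)) * ?S (Suc i) j
     + ?S (Suc i) (j - 1) - ?S i j"
    by (simp add: int del: orth_poly.simps)
  \<comment> \<open>For \<open>j = 1\<close> the induction hypothesis does not reach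
    \<open>j - 1 = 0\<close>, but there \<open>p_0 = 0\<close>.\<close>
  moreover have "?S (Suc i) (j - 1) = (if Suc i = j - 1 then 1 else 0)"
    using ge2.IH(2)[of "j - 1"] ge2.prems by (cases "j = 1") auto
  ultimately show ?case
    using ge2.IH(1)[of j] ge2.IH(2)[of j] ge2.IH(2)[of "j + 1"] ge2.prems
    by (auto split: if_splits simp del: orth_poly.simps)
qed

section \<open>Slowly varying families\<close>

text \<open>Uniform in the parameter \<open>x\<close>, since solutions are to be bounded on a whole
  interval at once. The values are complex to accommodate eigenvalues on the unit circle.\<close>

definition slow_at :: "real \<Rightarrow> (nat \<Rightarrow> real) \<Rightarrow> (nat \<Rightarrow> real) \<Rightarrow> 'a set \<Rightarrow> (nat \<Rightarrow> 'a \<Rightarrow> complex) \<Rightarrow> nat \<Rightarrow> bool" where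
  "slow_at C \<delta> \<eta> K X m \<longleftrightarrow> (\<forall>x\<in>K. cmod (X m x) \<le> C \<and> cmod (X (Suc m) x - X m x) \<le> C * \<delta> m \<and>
      cmod (X (Suc (Suc m)) x - 2 * X (Suc m) x + X m x) \<le> C * \<eta> m)"

text \<open>Asymptotic in \<open>m\<close>, so as to admit quantities whose denominators are bounded
  away from zero only for large \<open>m\<close>.\<close>

definition slow :: "(nat \<Rightarrow> real) \<Rightarrow> (nat \<Rightarrow> real) \<Rightarrow> 'a set \<Rightarrow> (nat \<Rightarrow> 'a \<Rightarrow> complex) \<Rightarrow> bool" where
  "slow \<delta> \<eta> K X \<longleftrightarrow> (\<exists>C. \<forall>\<^sub>F m in sequentially. slow_at C \<delta> \<eta> K X m)"

text \<open>Discrete Leibniz rule, arranged so that the middle term pairs the first differences of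
  adjacent steps.\<close>

lemma second_difference_mult:
  fixes x y :: "'a::comm_ring_1"
  shows "x'' * y'' - 2 * (x' * y') + x * y =
    (x'' - 2 * x' + x) * y'' + 2 * ((x' - x) * (y'' - y')) + x * (y'' - 2 * y' + y)"
  by (simp add: algebra_simps)

lemma cmod_second_difference_mult:
  assumes "cmod (x'' - 2 * x' + x) \<le> p" "cmod y'' \<le> q" "cmod (x' - x) \<le> r" "cmod (y'' - y') \<le> s"
    "cmod x \<le> t" "cmod (y'' - 2 * y' + y) \<le> u"
  shows "cmod (x'' * y'' - 2 * (x' * y') + x * y) \<le> p * q + 2 * (r * s) + t * u"
proof -
  have "p \<ge> 0" "q \<ge> 0" "r \<ge> 0" "s \<ge> 0" "t \<ge> 0" "u \<ge> 0"
    using assms norm_ge_zero order.trans by blast+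
  then show ?thesis
    unfolding second_difference_mult
    by (intro norm_triangle_le add_mono) (auto simp: norm_mult intro!: mult_mono' assms)
qed

text \<open>Since \<open>\<eta>\<close> dominates the squares of \<open>\<delta>\<close> at both
  adjacent steps, products of first differences count as second differences. This makes slow
  families closed under products, and under inverses and roots away from zero.\<close>

locale slow_scale =
  fixes \<delta> \<eta> :: "nat \<Rightarrow> real"
  assumes \<delta>_nonneg: "\<And>m. 0 \<le> \<delta> m"
    and \<delta>_square: "\<And>m. (\<delta> m)\<^sup>2 \<le> \<eta> m" "\<And>m. (\<delta> (Suc m))\<^sup>2 \<le> \<eta> m"
    and \<eta>_summable: "summable \<eta>"
begin

lemma \<eta>_nonneg: "0 \<le> \<eta> m"
  using \<delta>_square(1)[of m] zero_le_power2[of "\<delta> m"] by linarith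

lemma \<delta>_mult: "\<delta> m * \<delta> (Suc m) \<le> \<eta> m"
proof -
  have "2 * (\<delta> m * \<delta> (Suc m)) \<le> (\<delta> m)\<^sup>2 + (\<delta> (Suc m))\<^sup>2"
    using sum_squares_bound[of "\<delta> m" "\<delta> (Suc m)"] by simp
  then show ?thesis using \<delta>_square[of m] by linarith
qed

lemma \<delta>_tendsto_0: "\<delta> \<longlonglongrightarrow> 0"
proof -
  have "(\<lambda>m. sqrt (\<eta> m)) \<longlonglongrightarrow> sqrt 0"
    by (intro tendsto_intros summable_LIMSEQ_zero \<eta>_summable)
  moreover have "\<bar>\<delta> m\<bar> \<le> sqrt (\<eta> m)" for m
    using \<delta>_square(1)[of m] by (simp add: real_le_rsqrt \<delta>_nonneg)
  ultimately show ?thesis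
    by (intro Lim_null_comparison[of \<delta> "\<lambda>m. sqrt (\<eta> m)"]) auto
qed

lemma slow_at_mono: "slow_at C \<delta> \<eta> K X m \<Longrightarrow> C \<le> C' \<Longrightarrow> slow_at C' \<delta> \<eta> K X m"
  unfolding slow_at_def
  by (meson order.trans mult_right_mono \<delta>_nonneg \<eta>_nonneg)

lemma slow_atD:
  assumes "slow_at C \<delta> \<eta> K X m" "x \<in> K"
  shows "cmod (X m x) \<le> C" "cmod (X (Suc m) x - X m x) \<le> C * \<delta> m"
    "cmod (X (Suc (Suc m)) x - 2 * X (Suc m) x + X m x) \<le> C * \<eta> m"
  using assms by (auto simp: slow_at_def)

lemma slowI:
  assumes "\<forall>\<^sub>F m in sequentially. \<forall>x\<in>K. cmod (X m x) \<le> C1"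
    "\<forall>\<^sub>F m in sequentially. \<forall>x\<in>K. cmod (X (Suc m) x - X m x) \<le> C2 * \<delta> m"
    "\<forall>\<^sub>F m in sequentially. \<forall>x\<in>K. cmod (X (Suc (Suc m)) x - 2 * X (Suc m) x + X m x) \<le> C3 * \<eta> m"
  shows "slow \<delta> \<eta> K X"
proof -
  define C where "C = max C1 (max C2 C3)"
  have CC: "C1 \<le> C" "C2 * \<delta> m \<le> C * \<delta> m" "C3 * \<eta> m \<le> C * \<eta> m" for m
    by (auto simp: C_def intro!: mult_right_mono \<delta>_nonneg \<eta>_nonneg)
  have "\<forall>\<^sub>F m in sequentially. slow_at C \<delta> \<eta> K X m"
    using assms by eventually_elim
      (auto simp: slow_at_def intro: order.trans[OF _ CC(1)] order.trans[OF _ CC(2)] order.trans[OF _ CC(3)])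
  then show ?thesis unfolding slow_def by blast
qed

lemma slowE:
  assumes "slow \<delta> \<eta> K X"
  obtains C where "C > 0" "\<forall>\<^sub>F m in sequentially. slow_at C \<delta> \<eta> K X m"
proof -
  from assms obtain C0 where C0: "\<forall>\<^sub>F m in sequentially. slow_at C0 \<delta> \<eta> K X m" by (auto simp: slow_def)
  show thesis
  proof
    show "max C0 1 > 0" by simp
    show "\<forall>\<^sub>F m in sequentially. slow_at (max C0 1) \<delta> \<eta> K X m"
      using C0 by eventually_elim (rule slow_at_mono, auto)
  qed
qed

lemma slow_of_bounded:
  assumes "\<And>x. x \<in> K \<Longrightarrow> cmod (f x) \<le> C"
  shows "slow \<delta> \<eta> K (\<lambda>m. f)"
  by (rule slowI[where ?C1.0 = C and ?C2.0 = 0 and ?C3.0 = 0]) (use assms in auto)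

lemma slow_const: "slow \<delta> \<eta> K (\<lambda>m x. c)"
  by (rule slow_of_bounded[where C = "cmod c"]) simp

lemma slow_add:
  assumes "slow \<delta> \<eta> K X" "slow \<delta> \<eta> K Y"
  shows "slow \<delta> \<eta> K (\<lambda>m x. X m x + Y m x)"
proof -
  obtain C where C: "\<forall>\<^sub>F m in sequentially. slow_at C \<delta> \<eta> K X m" using assms(1) by (auto simp: slow_def)
  obtain D where D: "\<forall>\<^sub>F m in sequentially. slow_at D \<delta> \<eta> K Y m" using assms(2) by (auto simp: slow_def)
  have "\<forall>\<^sub>F m in sequentially. slow_at (C + D) \<delta> \<eta> K (\<lambda>m x. X m x + Y m x) m"
    using C D
  proof eventually_elim
    case (elim m)
    have e: "a + b - 2 * (a' + b') + (a'' + b'') = (a - 2 * a' + a'') + (b - 2 * b' + b'')"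
      "a + b - (a' + b') = (a - a') + (b - b')" for a b a' b' a'' b'' :: complex by simp_all
    show ?case
      unfolding slow_at_def e distrib_right
      using slow_atD[OF elim(1)] slow_atD[OF elim(2)] by (auto intro!: norm_triangle_mono)
  qed
  then show ?thesis by (auto simp: slow_def)
qed

lemma slow_mult:
  assumes "slow \<delta> \<eta> K X" "slow \<delta> \<eta> K Y"
  shows "slow \<delta> \<eta> K (\<lambda>m x. X m x * Y m x)"
proof -
  obtain C where C: "C > 0" "\<forall>\<^sub>F m in sequentially. slow_at C \<delta> \<eta> K X m" using slowE[OF assms(1)] .
  obtain D where D: "D > 0" "\<forall>\<^sub>F m in sequentially. slow_at D \<delta> \<eta> K Y m" using slowE[OF assms(2)] .
  have DS: "\<forall>\<^sub>F m in sequentially. \<forall>n\<ge>m. slow_at D \<delta> \<eta> K Y n"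
    by (rule eventually_all_ge_at_top[OF D(2)])
  have "\<forall>\<^sub>F m in sequentially. slow_at (4 * (C * D)) \<delta> \<eta> K (\<lambda>m x. X m x * Y m x) m"
    using C(2) DS
  proof eventually_elim
    case (elim m)
    show ?case
      unfolding slow_at_def
    proof (intro ballI conjI)
      fix x assume x: "x \<in> K"
      note X = slow_atD[OF elim(1) x]
      have Yn: "slow_at D \<delta> \<eta> K Y m" "slow_at D \<delta> \<eta> K Y (Suc m)" "slow_at D \<delta> \<eta> K Y (Suc (Suc m))"
        using elim(2) by auto
      note Y = slow_atD[OF Yn(1) x] slow_atD(1,2)[OF Yn(2) x] slow_atD(1)[OF Yn(3) x]
      have CD: "C * D \<ge> 0" using C D by simp
      have "cmod (X m x * Y m x) \<le> C * D"
        unfolding norm_mult by (intro mult_mono' X Y norm_ge_zero)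
      then show "cmod (X m x * Y m x) \<le> 4 * (C * D)" using CD by linarith
      have "X (Suc m) x * Y (Suc m) x - X m x * Y m x =
          (X (Suc m) x - X m x) * Y (Suc m) x + X m x * (Y (Suc m) x - Y m x)"
        by (simp add: algebra_simps)
      also have "cmod \<dots> \<le> (C * \<delta> m) * D + C * (D * \<delta> m)"
      proof (rule norm_triangle_le, rule add_mono)
        show "cmod ((X (Suc m) x - X m x) * Y (Suc m) x) \<le> (C * \<delta> m) * D"
          unfolding norm_mult by (intro mult_mono' X Y norm_ge_zero)
        show "cmod (X m x * (Y (Suc m) x - Y m x)) \<le> C * (D * \<delta> m)"
          unfolding norm_mult by (intro mult_mono' X Y norm_ge_zero)
      qed
      also have "\<dots> = 2 * ((C * D) * \<delta> m)" by simp
      also have "\<dots> \<le> 4 * ((C * D) * \<delta> m)" using mult_nonneg_nonneg[OF CD \<delta>_nonneg[of m]] by linarith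
      finally show "cmod (X (Suc m) x * Y (Suc m) x - X m x * Y m x) \<le> 4 * (C * D) * \<delta> m" by simp
      have "cmod (X (Suc (Suc m)) x * Y (Suc (Suc m)) x - 2 * (X (Suc m) x * Y (Suc m) x) + X m x * Y m x)
        \<le> (C * \<eta> m) * D + 2 * ((C * \<delta> m) * (D * \<delta> (Suc m))) + C * (D * \<eta> m)"
        by (rule cmod_second_difference_mult[OF X(3) Y(6) X(2) Y(5) X(1) Y(3)])
      also have "\<dots> = 2 * ((C * D) * \<eta> m) + 2 * ((C * D) * (\<delta> m * \<delta> (Suc m)))" by simp
      also have "\<dots> \<le> 2 * ((C * D) * \<eta> m) + 2 * ((C * D) * \<eta> m)"
        using \<delta>_mult[of m] CD by (intro add_left_mono mult_left_mono) auto
      finally show "cmod (X (Suc (Suc m)) x * Y (Suc (Suc m)) x - 2 * (X (Suc m) x * Y (Suc m) x) + X m x * Y m x)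
        \<le> 4 * (C * D) * \<eta> m" by simp
    qed
  qed
  then show ?thesis by (auto simp: slow_def)
qed

lemma slow_minus: "slow \<delta> \<eta> K X \<Longrightarrow> slow \<delta> \<eta> K (\<lambda>m x. - X m x)"
  using slow_mult[OF slow_const[of _ "-1"], of K X] by simp

lemma slow_diff:
  "slow \<delta> \<eta> K X \<Longrightarrow> slow \<delta> \<eta> K Y \<Longrightarrow> slow \<delta> \<eta> K (\<lambda>m x. X m x - Y m x)"
  using slow_add[OF _ slow_minus, of K X Y] by simp

text \<open>The product \<open>X * inverse X = 1\<close> has second difference zero, and its Leibniz
  rule can be solved for the second difference of the inverse.\<close>

lemma slow_inverse:
  assumes "slow \<delta> \<eta> K X" and c: "c > 0" "\<forall>\<^sub>F m in sequentially. \<forall>x\<in>K. c \<le> cmod (X m x)"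
  shows "slow \<delta> \<eta> K (\<lambda>m x. inverse (X m x))"
proof -
  obtain C where C: "C > 0" "\<forall>\<^sub>F m in sequentially. slow_at C \<delta> \<eta> K X m" using slowE[OF assms(1)] .
  have CS: "\<forall>\<^sub>F m in sequentially. \<forall>n\<ge>m. slow_at C \<delta> \<eta> K X n"
    by (rule eventually_all_ge_at_top[OF C(2)])
  have cS: "\<forall>\<^sub>F m in sequentially. \<forall>n\<ge>m. \<forall>x\<in>K. c \<le> cmod (X n x)"
    by (rule eventually_all_ge_at_top[OF c(2)])
  define D where "D = C / c\<^sup>2"
  have D: "D \<ge> 0" using C by (simp add: D_def)
  have inv: "cmod (inverse (X n x)) \<le> 1 / c" if "c \<le> cmod (X n x)" for n x
    unfolding norm_inverse using le_imp_inverse_le[OF that c(1)] by (simp only: inverse_eq_divide)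
  have first: "cmod (inverse (X (Suc n) x) - inverse (X n x)) \<le> D * \<delta> n"
    if "x \<in> K" "slow_at C \<delta> \<eta> K X n" "c \<le> cmod (X n x)" "c \<le> cmod (X (Suc n) x)" for n x
  proof -
    have nz: "X n x \<noteq> 0" "X (Suc n) x \<noteq> 0" using that c(1) by auto
    have "cmod (inverse (X (Suc n) x) - inverse (X n x)) =
        cmod (X (Suc n) x - X n x) * (cmod (inverse (X (Suc n) x)) * cmod (inverse (X n x)))"
      using nz by (simp add: inverse_diff_inverse norm_mult mult_ac norm_minus_commute)
    also have "\<dots> \<le> (C * \<delta> n) * (1 / c * (1 / c))"
      using that inv slow_atD[OF that(2,1)] C c \<delta>_nonneg[of n] by (intro mult_mono) auto
    also have "\<dots> = D * \<delta> n" by (simp add: D_def power2_eq_square)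
    finally show ?thesis .
  qed
  show ?thesis
  proof (rule slowI)
    show "\<forall>\<^sub>F m in sequentially. \<forall>x\<in>K. cmod (inverse (X m x)) \<le> 1 / c"
      using c(2) by eventually_elim (auto intro: inv)
    show "\<forall>\<^sub>F m in sequentially. \<forall>x\<in>K. cmod (inverse (X (Suc m) x) - inverse (X m x)) \<le> D * \<delta> m"
      using CS cS by eventually_elim (auto intro!: first)
    show "\<forall>\<^sub>F m in sequentially. \<forall>x\<in>K. cmod (inverse (X (Suc (Suc m)) x) - 2 * inverse (X (Suc m) x) + inverse (X m x))
        \<le> (1 / c * (C * (1 / c) + 2 * (C * D))) * \<eta> m"
      using CS cS
    proof eventually_elim
      case (elim m)
      show ?case
      proof
        fix x assume x: "x \<in> K"
        let ?a = "X m x" and ?a' = "X (Suc m) x" and ?a'' = "X (Suc (Suc m)) x"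
        let ?y = "inverse ?a" and ?y' = "inverse ?a'" and ?y'' = "inverse ?a''"
        have cc: "c \<le> cmod ?a" "c \<le> cmod ?a'" "c \<le> cmod ?a''" using elim(2) x by auto
        then have nz: "?a \<noteq> 0" "?a' \<noteq> 0" "?a'' \<noteq> 0" using c(1) by auto
        have X: "slow_at C \<delta> \<eta> K X m" "slow_at C \<delta> \<eta> K X (Suc m)" using elim(1) by auto
        let ?r = "(?a'' - 2 * ?a' + ?a) * ?y'' + 2 * ((?a' - ?a) * (?y'' - ?y'))"
        have "?r + ?a * (?y'' - 2 * ?y' + ?y) = 0"
          unfolding second_difference_mult[symmetric] using nz by simp
        then have "?y'' - 2 * ?y' + ?y = ?y * - ?r"
          using nz by (simp add: field_simps add_eq_0_iff)
        also have "cmod \<dots> \<le> 1 / c * ((C * \<eta> m) * (1 / c) + 2 * ((C * \<delta> m) * (D * \<delta> (Suc m))))"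
          unfolding norm_mult norm_minus_cancel
        proof (intro mult_mono inv cc norm_triangle_le add_mono)
          show "cmod ((?a'' - 2 * ?a' + ?a) * ?y'') \<le> C * \<eta> m * (1 / c)"
            unfolding norm_mult using slow_atD(3)[OF X(1) x] inv[OF cc(3)] C c \<eta>_nonneg[of m]
            by (intro mult_mono) auto
          show "cmod (2 * ((?a' - ?a) * (?y'' - ?y'))) \<le> 2 * ((C * \<delta> m) * (D * \<delta> (Suc m)))"
            unfolding norm_mult
            using slow_atD(2)[OF X(1) x] first[OF x X(2) cc(2,3)] C D \<delta>_nonneg
            by (intro mult_mono) auto
        qed (use c in auto)
        also have "\<dots> \<le> 1 / c * ((C * \<eta> m) * (1 / c) + 2 * (C * D * \<eta> m))"
        proof -
          have "C * D * (\<delta> m * \<delta> (Suc m)) \<le> C * D * \<eta> m"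
            using C D \<delta>_mult[of m] by (intro mult_left_mono) auto
          then show ?thesis using c(1) by (intro mult_left_mono) (auto simp: mult_ac)
        qed
        also have "\<dots> = (1 / c * (C * (1 / c) + 2 * (C * D))) * \<eta> m" by (simp add: algebra_simps)
        finally show "cmod (?y'' - 2 * ?y' + ?y) \<le> (1 / c * (C * (1 / c) + 2 * (C * D))) * \<eta> m" .
      qed
    qed
  qed
qed

text \<open>In the Leibniz rule for the square of the root, the second difference of the root is
  multiplied by a sum of two roots, which is at least \<open>2 * sqrt c\<close>.\<close>

lemma slow_sqrt:
  assumes "slow \<delta> \<eta> K (\<lambda>m x. of_real (Y m x))" and c: "c > 0" "\<forall>\<^sub>F m in sequentially. \<forall>x\<in>K. c \<le> Y m x"
  shows "slow \<delta> \<eta> K (\<lambda>m x. of_real (sqrt (Y m x)))"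
proof -
  obtain C where C: "C > 0" "\<forall>\<^sub>F m in sequentially. slow_at C \<delta> \<eta> K (\<lambda>m x. of_real (Y m x)) m"
    using slowE[OF assms(1)] .
  have cm: "cmod (of_real a - of_real b) = \<bar>a - b\<bar>"
    "cmod (of_real a - 2 * of_real b + of_real d) = \<bar>a - 2 * b + d\<bar>" for a b d :: real
  proof -
    have "of_real a - 2 * of_real b + (of_real d :: complex) = of_real (a - 2 * b + d)" by simp
    then show "cmod (of_real a - 2 * of_real b + of_real d) = \<bar>a - 2 * b + d\<bar>" by (simp only: norm_of_real)
    have "of_real a - (of_real b :: complex) = of_real (a - b)" by simp
    then show "cmod (of_real a - of_real b) = \<bar>a - b\<bar>" by (simp only: norm_of_real)
  qed
  have YD: "\<bar>Y n x\<bar> \<le> C" "\<bar>Y (Suc n) x - Y n x\<bar> \<le> C * \<delta> n"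
     "\<bar>Y (Suc (Suc n)) x - 2 * Y (Suc n) x + Y n x\<bar> \<le> C * \<eta> n"
    if "slow_at C \<delta> \<eta> K (\<lambda>m x. of_real (Y m x)) n" "x \<in> K" for n x
    using slow_atD[OF that] unfolding cm norm_of_real .
  have CS: "\<forall>\<^sub>F m in sequentially. \<forall>n\<ge>m. slow_at C \<delta> \<eta> K (\<lambda>m x. of_real (Y m x)) n"
    by (rule eventually_all_ge_at_top[OF C(2)])
  have cS: "\<forall>\<^sub>F m in sequentially. \<forall>n\<ge>m. \<forall>x\<in>K. c \<le> Y n x"
    by (rule eventually_all_ge_at_top[OF c(2)])
  define e where "e = 2 * sqrt c"
  have e: "e > 0" using c by (simp add: e_def)
  define D where "D = C / e"
  have D: "D \<ge> 0" using C e by (simp add: D_def)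
  have quot: "\<bar>u\<bar> \<le> w / e" if "\<bar>v * u\<bar> \<le> w" "v \<ge> e" for u v w :: real
  proof -
    have "e * \<bar>u\<bar> \<le> v * \<bar>u\<bar>" using that by (intro mult_right_mono) auto
    also have "\<dots> = \<bar>v * u\<bar>" using that e by (simp add: abs_mult)
    finally show ?thesis using that e by (simp add: field_simps)
  qed
  have root: "sqrt (Y n x) \<ge> e / 2" if "c \<le> Y n x" for n x
    using that by (simp add: e_def)
  have first: "\<bar>sqrt (Y (Suc n) x) - sqrt (Y n x)\<bar> \<le> D * \<delta> n"
    if "x \<in> K" "slow_at C \<delta> \<eta> K (\<lambda>m x. of_real (Y m x)) n" "c \<le> Y n x" "c \<le> Y (Suc n) x" for n x
  proof -
    have "(sqrt (Y (Suc n) x) + sqrt (Y n x)) * (sqrt (Y (Suc n) x) - sqrt (Y n x)) = Y (Suc n) x - Y n x"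
      using that c by (simp add: algebra_simps)
    then have "\<bar>sqrt (Y (Suc n) x) - sqrt (Y n x)\<bar> \<le> C * \<delta> n / e"
      using YD(2)[OF that(2,1)] root[OF that(3)] root[OF that(4)]
      by (intro quot[where v = "sqrt (Y (Suc n) x) + sqrt (Y n x)"]) auto
    then show ?thesis by (simp add: D_def)
  qed
  show ?thesis
  proof (rule slowI)
    show "\<forall>\<^sub>F m in sequentially. \<forall>x\<in>K. cmod (of_real (sqrt (Y m x))) \<le> sqrt C"
      using CS cS by eventually_elim (use YD(1) c in fastforce)
    show "\<forall>\<^sub>F m in sequentially. \<forall>x\<in>K. cmod (of_real (sqrt (Y (Suc m) x)) - of_real (sqrt (Y m x))) \<le> D * \<delta> m"
      unfolding cm using CS cS by eventually_elim (auto intro!: first)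
    show "\<forall>\<^sub>F m in sequentially. \<forall>x\<in>K.
       cmod (of_real (sqrt (Y (Suc (Suc m)) x)) - 2 * of_real (sqrt (Y (Suc m) x)) + of_real (sqrt (Y m x)))
        \<le> ((C + 2 * (D * D)) / e) * \<eta> m"
      unfolding cm using CS cS
    proof eventually_elim
      case (elim m)
      show ?case
      proof
        fix x assume x: "x \<in> K"
        let ?a = "sqrt (Y m x)" and ?a' = "sqrt (Y (Suc m) x)" and ?a'' = "sqrt (Y (Suc (Suc m)) x)"
        have cc: "c \<le> Y m x" "c \<le> Y (Suc m) x" "c \<le> Y (Suc (Suc m)) x" using elim(2) x by auto
        have X: "slow_at C \<delta> \<eta> K (\<lambda>m x. of_real (Y m x)) m" "slow_at C \<delta> \<eta> K (\<lambda>m x. of_real (Y m x)) (Suc m)"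
          using elim(1) by auto
        have "Y (Suc (Suc m)) x - 2 * Y (Suc m) x + Y m x = ?a'' * ?a'' - 2 * (?a' * ?a') + ?a * ?a"
          using cc c by simp
        also have "\<dots> = (?a + ?a'') * (?a'' - 2 * ?a' + ?a) + 2 * ((?a' - ?a) * (?a'' - ?a'))"
          unfolding second_difference_mult by (simp add: algebra_simps)
        finally have "\<bar>(?a + ?a'') * (?a'' - 2 * ?a' + ?a)\<bar> \<le> \<bar>Y (Suc (Suc m)) x - 2 * Y (Suc m) x + Y m x\<bar> + 2 * (\<bar>?a' - ?a\<bar> * \<bar>?a'' - ?a'\<bar>)"
          by (simp flip: abs_mult)
        also have "\<dots> \<le> C * \<eta> m + 2 * ((D * \<delta> m) * (D * \<delta> (Suc m)))"
          using YD(3)[OF X(1) x] first[OF x X(1) cc(1,2)] first[OF x X(2) cc(2,3)] D \<delta>_nonneg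
          by (intro add_mono mult_mono) auto
        also have "\<dots> \<le> C * \<eta> m + 2 * (D * D * \<eta> m)"
        proof -
          have "D * D * (\<delta> m * \<delta> (Suc m)) \<le> D * D * \<eta> m"
            using D \<delta>_mult[of m] by (intro mult_left_mono) auto
          then show ?thesis by (simp add: mult_ac)
        qed
        finally have "\<bar>?a'' - 2 * ?a' + ?a\<bar> \<le> (C * \<eta> m + 2 * (D * D * \<eta> m)) / e"
          using root[OF cc(1)] root[OF cc(3)] by (intro quot[where v = "?a + ?a''"]) auto
        then show "\<bar>?a'' - 2 * ?a' + ?a\<bar> \<le> ((C + 2 * (D * D)) / e) * \<eta> m"
          by (simp add: field_simps)
      qed
    qed
  qed
qed

lemma slow_Im:
  assumes "slow \<delta> \<eta> K X"
  shows "slow \<delta> \<eta> K (\<lambda>m x. of_real (Im (X m x)))"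
proof -
  obtain C where C: "\<forall>\<^sub>F m in sequentially. slow_at C \<delta> \<eta> K X m" using assms by (auto simp: slow_def)
  have e: "of_real (Im a) - 2 * of_real (Im b) + (of_real (Im d) :: complex) = of_real (Im (a - 2 * b + d))"
    "of_real (Im a) - (of_real (Im b) :: complex) = of_real (Im (a - b))" for a b d by simp_all
  have "\<forall>\<^sub>F m in sequentially. slow_at C \<delta> \<eta> K (\<lambda>m x. of_real (Im (X m x))) m"
    using C by eventually_elim
      (unfold slow_at_def e norm_of_real, meson abs_Im_le_cmod order.trans)
  then show ?thesis by (auto simp: slow_def)
qed

end

text \<open>The quadratic energy \<open>\<bar>Z\<bar>\<^sup>2 / I\<close> is conserved by \<open>Z \<mapsto> \<zeta> Z\<close>; the change of \<open>\<theta>\<close> by \<open>d\<close> perturbs it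
  to first order by an oscillating term. Since \<open>\<kappa> = cnj d * R\<close> solves the cohomological equation
  \<open>\<kappa> \<zeta>\<^sup>2 - \<kappa> = - \<i> cnj d \<zeta>\<^sup>2 / I\<^sup>2\<close>, subtracting \<open>Re (\<kappa> Z\<^sup>2)\<close> leaves only second order errors.\<close>

lemma energy_step:
  fixes Z \<zeta> d d' R R' Z' Y :: complex and I I' s P h :: real
  assumes \<zeta>: "cmod \<zeta> = 1" "Im \<zeta> = s" "s \<noteq> 0"
    and I: "I \<noteq> 0" "I' \<noteq> 0" "I' = I + Im d"
    and R: "R = - \<zeta> / of_real (2 * s * I\<^sup>2)"
    and Y: "Y = \<zeta> * Z" and Z': "Z' = Y + d * of_real (Im Y / I)"
    and P: "1 / \<bar>I\<bar> \<le> P" "1 / \<bar>I'\<bar> \<le> P" "cmod R \<le> P"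
    and h: "cmod (cnj d' * R' - cnj d * R) \<le> P * h" "(cmod d)\<^sup>2 \<le> h" "cmod d \<le> 1"
  shows "\<bar>((cmod Z')\<^sup>2 / I' - Re (cnj d' * R' * Z'\<^sup>2)) - ((cmod Z)\<^sup>2 / I - Re (cnj d * R * Z\<^sup>2))\<bar>
    \<le> (2 * P ^ 3 + P\<^sup>2 * (2 + P) + P * (1 + P)\<^sup>2) * h * (cmod Z)\<^sup>2"
proof -
  have P0: "P \<ge> 0" using P(3) norm_ge_zero order.trans by blast
  have h0: "h \<ge> 0" using h(2) zero_le_power2 order.trans by blast
  define n where "n = cmod Z"
  have n0: "n \<ge> 0" by (simp add: n_def)
  have nY: "cmod Y = n" by (simp add: Y norm_mult \<zeta> n_def)
  define D where "D = cmod d"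
  have D0: "D \<ge> 0" "D \<le> 1" "D\<^sup>2 \<le> h" using h by (auto simp: D_def)
  \<comment> \<open>\<open>E\<close> collects what is of second order in \<open>d\<close>: the
    change of the weight \<open>1 / I\<close> in the linear term, and the quadratic term.\<close>
  define E where "E = Re (- \<i> * cnj d * Y\<^sup>2) / I * (1 / I' - 1 / I) + (cmod d)\<^sup>2 * (Im Y)\<^sup>2 / (I\<^sup>2 * I')"
  have first: "(cmod Z')\<^sup>2 / I' - (cmod Z)\<^sup>2 / I = Re (- \<i> * cnj d * Y\<^sup>2) / I\<^sup>2 + E"
  proof -
    have "(cmod Z)\<^sup>2 = (cmod Y)\<^sup>2" using nY n_def by simp
    moreover have "(cmod Z')\<^sup>2 = (cmod Y)\<^sup>2 * (I' / I) + Re (- \<i> * cnj d * Y\<^sup>2) / I + (cmod d)\<^sup>2 * (Im Y)\<^sup>2 / I\<^sup>2"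
      unfolding Z' cmod_power2 using I(1)
      by (simp add: I(3) field_simps power2_eq_square) 
    moreover have "(N * (I' / I) + X / I + q / I\<^sup>2) / I' - N / I =
        X / I\<^sup>2 + (X / I * (1 / I' - 1 / I) + q / (I\<^sup>2 * I'))" for N X q
      using I(1,2) by (simp add: field_simps power2_eq_square)
    ultimately show ?thesis
      unfolding E_def by (simp only:)
  qed
  have coh: "Re (- \<i> * cnj d * Y\<^sup>2) / I\<^sup>2 = Re (cnj d * R * Y\<^sup>2) - Re (cnj d * R * Z\<^sup>2)"
  proof -
    \<comment> \<open>On the unit circle \<open>\<zeta>^2 - 1\<close> equals
      \<open>2 * \<i> * s * \<zeta>\<close>, which explains the form of \<open>R\<close>;
      ellipticity enters as \<open>s\<close> being nonzero.\<close>
    have "\<zeta> * cnj \<zeta> = 1" using \<zeta>(1) by (simp add: complex_mult_cnj cmod_def)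
    then have "\<zeta>\<^sup>2 - 1 = \<zeta> * (\<zeta> - cnj \<zeta>)" by (simp add: algebra_simps power2_eq_square)
    also have "\<zeta> - cnj \<zeta> = 2 * \<i> * of_real s" using \<zeta>(2) by (simp add: complex_eq_iff)
    finally have z: "\<zeta>\<^sup>2 - 1 = 2 * \<i> * of_real s * \<zeta>" by simp
    have "R * (\<zeta>\<^sup>2 - 1) = - \<i> * \<zeta>\<^sup>2 / of_real (I\<^sup>2)"
      unfolding R z using \<zeta>(3) I(1) by (simp add: field_simps power2_eq_square)
    then have "cnj d * (R * (\<zeta>\<^sup>2 - 1)) * Z\<^sup>2 = (- \<i> * cnj d * Y\<^sup>2) / of_real (I\<^sup>2)"
      unfolding Y by (simp add: power_mult_distrib)
    also have "Re \<dots> = Re (- \<i> * cnj d * Y\<^sup>2) / I\<^sup>2"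
      by (rule Re_divide_of_real)
    finally have "Re (- \<i> * cnj d * Y\<^sup>2) / I\<^sup>2 = Re (cnj d * (R * (\<zeta>\<^sup>2 - 1)) * Z\<^sup>2)" by simp
    also have "cnj d * (R * (\<zeta>\<^sup>2 - 1)) * Z\<^sup>2 = cnj d * R * Y\<^sup>2 - cnj d * R * Z\<^sup>2"
      unfolding Y by (simp add: algebra_simps power_mult_distrib)
    finally show ?thesis by simp
  qed
  \<comment> \<open>The linear term has cancelled. Left are \<open>E\<close>, the error of using
    \<open>Z'\<close> in place of \<open>Y\<close> in the correction, and the change of the
    correction coefficient.\<close>
  have total: "((cmod Z')\<^sup>2 / I' - Re (cnj d' * R' * Z'\<^sup>2)) - ((cmod Z)\<^sup>2 / I - Re (cnj d * R * Z\<^sup>2)) =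
     E + Re (cnj d * R * (Y\<^sup>2 - Z'\<^sup>2)) - Re ((cnj d' * R' - cnj d * R) * Z'\<^sup>2)"
    using first coh by (simp add: algebra_simps)
  have inv: "\<bar>1 / I\<bar> \<le> P" "\<bar>1 / I'\<bar> \<le> P" using P by (simp_all add: abs_divide)
  have "cmod (d * of_real (Im Y / I)) = D * (\<bar>Im Y\<bar> * \<bar>1 / I\<bar>)"
    unfolding norm_mult norm_of_real D_def by (simp add: abs_divide)
  also have "\<dots> \<le> D * (n * P)"
    using abs_Im_le_cmod[of Y] nY inv D0 n0 by (intro mult_left_mono mult_mono) auto
  finally have diff: "cmod (Z' - Y) \<le> D * n * P" by (simp add: Z' mult_ac)
  have "D * n * P \<le> 1 * n * P" using D0 n0 P0 by (intro mult_right_mono) auto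
  then have nZ': "cmod Z' \<le> (1 + P) * n"
    using diff nY norm_triangle_sub[of Z' Y] by (simp add: algebra_simps)
  have dY: "cmod (- \<i> * cnj d * Y\<^sup>2) = D * n\<^sup>2"
    by (simp add: norm_mult norm_power D_def nY)
  have E: "\<bar>E\<bar> \<le> 2 * P ^ 3 * h * n\<^sup>2"
  proof -
    have e1: "1 / I' - 1 / I = - Im d * (1 / I * (1 / I'))"
      using I by (simp add: field_simps)
    have "\<bar>Re (- \<i> * cnj d * Y\<^sup>2) / I * (1 / I' - 1 / I)\<bar> =
       \<bar>Re (- \<i> * cnj d * Y\<^sup>2)\<bar> * \<bar>1 / I\<bar> * (\<bar>Im d\<bar> * (\<bar>1 / I\<bar> * \<bar>1 / I'\<bar>))"
      unfolding e1 by (simp add: abs_mult abs_divide)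
    also have "\<dots> \<le> (D * n\<^sup>2) * P * (D * (P * P))"
      using abs_Re_le_cmod[of "- \<i> * cnj d * Y\<^sup>2"] abs_Im_le_cmod[of d] inv P0 D0 unfolding dY D_def
      by (intro mult_mono) auto
    also have "\<dots> = P ^ 3 * D\<^sup>2 * n\<^sup>2" by (simp add: power2_eq_square power3_eq_cube)
    finally have t1: "\<bar>Re (- \<i> * cnj d * Y\<^sup>2) / I * (1 / I' - 1 / I)\<bar> \<le> P ^ 3 * D\<^sup>2 * n\<^sup>2" .
    have "\<bar>(cmod d)\<^sup>2 * (Im Y)\<^sup>2 / (I\<^sup>2 * I')\<bar> = D\<^sup>2 * \<bar>Im Y\<bar>\<^sup>2 * (\<bar>1 / I\<bar> * \<bar>1 / I\<bar> * \<bar>1 / I'\<bar>)"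
      by (simp add: abs_mult abs_divide D_def power2_eq_square)
    also have "\<dots> \<le> D\<^sup>2 * n\<^sup>2 * (P * P * P)"
      using abs_Im_le_cmod[of Y] nY inv P0 D0 by (intro mult_mono power_mono) auto
    also have "\<dots> = P ^ 3 * D\<^sup>2 * n\<^sup>2" by (simp add: power3_eq_cube)
    finally have t2: "\<bar>(cmod d)\<^sup>2 * (Im Y)\<^sup>2 / (I\<^sup>2 * I')\<bar> \<le> P ^ 3 * D\<^sup>2 * n\<^sup>2" .
    have "P ^ 3 * D\<^sup>2 * n\<^sup>2 \<le> P ^ 3 * h * n\<^sup>2"
      using D0 P0 by (intro mult_right_mono mult_left_mono) auto
    then have "\<bar>E\<bar> \<le> P ^ 3 * h * n\<^sup>2 + P ^ 3 * h * n\<^sup>2"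
      unfolding E_def using t1 t2 by (intro order.trans[OF abs_triangle_ineq add_mono]) (rule order.trans, assumption+)+
    then show ?thesis by (simp add: algebra_simps)
  qed
  have T2: "\<bar>Re (cnj d * R * (Y\<^sup>2 - Z'\<^sup>2))\<bar> \<le> P\<^sup>2 * (2 + P) * h * n\<^sup>2"
  proof -
    have "\<bar>Re (cnj d * R * (Y\<^sup>2 - Z'\<^sup>2))\<bar> \<le> cmod (cnj d * R * (Y\<^sup>2 - Z'\<^sup>2))"
      by (rule abs_Re_le_cmod)
    also have "cmod (cnj d * R * (Y\<^sup>2 - Z'\<^sup>2)) = D * cmod R * (cmod (Z' - Y) * cmod (Y + Z'))"
    proof -
      have "Y\<^sup>2 - Z'\<^sup>2 = - ((Z' - Y) * (Y + Z'))" by (simp add: power2_eq_square algebra_simps)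
      then show ?thesis by (simp add: norm_mult D_def)
    qed
    also have "\<dots> \<le> D * P * ((D * n * P) * (n + (1 + P) * n))"
      using P(3) diff nZ' nY P0 D0 n0
      by (intro mult_mono norm_triangle_le add_mono) auto
    also have "\<dots> = P\<^sup>2 * (2 + P) * D\<^sup>2 * n\<^sup>2" by (simp add: power2_eq_square algebra_simps)
    also have "\<dots> \<le> P\<^sup>2 * (2 + P) * h * n\<^sup>2"
      using D0 P0 by (intro mult_right_mono mult_left_mono) auto
    finally show ?thesis .
  qed
  have T3: "\<bar>Re ((cnj d' * R' - cnj d * R) * Z'\<^sup>2)\<bar> \<le> P * (1 + P)\<^sup>2 * h * n\<^sup>2"
  proof -
    have "\<bar>Re ((cnj d' * R' - cnj d * R) * Z'\<^sup>2)\<bar> \<le> cmod ((cnj d' * R' - cnj d * R) * Z'\<^sup>2)"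
      by (rule abs_Re_le_cmod)
    also have "\<dots> \<le> (P * h) * ((1 + P) * n)\<^sup>2"
      unfolding norm_mult norm_power using h(1) nZ' P0 h0 by (intro mult_mono power_mono) auto
    also have "\<dots> = P * (1 + P)\<^sup>2 * h * n\<^sup>2" by (simp add: power_mult_distrib)
    finally show ?thesis .
  qed
  have "\<bar>E + Re (cnj d * R * (Y\<^sup>2 - Z'\<^sup>2)) - Re ((cnj d' * R' - cnj d * R) * Z'\<^sup>2)\<bar> \<le>
    2 * P ^ 3 * h * n\<^sup>2 + P\<^sup>2 * (2 + P) * h * n\<^sup>2 + P * (1 + P)\<^sup>2 * h * n\<^sup>2"
    using E T2 T3 by linarith
  also have "\<dots> = (2 * P ^ 3 + P\<^sup>2 * (2 + P) + P * (1 + P)\<^sup>2) * h * n\<^sup>2" by (simp add: algebra_simps)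
  finally show ?thesis unfolding total n_def .
qed

text \<open>Discrete Gronwall inequality: a product of factors \<open>1 + e m\<close> is at most the
  exponential of the sum.\<close>

lemma summable_growth_bound:
  fixes F :: "nat \<Rightarrow> real"
  assumes step: "\<And>m. m \<ge> m0 \<Longrightarrow> F (Suc m) \<le> F m * (1 + e m)" and e: "\<And>m. 0 \<le> e m" "summable e"
    and F: "\<And>m. 0 \<le> F m" and "m \<ge> m0"
  shows "F m \<le> F m0 * exp (suminf e)"
proof -
  have "F m \<le> F m0 * exp (\<Sum>i\<in>{m0..<m}. e i)" if "m \<ge> m0" for m
    using that
  proof (induction m rule: dec_induct)
    case (step m)
    have "F (Suc m) \<le> F m * (1 + e m)" using assms(1) step by simp
    also have "\<dots> \<le> F m * exp (e m)"
      using F exp_ge_add_one_self by (intro mult_left_mono) auto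
    also have "\<dots> \<le> (F m0 * exp (\<Sum>i\<in>{m0..<m}. e i)) * exp (e m)"
      using step by (intro mult_right_mono) auto
    also have "\<dots> = F m0 * exp (\<Sum>i\<in>{m0..<Suc m}. e i)"
      using step by (simp add: exp_add)
    finally show ?case .
  qed simp
  from this[OF \<open>m \<ge> m0\<close>] have "F m \<le> F m0 * exp (\<Sum>i\<in>{m0..<m}. e i)" .
  also have "\<dots> \<le> F m0 * exp (suminf e)"
    using F e sum_le_suminf[OF e(2), of "{m0..<m}"] by (intro mult_left_mono) auto
  finally show ?thesis .
qed

section \<open>Boundedness of slowly varying elliptic products\<close>

context slow_scale
begin

text \<open>\<open>(1, \<theta>)\<close> is a left eigenvector of the matrix for an eigenvalue
  \<open>\<zeta>\<close> on the unit circle. So \<open>Z = V + \<theta> * W\<close> is merely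
  rotated by a frozen matrix, and \<open>|Z|^2 / I\<close> with \<open>I = Im \<theta>\<close> is
  the invariant form. The drift of \<open>\<theta>\<close> is absorbed by the correction of
  \<open>energy_step\<close>, and Gronwall sums the second order errors.\<close>

theorem elliptic_bounded:
  fixes A B C D V W :: "nat \<Rightarrow> 'a \<Rightarrow> real"
  assumes slowA: "slow \<delta> \<eta> K (\<lambda>m x. of_real (A m x))" and slowB: "slow \<delta> \<eta> K (\<lambda>m x. of_real (B m x))"
    and slowC: "slow \<delta> \<eta> K (\<lambda>m x. of_real (C m x))" and slowD: "slow \<delta> \<eta> K (\<lambda>m x. of_real (D m x))"
    and det: "\<And>m x. A m x * D m x - B m x * C m x = 1"
    and ell: "\<tau> > 0" "\<forall>\<^sub>F m in sequentially. \<forall>x\<in>K. \<bar>A m x + D m x\<bar> \<le> 2 - \<tau>"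
    and V: "\<And>m x. V (Suc m) x = A m x * V m x + B m x * W m x"
    and W: "\<And>m x. W (Suc m) x = C m x * V m x + D m x * W m x"
    and bdd: "\<And>m. \<exists>c. \<forall>x\<in>K. (V m x)\<^sup>2 + (W m x)\<^sup>2 \<le> c"
  shows "\<exists>M. \<forall>\<^sub>F m in sequentially. \<forall>x\<in>K. (V m x)\<^sup>2 + (W m x)\<^sup>2 \<le> M"
proof -
  define S where "S = (\<lambda>m x. sqrt (1 - ((A m x + D m x) / 2)\<^sup>2))"
  define \<zeta> where "\<zeta> = (\<lambda>m x. Complex ((A m x + D m x) / 2) (S m x))"
  define \<theta> where "\<theta> = (\<lambda>m x. (\<zeta> m x - of_real (A m x)) / of_real (C m x))"
  define I where "I = (\<lambda>m x. Im (\<theta> m x))"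
  define R where "R = (\<lambda>m x. - \<zeta> m x / of_real (2 * S m x * (I m x)\<^sup>2))"
  define c where "c = \<tau> / 2"
  have c: "c > 0" using ell by (simp add: c_def)
  have disc: "c \<le> 1 - ((A m x + D m x) / 2)\<^sup>2" if "\<bar>A m x + D m x\<bar> \<le> 2 - \<tau>" for m x
  proof -
    define t where "t = \<bar>(A m x + D m x) / 2\<bar>"
    have t: "0 \<le> t" "t \<le> 1 - \<tau> / 2" using that by (auto simp: t_def abs_divide)
    then have "t * t \<le> 1 * t" using ell(1) by (intro mult_right_mono) auto
    then have "t\<^sup>2 \<le> 1 - \<tau> / 2" using t by (simp add: power2_eq_square)
    moreover have "t\<^sup>2 = ((A m x + D m x) / 2)\<^sup>2" by (simp only: t_def power2_abs)
    ultimately show ?thesis unfolding c_def by linarith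
  qed
  have S: "\<forall>\<^sub>F m in sequentially. \<forall>x\<in>K. c \<le> 1 - ((A m x + D m x) / 2)\<^sup>2"
    using ell(2) by eventually_elim (auto intro: disc)
  have slowtr: "slow \<delta> \<eta> K (\<lambda>m x. of_real ((A m x + D m x) / 2))"
    using slow_mult[OF slow_add[OF slowA slowD] slow_const[of K "1/2"]] by simp
  have slowS: "slow \<delta> \<eta> K (\<lambda>m x. of_real (S m x))"
    unfolding S_def
    by (rule slow_sqrt[OF _ c S])
       (use slow_diff[OF slow_const[of K 1] slow_mult[OF slowtr slowtr]] in \<open>simp add: power2_eq_square\<close>)
  have slow\<zeta>: "slow \<delta> \<eta> K \<zeta>"
  proof -
    have "\<zeta> = (\<lambda>m x. of_real ((A m x + D m x) / 2) + \<i> * of_real (S m x))"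
      unfolding \<zeta>_def by (intro ext) (simp only: complex_eq_iff, simp)
    then show ?thesis
      using slow_add[OF slowtr slow_mult[OF slow_const[of K \<i>] slowS]] by simp
  qed
  obtain C0 where C0: "C0 > 0" "\<forall>\<^sub>F m in sequentially. slow_at C0 \<delta> \<eta> K (\<lambda>m x. of_real (B m x)) m"
    using slowE[OF slowB] .
  \<comment> \<open>The eigenvector needs \<open>C\<close> away from 0. Ellipticity and determinant
    1 force \<open>- B * C\<close> to be at least \<open>c\<close>, and \<open>B\<close> is
    bounded.\<close>
  have Clow: "\<forall>\<^sub>F m in sequentially. \<forall>x\<in>K. c / C0 \<le> \<bar>C m x\<bar>"
    using S C0(2)
  proof eventually_elim
    case (elim m)
    show ?case
    proof
      fix x assume x: "x \<in> K"
      have "c \<le> 1 - ((A m x + D m x) / 2)\<^sup>2" using elim x by auto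
      also have "\<dots> = - (B m x * C m x) - ((A m x - D m x) / 2)\<^sup>2"
        using det[of m x] by (simp add: power2_eq_square field_simps)
      also have "\<dots> \<le> \<bar>B m x\<bar> * \<bar>C m x\<bar>" by (simp add: abs_mult[symmetric])
          (use zero_le_power2[of "(A m x - D m x) / 2"] abs_ge_minus_self[of "B m x * C m x"] in linarith)
      also have "\<dots> \<le> C0 * \<bar>C m x\<bar>"
        using slow_atD(1)[OF elim(2) x] by (intro mult_right_mono) auto
      finally show "c / C0 \<le> \<bar>C m x\<bar>" using C0(1) by (simp add: field_simps)
    qed
  qed
  have cC0: "c / C0 > 0" using c C0 by simp
  have slow\<theta>: "slow \<delta> \<eta> K \<theta>"
    unfolding \<theta>_def divide_inverse
    by (intro slow_mult slow_diff slow\<zeta> slowA slow_inverse[OF slowC cC0]) (use Clow in simp)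
  have I_eq: "I m x = S m x / C m x" for m x
    by (simp add: I_def \<theta>_def \<zeta>_def Im_divide_of_real)
  have slowI: "slow \<delta> \<eta> K (\<lambda>m x. of_real (I m x))"
    unfolding I_def by (rule slow_Im[OF slow\<theta>])
  obtain C1 where C1: "C1 > 0" "\<forall>\<^sub>F m in sequentially. slow_at C1 \<delta> \<eta> K (\<lambda>m x. of_real (C m x)) m"
    using slowE[OF slowC] .
  define i0 where "i0 = sqrt c / C1"
  have i0: "i0 > 0" using c C1 by (simp add: i0_def)
  have Slow: "\<forall>\<^sub>F m in sequentially. \<forall>x\<in>K. sqrt c \<le> S m x"
    using S by eventually_elim (auto simp: S_def)
  have Ilow: "\<forall>\<^sub>F m in sequentially. \<forall>x\<in>K. i0 \<le> \<bar>I m x\<bar>"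
    using Slow C1(2) Clow
  proof eventually_elim
    case (elim m)
    show ?case
    proof
      fix x assume x: "x \<in> K"
      have "\<bar>C m x\<bar> \<le> C1" using slow_atD(1)[OF elim(2) x] by simp
      moreover have "\<bar>C m x\<bar> > 0" using elim(3) x cC0 by force
      moreover have "sqrt c \<le> S m x" using elim x by auto
      ultimately show "i0 \<le> \<bar>I m x\<bar>"
        unfolding I_eq i0_def abs_divide using c by (intro frac_le) auto
    qed
  qed
  have slowR: "slow \<delta> \<eta> K R"
  proof -
    have "slow \<delta> \<eta> K (\<lambda>m x. - \<zeta> m x * inverse (2 * of_real (S m x) * (of_real (I m x) * of_real (I m x))))"
    proof (intro slow_mult slow_minus slow\<zeta> slow_inverse slowS slowI slow_const)
      show "0 < 2 * sqrt c * (i0 * i0)" using c i0 by simp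
      show "\<forall>\<^sub>F m in sequentially. \<forall>x\<in>K. 2 * sqrt c * (i0 * i0)
          \<le> cmod (2 * complex_of_real (S m x) * (complex_of_real (I m x) * complex_of_real (I m x)))"
        using Slow Ilow
      proof eventually_elim
        case (elim m)
        show ?case
        proof
          fix x assume "x \<in> K"
          then have "sqrt c \<le> \<bar>S m x\<bar>" "i0 \<le> \<bar>I m x\<bar>" using elim by force+
          then have "2 * sqrt c * (i0 * i0) \<le> 2 * \<bar>S m x\<bar> * (\<bar>I m x\<bar> * \<bar>I m x\<bar>)"
            using c i0 by (intro mult_mono) auto
          then show "2 * sqrt c * (i0 * i0)
              \<le> cmod (2 * complex_of_real (S m x) * (complex_of_real (I m x) * complex_of_real (I m x)))"
            by (simp only: norm_mult norm_of_real norm_numeral)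
        qed
      qed
    qed
    moreover have "R = (\<lambda>m x. - \<zeta> m x * inverse (2 * of_real (S m x) * (of_real (I m x) * of_real (I m x))))"
      unfolding R_def divide_inverse power2_eq_square by (simp only: of_real_mult of_real_numeral)
    ultimately show ?thesis by (simp only:)
  qed
  obtain P1 where P1: "P1 > 0" "\<forall>\<^sub>F m in sequentially. slow_at P1 \<delta> \<eta> K \<theta> m" using slowE[OF slow\<theta>] .
  obtain P2 where P2: "P2 > 0" "\<forall>\<^sub>F m in sequentially. slow_at P2 \<delta> \<eta> K R m" using slowE[OF slowR] .
  \<comment> \<open>One constant for all bounds that \<open>energy_step\<close> asks for:
    \<open>1 / i0\<close> for the weights, \<open>P2\<close> for \<open>R\<close>, and
    \<open>2 * (P1 * P2)\<close> for the increments of the correction.\<close>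
  define P where "P = 1 + 1 / i0 + P2 + P1\<^sup>2 + 2 * (P1 * P2)"
  define h where "h = (\<lambda>m. (1 + P1\<^sup>2) * \<eta> m)"
  have P12: "P1 * P2 \<ge> 0" "P1\<^sup>2 \<ge> 0" "1 / i0 > 0" using P1 P2 i0 by auto
  have P_ge: "1 \<le> P" "1 / i0 \<le> P" "P2 \<le> P" "P1\<^sup>2 \<le> P" "2 * (P1 * P2) \<le> P"
    using P12 P2 by (auto simp: P_def)
  define Z where "Z = (\<lambda>m x. of_real (V m x) + \<theta> m x * of_real (W m x))"
  define d where "d = (\<lambda>m x. \<theta> (Suc m) x - \<theta> m x)"
  define F where "F = (\<lambda>m x. (cmod (Z m x))\<^sup>2 / I m x - Re (cnj (d m x) * R m x * (Z m x)\<^sup>2))"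
  define Q where "Q = 2 * P ^ 3 + P\<^sup>2 * (2 + P) + P * (1 + P)\<^sup>2"
  have Q0: "Q \<ge> 0" using P_ge(1) by (simp add: Q_def)
  \<comment> \<open>Keeps \<open>d\<close> below 1 and the correction below half of the main term,
    so that \<open>F\<close> controls \<open>|Z|^2\<close>.\<close>
  have small: "\<forall>\<^sub>F m in sequentially. \<delta> m < min (1 / P1) (1 / (2 * P1 * (P1 * P2)))"
    using P1 P2 by (intro order_tendstoD(2)[OF \<delta>_tendsto_0]) auto
  note ev = eventually_all_ge_at_top[OF Ilow] eventually_all_ge_at_top[OF P1(2)] eventually_all_ge_at_top[OF P2(2)]
    eventually_all_ge_at_top[OF Slow] eventually_all_ge_at_top[OF Clow] eventually_all_ge_at_top[OF S]
    eventually_all_ge_at_top[OF small]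
  have "\<forall>\<^sub>F m in sequentially. (\<forall>n\<ge>m. \<forall>x\<in>K. i0 \<le> \<bar>I n x\<bar>) \<and> (\<forall>n\<ge>m. slow_at P1 \<delta> \<eta> K \<theta> n) \<and>
    (\<forall>n\<ge>m. slow_at P2 \<delta> \<eta> K R n) \<and> (\<forall>n\<ge>m. \<forall>x\<in>K. sqrt c \<le> S n x) \<and> (\<forall>n\<ge>m. \<forall>x\<in>K. c / C0 \<le> \<bar>C n x\<bar>) \<and>
    (\<forall>n\<ge>m. \<forall>x\<in>K. c \<le> 1 - ((A n x + D n x) / 2)\<^sup>2) \<and> (\<forall>n\<ge>m. \<delta> n < min (1 / P1) (1 / (2 * P1 * (P1 * P2))))"
    using ev by eventually_elim blast
  from eventually_happens'[OF sequentially_bot this] obtain m0 where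
      H: "\<forall>n\<ge>m0. \<forall>x\<in>K. i0 \<le> \<bar>I n x\<bar>" "\<forall>n\<ge>m0. slow_at P1 \<delta> \<eta> K \<theta> n"
        "\<forall>n\<ge>m0. slow_at P2 \<delta> \<eta> K R n" "\<forall>n\<ge>m0. \<forall>x\<in>K. sqrt c \<le> S n x"
        "\<forall>n\<ge>m0. \<forall>x\<in>K. c / C0 \<le> \<bar>C n x\<bar>" "\<forall>n\<ge>m0. \<forall>x\<in>K. c \<le> 1 - ((A n x + D n x) / 2)\<^sup>2"
        "\<forall>n\<ge>m0. \<delta> n < min (1 / P1) (1 / (2 * P1 * (P1 * P2)))"
    by (elim exE conjE)
  note G = H[rule_format]
  have dle: "cmod (d n x) \<le> P1 * \<delta> n" if "n \<ge> m0" "x \<in> K" for n x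
    unfolding d_def using slow_atD(2)[OF G(2)] that by blast
  have Iup: "\<bar>I n x\<bar> \<le> P1" if "n \<ge> m0" "x \<in> K" for n x
    unfolding I_def using slow_atD(1)[OF G(2)[OF that(1)] that(2)] abs_Im_le_cmod order.trans by blast
  have lower: "(cmod (Z n x))\<^sup>2 \<le> 2 * P1 * \<bar>F n x\<bar>" if n: "n \<ge> m0" and x: "x \<in> K" for n x
  proof -
    have "cmod (cnj (d n x) * R n x) \<le> (P1 * \<delta> n) * P2"
      unfolding norm_mult complex_mod_cnj
      by (intro mult_mono' dle that norm_ge_zero slow_atD(1)[OF G(3)[OF n] x])
    also have "\<dots> = (P1 * P2) * \<delta> n" by simp
    also have "\<dots> \<le> (P1 * P2) * (1 / (2 * P1 * (P1 * P2)))"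
      using G(7)[OF n] P1 P2 by (intro mult_left_mono) auto
    also have "\<dots> = 1 / (2 * P1)" using P1 P2 by simp
    finally have "cmod (cnj (d n x) * R n x) \<le> 1 / (2 * P1)" .
    then have "cmod (cnj (d n x) * R n x) * (cmod (Z n x))\<^sup>2 \<le> 1 / (2 * P1) * (cmod (Z n x))\<^sup>2"
      by (rule mult_right_mono) simp
    then have k: "\<bar>Re (cnj (d n x) * R n x * (Z n x)\<^sup>2)\<bar> \<le> 1 / (2 * P1) * (cmod (Z n x))\<^sup>2"
      using abs_Re_le_cmod[of "cnj (d n x) * R n x * (Z n x)\<^sup>2"] by (simp add: norm_mult norm_power)
    have "1 / P1 * (cmod (Z n x))\<^sup>2 \<le> 1 / \<bar>I n x\<bar> * (cmod (Z n x))\<^sup>2"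
      using Iup[OF that] G(1)[OF that] i0 by (intro mult_right_mono divide_left_mono) auto
    also have "\<dots> = \<bar>(cmod (Z n x))\<^sup>2 / I n x\<bar>" by (simp add: abs_divide)
    finally have "1 / P1 * (cmod (Z n x))\<^sup>2 - 1 / (2 * P1) * (cmod (Z n x))\<^sup>2 \<le> \<bar>F n x\<bar>"
      using k unfolding F_def by linarith
    then show ?thesis using P1 by (simp add: field_simps)
  qed
  have step: "\<bar>F (Suc n) x\<bar> \<le> \<bar>F n x\<bar> * (1 + 2 * P1 * Q * h n)" if n: "n \<ge> m0" and x: "x \<in> K" for n x
  proof -
    have n': "Suc n \<ge> m0" using n by simp
    have nz: "I n x \<noteq> 0" "I (Suc n) x \<noteq> 0" "C n x \<noteq> 0"
      using G(1)[OF n x] G(1)[OF n' x] G(5)[OF n x] i0 cC0 by auto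
    have Spos: "S n x > 0" using G(4)[OF n x] c by (metis less_le_trans real_sqrt_gt_zero)
    have S2: "(S n x)\<^sup>2 = 1 - ((A n x + D n x) / 2)\<^sup>2"
      using G(6)[OF n x] c by (simp add: S_def)
    have \<zeta>1: "cmod (\<zeta> n x) = 1"
      unfolding cmod_def \<zeta>_def complex.sel S2 by simp
    have char: "(\<zeta> n x)\<^sup>2 = of_real (A n x + D n x) * \<zeta> n x - 1"
      using S2 by (simp add: \<zeta>_def complex_eq_iff power2_eq_square field_simps)
    have eig1: "of_real (A n x) + \<theta> n x * of_real (C n x) = \<zeta> n x"
      using nz by (simp add: \<theta>_def)
    \<comment> \<open>The second eigenvector equation is checked after multiplication by
      \<open>C\<close>, where it follows from the first one, the determinant and the characteristic
      equation.\<close>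
    have eig2: "of_real (B n x) + \<theta> n x * of_real (D n x) = \<zeta> n x * \<theta> n x"
    proof -
      have bc: "of_real (B n x) * of_real (C n x) = (of_real (A n x) * of_real (D n x) - 1 :: complex)"
      proof -
        have "B n x * C n x = A n x * D n x - 1" using det[of n x] by linarith
        then have "of_real (B n x * C n x) = (of_real (A n x * D n x - 1) :: complex)" by (rule arg_cong)
        then show ?thesis by (simp only: of_real_mult of_real_diff of_real_1)
      qed
      have t: "of_real (C n x) * \<theta> n x = \<zeta> n x - of_real (A n x)"
        using nz by (simp add: \<theta>_def)
      have char': "(\<zeta> n x)\<^sup>2 = (of_real (A n x) + of_real (D n x)) * \<zeta> n x - 1"
        using char by (simp only: of_real_add)
      have key: "p + u * v = z * u" if "p = a * v - 1" "u = z - a" "z\<^sup>2 = (a + v) * z - 1" for p u v z a :: complex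
        unfolding that(1,2) using that(3) by (simp add: algebra_simps power2_eq_square)
      have "of_real (C n x) * (of_real (B n x) + \<theta> n x * of_real (D n x)) =
          of_real (B n x) * of_real (C n x) + (of_real (C n x) * \<theta> n x) * of_real (D n x)"
        by (simp add: algebra_simps)
      also have "\<dots> = \<zeta> n x * (of_real (C n x) * \<theta> n x)"
        by (rule key[OF bc t char'])
      finally have "of_real (C n x) * (of_real (B n x) + \<theta> n x * of_real (D n x)) =
          \<zeta> n x * (of_real (C n x) * \<theta> n x)" .
      then have "of_real (C n x) * (of_real (B n x) + \<theta> n x * of_real (D n x)) = of_real (C n x) * (\<zeta> n x * \<theta> n x)"
        by (simp only: mult.left_commute)
      then show ?thesis using nz by simp
    qed
    define Y where "Y = \<zeta> n x * Z n x"
    have Y: "of_real (V (Suc n) x) + \<theta> n x * of_real (W (Suc n) x) = Y"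
    proof -
      have "of_real (V (Suc n) x) + \<theta> n x * of_real (W (Suc n) x) =
        (of_real (A n x) + \<theta> n x * of_real (C n x)) * of_real (V n x) +
        (of_real (B n x) + \<theta> n x * of_real (D n x)) * of_real (W n x)"
        by (simp add: V W algebra_simps)
      then show ?thesis unfolding eig1 eig2 Y_def Z_def by (simp add: algebra_simps)
    qed
    \<comment> \<open>\<open>V\<close> and \<open>W\<close> are real, so the new \<open>W\<close> is
      recovered from the imaginary part of \<open>Y\<close>, which is formed with the old
      \<open>\<theta>\<close>.\<close>
    have "Im Y = I n x * W (Suc n) x" unfolding Y[symmetric] by (simp add: I_def)
    then have W': "W (Suc n) x = Im Y / I n x" using nz by simp
    have Z': "Z (Suc n) x = Y + d n x * of_real (Im Y / I n x)"
      unfolding W'[symmetric] unfolding Y[symmetric] d_def Z_def by (simp add: algebra_simps)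
    have dn: "cmod (d n x) \<le> P1 * \<delta> n" using dle[OF n x] .
    have "\<bar>F (Suc n) x - F n x\<bar> \<le> Q * h n * (cmod (Z n x))\<^sup>2"
      unfolding F_def Q_def
    proof (rule energy_step[where \<zeta> = "\<zeta> n x" and s = "S n x" and Y = Y])
      show "Im (\<zeta> n x) = S n x" by (simp add: \<zeta>_def)
      show "I (Suc n) x = I n x + Im (d n x)" by (simp add: I_def d_def)
      show "1 / \<bar>I n x\<bar> \<le> P" "1 / \<bar>I (Suc n) x\<bar> \<le> P"
        using G(1)[OF n x] G(1)[OF n' x] i0 by (auto intro!: order.trans[OF _ P_ge(2)] divide_left_mono)
      show "cmod (R n x) \<le> P"
        using slow_atD(1)[OF G(3)[OF n] x] P_ge(3) by linarith
      have eq: "cnj (d (Suc n) x) * R (Suc n) x - cnj (d n x) * R n x =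
         cnj (d (Suc n) x - d n x) * R (Suc n) x + cnj (d n x) * (R (Suc n) x - R n x)"
        by (simp add: algebra_simps)
      have d2: "cmod (d (Suc n) x - d n x) \<le> P1 * \<eta> n"
        using slow_atD(3)[OF G(2)[OF n] x] by (simp add: d_def algebra_simps)
      have "cmod (cnj (d (Suc n) x) * R (Suc n) x - cnj (d n x) * R n x) \<le>
          (P1 * \<eta> n) * P2 + (P1 * \<delta> n) * (P2 * \<delta> n)"
        unfolding eq
      proof (rule norm_triangle_le, rule add_mono)
        show "cmod (cnj (d (Suc n) x - d n x) * R (Suc n) x) \<le> (P1 * \<eta> n) * P2"
          unfolding norm_mult complex_mod_cnj
          by (intro mult_mono' d2 slow_atD(1)[OF G(3)[OF n'] x] norm_ge_zero)
        show "cmod (cnj (d n x) * (R (Suc n) x - R n x)) \<le> (P1 * \<delta> n) * (P2 * \<delta> n)"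
          unfolding norm_mult complex_mod_cnj
          by (intro mult_mono' dn slow_atD(2)[OF G(3)[OF n] x] norm_ge_zero)
      qed
      also have "\<dots> = P1 * P2 * \<eta> n + P1 * P2 * (\<delta> n)\<^sup>2" by (simp add: power2_eq_square)
      also have "\<dots> \<le> P1 * P2 * \<eta> n + P1 * P2 * \<eta> n"
        using \<delta>_square(1)[of n] P12 by (intro add_left_mono mult_left_mono) auto
      also have "\<dots> = 2 * (P1 * P2) * \<eta> n" by simp
      also have "\<dots> \<le> P * \<eta> n" using P_ge \<eta>_nonneg by (intro mult_right_mono) auto
      also have "\<dots> \<le> P * h n"
        unfolding h_def using P_ge \<eta>_nonneg[of n] P12 by (intro mult_left_mono) (auto simp: algebra_simps)
      finally show "cmod (cnj (d (Suc n) x) * R (Suc n) x - cnj (d n x) * R n x) \<le> P * h n" .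
      have "(cmod (d n x))\<^sup>2 \<le> (P1 * \<delta> n)\<^sup>2" using dn by (intro power_mono) auto
      also have "\<dots> \<le> P1\<^sup>2 * \<eta> n"
        unfolding power_mult_distrib using \<delta>_square(1)[of n] by (intro mult_left_mono) auto
      also have "\<dots> \<le> h n" unfolding h_def using \<eta>_nonneg[of n] by (simp add: algebra_simps)
      finally show "(cmod (d n x))\<^sup>2 \<le> h n" .
      have "P1 * \<delta> n \<le> P1 * (1 / P1)" using G(7)[OF n] P1 by (intro mult_left_mono) auto
      then show "cmod (d n x) \<le> 1" using dn P1 by simp
    qed (use nz Spos \<zeta>1 Z' in \<open>auto simp: R_def Y_def\<close>)
    also have "\<dots> \<le> Q * h n * (2 * P1 * \<bar>F n x\<bar>)"
      using Q0 \<eta>_nonneg P12 by (intro mult_left_mono lower[OF n x]) (auto simp: h_def)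
    finally have "\<bar>F (Suc n) x - F n x\<bar> \<le> \<bar>F n x\<bar> * (2 * P1 * Q * h n)" by (simp add: mult_ac)
    moreover have "\<bar>F n x\<bar> * (1 + 2 * P1 * Q * h n) = \<bar>F n x\<bar> + \<bar>F n x\<bar> * (2 * P1 * Q * h n)"
      by (simp add: algebra_simps)
    ultimately show ?thesis by linarith
  qed
  define e where "e = (\<lambda>n. 2 * P1 * Q * h n)"
  have e: "0 \<le> e n" "summable e" for n
    using P1 Q0 \<eta>_nonneg P12 \<eta>_summable unfolding e_def h_def by (auto intro!: summable_mult)
  obtain c0 where c0: "\<And>x. x \<in> K \<Longrightarrow> (V m0 x)\<^sup>2 + (W m0 x)\<^sup>2 \<le> c0" using bdd[of m0] by blast
  have Zbound: "(cmod (Z n x))\<^sup>2 \<le> 2 * (1 + P1\<^sup>2) * ((V n x)\<^sup>2 + (W n x)\<^sup>2)" if n: "n \<ge> m0" and x: "x \<in> K" for n x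
  proof -
    have "cmod (Z n x) \<le> \<bar>V n x\<bar> + P1 * \<bar>W n x\<bar>"
      unfolding Z_def using slow_atD(1)[OF G(2)[OF n] x]
      by (intro norm_triangle_le add_mono) (auto simp: norm_mult intro!: mult_right_mono)
    then have "(cmod (Z n x))\<^sup>2 \<le> (\<bar>V n x\<bar> + P1 * \<bar>W n x\<bar>)\<^sup>2" by (intro power_mono) auto
    also have "\<dots> \<le> 2 * (\<bar>V n x\<bar>\<^sup>2 + (P1 * \<bar>W n x\<bar>)\<^sup>2)"
      using sum_squares_bound[of "\<bar>V n x\<bar>" "P1 * \<bar>W n x\<bar>"] by (simp add: power2_sum)
    also have "\<dots> \<le> 2 * (1 + P1\<^sup>2) * ((V n x)\<^sup>2 + (W n x)\<^sup>2)"
      by (simp add: power_mult_distrib algebra_simps)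
    finally show ?thesis .
  qed
  define F0 where "F0 = (1 / i0 + P1 * P2 * (1 / P1)) * (2 * (1 + P1\<^sup>2) * c0)"
  have F0: "\<bar>F m0 x\<bar> \<le> F0" if x: "x \<in> K" for x
  proof -
    have "P1 * \<delta> m0 \<le> P1 * (1 / P1)" using G(7)[of m0] P1 by (intro mult_left_mono) auto
    then have d1: "cmod (d m0 x) \<le> P1 * (1 / P1)" using dle[of m0 x] x by simp
    have "\<bar>F m0 x\<bar> \<le> \<bar>(cmod (Z m0 x))\<^sup>2 / I m0 x\<bar> + cmod (cnj (d m0 x) * R m0 x * (Z m0 x)\<^sup>2)"
      unfolding F_def by (rule order.trans[OF abs_triangle_ineq4 add_left_mono[OF abs_Re_le_cmod]])
    also have "\<bar>(cmod (Z m0 x))\<^sup>2 / I m0 x\<bar> \<le> 1 / i0 * (cmod (Z m0 x))\<^sup>2"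
    proof -
      have "1 / \<bar>I m0 x\<bar> * (cmod (Z m0 x))\<^sup>2 \<le> 1 / i0 * (cmod (Z m0 x))\<^sup>2"
        using G(1)[of m0 x] x i0 by (intro mult_right_mono divide_left_mono) auto
      then show ?thesis by (simp add: abs_divide)
    qed
    also have "cmod (cnj (d m0 x) * R m0 x * (Z m0 x)\<^sup>2) \<le> (P1 * (1 / P1)) * P2 * (cmod (Z m0 x))\<^sup>2"
      unfolding norm_mult complex_mod_cnj norm_power
      by (intro mult_right_mono mult_mono' d1 slow_atD(1)[OF G(3)[OF order_refl] x]) auto
    also have "1 / i0 * (cmod (Z m0 x))\<^sup>2 + (P1 * (1 / P1)) * P2 * (cmod (Z m0 x))\<^sup>2 =
       (1 / i0 + P1 * P2 * (1 / P1)) * (cmod (Z m0 x))\<^sup>2" by (simp add: algebra_simps)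
    also have "\<dots> \<le> F0"
      unfolding F0_def
    proof (rule mult_left_mono)
      have "2 * (1 + P1\<^sup>2) * ((V m0 x)\<^sup>2 + (W m0 x)\<^sup>2) \<le> 2 * (1 + P1\<^sup>2) * c0"
        using c0[OF x] P12 by (intro mult_left_mono) auto
      then show "(cmod (Z m0 x))\<^sup>2 \<le> 2 * (1 + P1\<^sup>2) * c0" using Zbound[OF order_refl x] by linarith
    qed (use P1 P2 i0 in auto)
    finally show ?thesis by simp
  qed
  define M0 where "M0 = 2 * P1 * (F0 * exp (suminf e))"
  have ZM: "(cmod (Z n x))\<^sup>2 \<le> M0" if n: "n \<ge> m0" and x: "x \<in> K" for n x
  proof -
    have "\<bar>F n x\<bar> \<le> \<bar>F m0 x\<bar> * exp (suminf e)"
      by (rule summable_growth_bound[OF _ e _ n]) (use step x in \<open>auto simp: e_def\<close>)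
    also have "\<dots> \<le> F0 * exp (suminf e)" using F0[OF x] by (intro mult_right_mono) auto
    finally show ?thesis
      using lower[OF n x] P1 unfolding M0_def by (meson mult_left_mono order.trans less_imp_le mult_pos_pos zero_less_numeral)
  qed
  define M where "M = 2 * M0 + (1 + 2 * P1\<^sup>2) * (M0 / i0\<^sup>2)"
  have "(V n x)\<^sup>2 + (W n x)\<^sup>2 \<le> M" if n: "n \<ge> m0" and x: "x \<in> K" for n x
  proof -
    \<comment> \<open>Definiteness of the form: \<open>Im Z\<close> controls \<open>W\<close>, and
      then \<open>Z\<close> and \<open>W\<close> control \<open>V\<close>.\<close>
    have "I n x * W n x = Im (Z n x)" by (simp add: Z_def I_def)
    then have "i0 * \<bar>W n x\<bar> \<le> cmod (Z n x)"
      using G(1)[OF n x] abs_Im_le_cmod[of "Z n x"] mult_right_mono[of i0 "\<bar>I n x\<bar>" "\<bar>W n x\<bar>"]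
      by (simp add: abs_mult[symmetric])
    then have "(i0 * \<bar>W n x\<bar>)\<^sup>2 \<le> (cmod (Z n x))\<^sup>2" using i0 by (intro power_mono) auto
    then have "i0\<^sup>2 * (W n x)\<^sup>2 \<le> M0" using ZM[OF n x] by (simp add: power_mult_distrib)
    then have w: "(W n x)\<^sup>2 \<le> M0 / i0\<^sup>2" using i0 by (simp add: field_simps)
    have "of_real (V n x) = Z n x - \<theta> n x * of_real (W n x)" by (simp add: Z_def)
    then have "\<bar>V n x\<bar> \<le> cmod (Z n x) + cmod (\<theta> n x) * \<bar>W n x\<bar>"
      by (metis norm_of_real norm_mult norm_triangle_ineq4)
    also have "\<dots> \<le> cmod (Z n x) + P1 * \<bar>W n x\<bar>"
      using slow_atD(1)[OF G(2)[OF n] x] by (intro add_left_mono mult_right_mono) auto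
    finally have "\<bar>V n x\<bar>\<^sup>2 \<le> (cmod (Z n x) + P1 * \<bar>W n x\<bar>)\<^sup>2" by (intro power_mono) auto
    also have "\<dots> \<le> 2 * ((cmod (Z n x))\<^sup>2 + (P1 * \<bar>W n x\<bar>)\<^sup>2)"
      using sum_squares_bound[of "cmod (Z n x)" "P1 * \<bar>W n x\<bar>"] by (simp add: power2_sum)
    finally have "(V n x)\<^sup>2 \<le> 2 * M0 + 2 * P1\<^sup>2 * (W n x)\<^sup>2"
      using ZM[OF n x] by (simp add: power_mult_distrib)
    then have "(V n x)\<^sup>2 + (W n x)\<^sup>2 \<le> 2 * M0 + (1 + 2 * P1\<^sup>2) * (W n x)\<^sup>2" by (simp add: algebra_simps)
    also have "\<dots> \<le> M" unfolding M_def using w P12 by (intro add_left_mono mult_left_mono) auto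
    finally show ?thesis .
  qed
  then show ?thesis by (auto simp: eventually_sequentially)
qed

end

section \<open>Chebyshev polynomials and the discriminant\<close>

text \<open>Chebyshev polynomials of the second kind, \<open>U_(n-1) (y / 2)\<close>, obtained as
  orthogonal polynomials of the free matrix.\<close>

abbreviation cheb :: "nat \<Rightarrow> real \<Rightarrow> real" where
  "cheb n y \<equiv> orth (\<lambda>_. 0) n y"

text \<open>For \<open>q \<ge> 1\<close> this is \<open>2 * T_q (y / 2)\<close> with the Chebyshev
  polynomial of the first kind.\<close>

definition disc :: "nat \<Rightarrow> real \<Rightarrow> real" where
  "disc q y = cheb (Suc q) y - cheb (q - 1) y"

lemma abs_less_square_iff: "\<bar>x\<bar> < \<bar>y\<bar> \<longleftrightarrow> x\<^sup>2 < (y\<^sup>2 :: real)"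
  by (meson abs_le_square_iff not_le)

lemma cheb_Suc_Suc: "cheb (Suc (Suc n)) y = y * cheb (Suc n) y - cheb n y"
  unfolding orth_Suc_Suc by simp

lemma cheb_det: "(cheb (Suc n) y)\<^sup>2 - cheb n y * cheb (Suc (Suc n)) y = 1"
proof (induction n)
  case (Suc n)
  show ?case
    using Suc unfolding cheb_Suc_Suc[of "Suc n"]
    by (simp add: cheb_Suc_Suc power2_eq_square algebra_simps del: orth_poly.simps(3))
qed simp

text \<open>Pell's identity for Chebyshev polynomials, which locates band edges and touching points
  at once.\<close>

lemma disc_square:
  assumes "q \<ge> 1"
  shows "(disc q y)\<^sup>2 = 4 + (y\<^sup>2 - 4) * (cheb q y)\<^sup>2"
proof -
  obtain n where q: "q = Suc n" using assms by (cases q) auto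
  show ?thesis
    using cheb_det[of n y] unfolding q disc_def cheb_Suc_Suc
    by (simp add: power2_eq_square algebra_simps)
qed

lemma cheb_growth: "\<bar>y\<bar> \<ge> 2 \<Longrightarrow> \<bar>cheb n y\<bar> + 1 \<le> \<bar>cheb (Suc n) y\<bar>"
proof (induction n)
  case (Suc n)
  have "2 * \<bar>cheb (Suc n) y\<bar> \<le> \<bar>y * cheb (Suc n) y\<bar>"
    using Suc.prems unfolding abs_mult by (intro mult_right_mono) auto
  then show ?case
    using Suc.IH[OF Suc.prems] unfolding cheb_Suc_Suc by linarith
qed simp

text \<open>Linear growth is the exact rate at \<open>y = 2\<close>. Since it holds on the whole
  closed complement of the band, the edges of a gap are treated together with its interior.\<close>

lemma cheb_ge: "\<bar>y\<bar> \<ge> 2 \<Longrightarrow> real n \<le> \<bar>cheb n y\<bar>"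
proof (induction n)
  case (Suc n)
  then show ?case using cheb_growth[of y n] by linarith
qed simp

lemma cheb_trig: "cheb n (2 * cos t) * sin t = sin (real n * t)"
proof (induction n rule: induct_nat_012)
  case (ge2 n)
  have "cheb (Suc (Suc n)) (2 * cos t) * sin t = 2 * cos t * sin (real (Suc n) * t) - sin (real n * t)"
    unfolding cheb_Suc_Suc using ge2 by (simp add: algebra_simps del: orth_poly.simps)
  also have "real n * t = real (Suc n) * t - t" by (simp add: algebra_simps)
  also have "2 * cos t * sin (real (Suc n) * t) - sin (real (Suc n) * t - t) = sin (real (Suc n) * t + t)"
    unfolding sin_add sin_diff by simp
  also have "real (Suc n) * t + t = real (Suc (Suc n)) * t" by (simp add: algebra_simps)
  finally show ?case .
qed auto

lemma continuous_on_orth [continuous_intros]: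
  "continuous_on S f \<Longrightarrow> continuous_on S (\<lambda>x. orth b n (f x))"
  by (rule continuous_on_poly)

lemma continuous_on_disc [continuous_intros]:
  "continuous_on S f \<Longrightarrow> continuous_on S (\<lambda>x. disc q (f x))"
  unfolding disc_def by (intro continuous_intros)

lemma cheb_nonzero_poly: "q \<ge> 1 \<Longrightarrow> orth_poly (\<lambda>_. 0) q \<noteq> 0"
  using cheb_ge[of 2 q] by auto

lemma finite_cheb_zeros: "q \<ge> 1 \<Longrightarrow> finite {z. cheb q z = 0}"
  by (rule poly_roots_finite[OF cheb_nonzero_poly])

text \<open>The diagonal Christoffel-Darboux formula; the sum of squares fixes the sign of the
  derivative at a zero.\<close>

lemma orth_Christoffel_Darboux:
  "poly (pderiv (orth_poly b (Suc n))) x * orth b n x - orth b (Suc n) x * poly (pderiv (orth_poly b n)) x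
    = (\<Sum>k\<le>n. (orth b k x)\<^sup>2)"
proof (induction n)
  case (Suc n)
  have d: "poly (pderiv (orth_poly b (Suc (Suc n)))) x =
    (x - b (Suc n)) * poly (pderiv (orth_poly b (Suc n))) x + orth b (Suc n) x - poly (pderiv (orth_poly b n)) x"
    by (simp add: pderiv_diff pderiv_add pderiv_smult pderiv_mult pderiv_pCons algebra_simps del: mult_pCons_left)
  show ?case
    using Suc unfolding d orth_Suc_Suc sum.atMost_Suc[of _ n]
    by (simp add: power2_eq_square algebra_simps)
qed simp

text \<open>At such a zero \<open>disc q z\<close> equals \<open>2 * cheb (Suc q) z\<close>, and
  Christoffel-Darboux turns \<open>- cheb (Suc q) z\<close> times the derivative into a positive
  sum. The sign decides that a positive bump opens the gap to the right of \<open>z\<close>.\<close>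

lemma disc_cheb_deriv:
  assumes "q \<ge> 1" "cheb q z = 0"
  shows "disc q z * poly (pderiv (orth_poly (\<lambda>_. 0) q)) z < 0"
proof -
  obtain n where q: "q = Suc n" using assms by (cases q) auto
  have c: "cheb (Suc q) z = - cheb (q - 1) z"
    using assms(2) unfolding q cheb_Suc_Suc by simp
  have "(\<Sum>k\<in>{1}. (cheb k z)\<^sup>2) \<le> (\<Sum>k\<le>q. (cheb k z)\<^sup>2)"
    using assms by (intro sum_mono2) auto
  then have "(\<Sum>k\<le>q. (cheb k z)\<^sup>2) > 0" by simp
  then show ?thesis
    using orth_Christoffel_Darboux[of "\<lambda>_. 0" q z] assms(2) c
    by (simp add: disc_def mult.commute del: orth_poly.simps)
qed

text \<open>Just to the right of \<open>z\<close>, \<open>disc\<close> and \<open>cheb\<close> have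
  opposite signs, so \<open>- \<epsilon> * cheb\<close> enlarges the modulus of the trace. By Pell's
  identity \<open>disc^2\<close> falls short of 4 by an amount quadratic in \<open>cheb\<close>,
  whereas the gain is of order \<open>\<epsilon> * |cheb|\<close>; it wins as long as
  \<open>h\<close> is at most a small multiple of \<open>\<epsilon>\<close>.\<close>

lemma gap_opening:
  assumes q: "q \<ge> 1" and z: "cheb q z = 0"
  obtains \<kappa> where "\<kappa> > 0"
    "\<And>\<epsilon> h. 0 < \<epsilon> \<Longrightarrow> \<epsilon> \<le> 1 \<Longrightarrow> 0 < h \<Longrightarrow> h \<le> \<kappa> * \<epsilon> \<Longrightarrow> 2 \<le> \<bar>disc q (z + h) - \<epsilon> * cheb q (z + h)\<bar>"
proof -
  define c' where "c' = poly (pderiv (orth_poly (\<lambda>_. 0) q)) z"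
  define \<sigma> where "\<sigma> = disc q z / 2"
  have "(disc q z)\<^sup>2 = 2\<^sup>2" using disc_square[OF q, of z] z by simp
  then have "disc q z = 2 \<or> disc q z = - 2" by (simp only: power2_eq_iff)
  then have \<sigma>: "\<sigma> = 1 \<or> \<sigma> = - 1" by (auto simp: \<sigma>_def)
  have neg: "\<sigma> * c' < 0" using disc_cheb_deriv[OF q z] by (simp add: \<sigma>_def c'_def)
  have "((\<lambda>h. (cheb q (z + h) - cheb q z) / h) \<longlongrightarrow> c') (at 0)"
    using poly_DERIV[of "orth_poly (\<lambda>_. 0) q" z] unfolding DERIV_def c'_def .
  then have "\<forall>\<^sub>F h in at 0. dist ((cheb q (z + h) - cheb q z) / h) c' < \<bar>c'\<bar> / 2"
    by (rule tendstoD) (use neg in auto)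
  then obtain h1 where h1: "h1 > 0"
    "\<And>h. h \<noteq> 0 \<Longrightarrow> \<bar>h\<bar> < h1 \<Longrightarrow> \<bar>cheb q (z + h) / h - c'\<bar> < \<bar>c'\<bar> / 2"
    unfolding eventually_at dist_real_def z by auto
  have "continuous_on UNIV (\<lambda>h. disc q (z + h))" by (intro continuous_intros)
  then have "((\<lambda>h. \<sigma> * disc q (z + h)) \<longlongrightarrow> \<sigma> * disc q (z + 0)) (at 0)"
    by (intro tendsto_intros isContD) (auto simp: continuous_on_eq_continuous_at)
  moreover have "\<sigma> * disc q (z + 0) > 1" using \<sigma> by (auto simp: \<sigma>_def)
  ultimately have "\<forall>\<^sub>F h in at 0. \<sigma> * disc q (z + h) > 1" by (rule order_tendstoD)
  then obtain h2 where h2: "h2 > 0" "\<And>h. h \<noteq> 0 \<Longrightarrow> \<bar>h\<bar> < h2 \<Longrightarrow> \<sigma> * disc q (z + h) > 1"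
    by (auto simp: eventually_at dist_real_def)
  \<comment> \<open>The first bound keeps \<open>h\<close> in both neighbourhoods found above; the
    second makes \<open>3 / 2 * |c'| * h\<close>, a bound for \<open>|c|\<close>, at most
    \<open>\<epsilon> / 2\<close>.\<close>
  define \<kappa> where "\<kappa> = min (min h1 h2 / 2) (1 / (3 * \<bar>c'\<bar>))"
  have c': "\<bar>c'\<bar> > 0" using neg by auto
  show thesis
  proof
    show "\<kappa> > 0" using h1 h2 c' by (simp add: \<kappa>_def)
    fix \<epsilon> h :: real assume \<epsilon>: "0 < \<epsilon>" "\<epsilon> \<le> 1" and h: "0 < h" "h \<le> \<kappa> * \<epsilon>"
    have "\<kappa> * \<epsilon> \<le> \<kappa> * 1" using \<epsilon> \<open>\<kappa> > 0\<close> by (intro mult_left_mono) auto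
    then have hs: "\<bar>h\<bar> < h1" "\<bar>h\<bar> < h2" using h h1(1) h2(1) by (auto simp: \<kappa>_def)
    define c where "c = cheb q (z + h)"
    define t where "t = disc q (z + h)"
    have quot: "\<bar>c / h - c'\<bar> < \<bar>c'\<bar> / 2" using h1(2)[of h] h hs by (simp add: c_def)
    have t1: "\<sigma> * t > 1" using h2(2)[of h] h hs by (simp add: t_def)
    have "\<bar>c / h\<bar> \<le> 3 / 2 * \<bar>c'\<bar>" using quot by linarith
    then have "\<bar>c\<bar> \<le> 3 / 2 * \<bar>c'\<bar> * h" using h by (simp add: field_simps abs_divide)
    also have "\<dots> \<le> 3 / 2 * \<bar>c'\<bar> * (1 / (3 * \<bar>c'\<bar>) * \<epsilon>)"
    proof (intro mult_left_mono)
      have "\<kappa> * \<epsilon> \<le> 1 / (3 * \<bar>c'\<bar>) * \<epsilon>" using \<epsilon> by (intro mult_right_mono) (auto simp: \<kappa>_def)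
      then show "h \<le> 1 / (3 * \<bar>c'\<bar>) * \<epsilon>" using h by linarith
    qed auto
    also have "\<dots> = \<epsilon> / 2" using c' by simp
    finally have c_le: "\<bar>c\<bar> \<le> \<epsilon> / 2" .
    have sgn: "\<sigma> * c < 0"
    proof -
      have "\<sigma> * u < 0" if "\<bar>u - c'\<bar> < \<bar>c'\<bar> / 2" for u
        using that neg \<sigma> by (auto simp: abs_if split: if_splits)
      then have "\<sigma> * (c / h) < 0" using quot .
      then show ?thesis using h by (simp add: divide_less_0_iff mult_less_0_iff)
    qed
    have "\<bar>c\<bar> = - (\<sigma> * c)" using sgn \<sigma> by auto
    have prod: "- (t * c) = (\<sigma> * t) * (- (\<sigma> * c))" using \<sigma> by auto
    have "c\<^sup>2 = \<bar>c\<bar> * \<bar>c\<bar>" by (simp add: power2_eq_square)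
    also have "\<dots> \<le> \<epsilon> / 2 * \<bar>c\<bar>" using c_le by (intro mult_right_mono) auto
    also have "\<dots> = \<epsilon> / 2 * (1 * (- (\<sigma> * c)))" using \<open>\<bar>c\<bar> = - (\<sigma> * c)\<close> by simp
    also have "\<dots> \<le> \<epsilon> / 2 * ((\<sigma> * t) * (- (\<sigma> * c)))"
      using t1 sgn \<epsilon> by (intro mult_left_mono mult_right_mono) auto
    finally have key: "4 * c\<^sup>2 \<le> - 2 * \<epsilon> * (t * c)" unfolding prod[symmetric] by (simp add: algebra_simps)
    have "(t - \<epsilon> * c)\<^sup>2 = t\<^sup>2 - 2 * \<epsilon> * (t * c) + \<epsilon>\<^sup>2 * c\<^sup>2" by (simp add: power2_eq_square algebra_simps)
    also have "t\<^sup>2 = 4 + (z + h)\<^sup>2 * c\<^sup>2 - 4 * c\<^sup>2"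
      unfolding t_def c_def disc_square[OF q] by (simp add: algebra_simps)
    finally have e: "(t - \<epsilon> * c)\<^sup>2 = 4 + (z + h)\<^sup>2 * c\<^sup>2 - 4 * c\<^sup>2 - 2 * \<epsilon> * (t * c) + \<epsilon>\<^sup>2 * c\<^sup>2" .
    have "0 \<le> (z + h)\<^sup>2 * c\<^sup>2" "0 \<le> \<epsilon>\<^sup>2 * c\<^sup>2" by simp_all
    moreover have "- 2 * \<epsilon> * (t * c) = - (2 * \<epsilon> * (t * c))" by simp
    ultimately have "(t - \<epsilon> * c)\<^sup>2 \<ge> 4"
      using key e by linarith
    then show "2 \<le> \<bar>disc q (z + h) - \<epsilon> * cheb q (z + h)\<bar>"
      unfolding c_def[symmetric] t_def[symmetric] using abs_le_square_iff[of 2 "t - \<epsilon> * c"] by simp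
  qed
qed

lemma disc_gt_2:
  assumes "q \<ge> 1" "\<bar>y\<bar> > 2"
  shows "\<bar>disc q y\<bar> > 2"
proof -
  have "cheb q y \<noteq> 0" using cheb_ge[of y q] assms by auto
  moreover have "y\<^sup>2 > 2\<^sup>2" using assms abs_less_square_iff[of 2 y] by simp
  ultimately have "(disc q y)\<^sup>2 > 2\<^sup>2" unfolding disc_square[OF assms(1)] by simp
  then show ?thesis using abs_less_square_iff[of 2 "disc q y"] by simp
qed

lemma disc_ge_2_cases:
  assumes "q \<ge> 1" "\<bar>disc q y\<bar> \<ge> 2"
  shows "\<bar>y\<bar> \<ge> 2 \<or> cheb q y = 0"
proof (rule ccontr)
  assume "\<not> (\<bar>y\<bar> \<ge> 2 \<or> cheb q y = 0)"
  then have "y\<^sup>2 < 2\<^sup>2" "(cheb q y)\<^sup>2 > 0" using abs_less_square_iff[of y 2] by auto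
  then have "(y\<^sup>2 - 4) * (cheb q y)\<^sup>2 < 0" by (intro mult_neg_pos) auto
  moreover have "(disc q y)\<^sup>2 \<ge> 2\<^sup>2" using assms(2) abs_le_square_iff[of 2 "disc q y"] by simp
  ultimately show False unfolding disc_square[OF assms(1)] by simp
qed

lemma disc_cheb_zero: "q \<ge> 1 \<Longrightarrow> cheb q z = 0 \<Longrightarrow> \<bar>disc q z\<bar> = 2"
  using disc_square[of q z] power2_eq_iff[of "disc q z" 2] by auto

lemma exists_elliptic:
  assumes "q \<ge> 1"
  obtains y where "\<bar>disc q y\<bar> < 2"
proof -
  have "infinite {-1..1::real}" by (simp add: infinite_Icc_iff)
  with finite_cheb_zeros[OF assms] obtain y where y: "y \<in> {-1..1}" "cheb q y \<noteq> 0"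
    by (metis (mono_tags, lifting) finite_subset mem_Collect_eq subsetI)
  then have "\<not> \<bar>disc q y\<bar> \<ge> 2" using disc_ge_2_cases[OF assms, of y] by auto
  then have "\<bar>disc q y\<bar> < 2" by linarith
  then show thesis by (rule that)
qed

lemma exists_cheb_zero:
  assumes "q > 1"
  obtains z where "cheb q z = 0" "\<bar>z\<bar> < 2"
proof
  let ?t = "pi / real q"
  have t: "0 < ?t" "?t < pi" using assms by (auto simp: field_simps)
  have s: "sin ?t > 0" using t by (rule sin_gt_zero)
  then show "cheb q (2 * cos ?t) = 0"
    using cheb_trig[of q ?t] assms by auto
  have "(cos ?t)\<^sup>2 < 1\<^sup>2" unfolding cos_squared_eq using s by simp
  then show "\<bar>2 * cos ?t\<bar> < 2" using abs_less_square_iff[of "cos ?t" 1] by simp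
qed

text \<open>Entries of the transfer matrix over \<open>q\<close> sites, acting on the two values at
  their start. The bump sits on the first site, whose factor acts first, so \<open>e\<close> enters
  only the first column.\<close>

definition T11 :: "nat \<Rightarrow> real \<Rightarrow> real \<Rightarrow> real" where "T11 q e y = cheb (Suc q) y - e * cheb q y"
definition T12 :: "nat \<Rightarrow> real \<Rightarrow> real" where "T12 q y = - cheb q y"
definition T21 :: "nat \<Rightarrow> real \<Rightarrow> real \<Rightarrow> real" where "T21 q e y = cheb q y - e * cheb (q - 1) y"
definition T22 :: "nat \<Rightarrow> real \<Rightarrow> real" where "T22 q y = - cheb (q - 1) y"

lemma T_det: "q \<ge> 1 \<Longrightarrow> T11 q e y * T22 q y - T12 q y * T21 q e y = 1"
  using cheb_det[of "q - 1" y]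
  by (cases q) (auto simp: T11_def T12_def T21_def T22_def power2_eq_square algebra_simps simp del: orth_poly.simps)

lemma T_trace: "T11 q e y + T22 q y = disc q y - e * cheb q y"
  by (simp add: T11_def T22_def disc_def)

lemma orth_block:
  assumes q: "q \<ge> 2" and b1: "b (Suc s) = g + e" and b2: "\<And>i. 2 \<le> i \<Longrightarrow> i \<le> q \<Longrightarrow> b (s + i) = g"
  shows "orth b (Suc (s + q)) x = T11 q e (x - g) * orth b (Suc s) x + T12 q (x - g) * orth b s x"
    and "orth b (s + q) x = T21 q e (x - g) * orth b (Suc s) x + T22 q (x - g) * orth b s x"
proof -
  let ?y = "x - g"
  have p2: "orth b (Suc (Suc s)) x = (?y - e) * orth b (Suc s) x - orth b s x"
    unfolding orth_Suc_Suc b1 by (simp add: algebra_simps)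
  have gen: "k < q \<Longrightarrow> orth b (Suc (Suc s) + k) x = cheb (Suc k) ?y * orth b (Suc (Suc s)) x - cheb k ?y * orth b (Suc s) x" for k
  proof (induction k rule: induct_nat_012)
    case 1
    have "b (Suc (Suc s)) = g" using b2[of 2] q by (simp add: numeral_2_eq_2)
    then show ?case
      using orth_Suc_Suc[of b "Suc s" x] cheb_Suc_Suc[of 0 ?y] by (simp del: orth_poly.simps(3))
  next
    case (ge2 k)
    have "b (Suc (Suc (Suc (s + k)))) = g" using b2[of "k + 3"] ge2.prems by (simp add: eval_nat_numeral)
    then have r: "orth b (Suc (Suc s) + Suc (Suc k)) x =
        ?y * orth b (Suc (Suc s) + Suc k) x - orth b (Suc (Suc s) + k) x"
      using orth_Suc_Suc[of b "Suc (Suc (s + k))" x] by (simp del: orth_poly.simps(3))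
    have I: "orth b (Suc (Suc s) + k) x = cheb (Suc k) ?y * orth b (Suc (Suc s)) x - cheb k ?y * orth b (Suc s) x"
      "orth b (Suc (Suc s) + Suc k) x = cheb (Suc (Suc k)) ?y * orth b (Suc (Suc s)) x - cheb (Suc k) ?y * orth b (Suc s) x"
      using ge2 by auto
    show ?case
      unfolding r I cheb_Suc_Suc[of "Suc k" ?y] cheb_Suc_Suc[of k ?y]
      by (simp add: algebra_simps del: orth_poly.simps(3))
  qed (simp del: orth_poly.simps(3))
  obtain n where n: "q = Suc (Suc n)" using q by (metis add_2_eq_Suc le_add_diff_inverse)
  show "orth b (Suc (s + q)) x = T11 q e ?y * orth b (Suc s) x + T12 q ?y * orth b s x"
    using gen[of "Suc n"] unfolding n T11_def T12_def p2
    by (simp add: algebra_simps cheb_Suc_Suc del: orth_poly.simps(3))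
  show "orth b (s + q) x = T21 q e ?y * orth b (Suc s) x + T22 q ?y * orth b s x"
    using gen[of n] unfolding n T21_def T22_def p2
    by (simp add: algebra_simps cheb_Suc_Suc del: orth_poly.simps(3))
qed

section \<open>The potential\<close>

text \<open>Clock indices count groups of \<open>q\<close> sites. The resting lengths
  \<open>L\<close> are a parameter because they are determined last.\<close>

definition block_start :: "(nat \<Rightarrow> nat) \<Rightarrow> nat \<Rightarrow> nat" where
  "block_start L k = (\<Sum>i<k. L i + 2 ^ i)"

text \<open>Every block of indices consists of \<open>L k\<close> resting steps followed by \<open>2 ^ k\<close> steps of speed \<open>1 / 2 ^ k\<close>.\<close>

definition speed :: "(nat \<Rightarrow> nat) \<Rightarrow> nat \<Rightarrow> real" where
  "speed L j = (\<Sum>k\<le>j. if block_start L k + L k \<le> j \<and> j < block_start L (Suc k) then 1 / 2 ^ k else 0)"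

definition slow_time :: "(nat \<Rightarrow> nat) \<Rightarrow> nat \<Rightarrow> real" where
  "slow_time L m = (\<Sum>j<m. speed L j)"

lemma block_start_Suc: "block_start L (Suc k) = block_start L k + L k + 2 ^ k"
  by (simp add: block_start_def)

lemma strict_mono_block_start: "strict_mono (block_start L)"
  by (rule strict_monoI_Suc) (simp add: block_start_Suc)

lemma block_start_mono: "k \<le> l \<Longrightarrow> block_start L k \<le> block_start L l"
  by (simp add: strict_mono_less_eq[OF strict_mono_block_start])

lemma le_block_start: "k \<le> block_start L k"
  by (rule strict_mono_imp_increasing[OF strict_mono_block_start])

lemma block_exists:
  obtains k where "block_start L k \<le> j" "j < block_start L (Suc k)"
proof -
  have ex: "\<exists>k. j < block_start L (Suc k)"
    using le_block_start[of "Suc j" L] by (intro exI[of _ j]) simp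
  define k where "k = (LEAST k. j < block_start L (Suc k))"
  have "j < block_start L (Suc k)" unfolding k_def using ex by (rule LeastI_ex)
  moreover have "block_start L k \<le> j"
  proof (cases k)
    case (Suc l)
    have "\<not> j < block_start L (Suc l)" using not_less_Least[of l "\<lambda>k. j < block_start L (Suc k)"] Suc unfolding k_def by simp
    then show ?thesis using Suc by simp
  qed (simp add: block_start_def)
  ultimately show thesis using that by blast
qed

lemma block_unique:
  assumes "block_start L k \<le> j" "j < block_start L (Suc k)" "block_start L l \<le> j" "j < block_start L (Suc l)"
  shows "k = l"
proof (rule ccontr)
  assume "k \<noteq> l"
  then consider "Suc k \<le> l" | "Suc l \<le> k" by linarith
  then show False
    using block_start_mono[of "Suc k" l L] block_start_mono[of "Suc l" k L] assms by cases linarith+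
qed

lemma speed_eq:
  assumes "block_start L k \<le> j" "j < block_start L (Suc k)"
  shows "speed L j = (if block_start L k + L k \<le> j then 1 / 2 ^ k else 0)"
proof -
  have kj: "k \<le> j" using assms(1) le_block_start[of k L] by linarith
  have "speed L j = (\<Sum>l\<in>{k}. if block_start L l + L l \<le> j \<and> j < block_start L (Suc l) then 1 / 2 ^ l else 0)"
    unfolding speed_def
  proof (rule sum.mono_neutral_right)
    show "\<forall>l\<in>{..j} - {k}. (if block_start L l + L l \<le> j \<and> j < block_start L (Suc l) then 1 / 2 ^ l else (0::real)) = 0"
    proof
      fix l assume l: "l \<in> {..j} - {k}"
      have "\<not> (block_start L l + L l \<le> j \<and> j < block_start L (Suc l))"
        using block_unique[OF assms, of l] l by auto
      then show "(if block_start L l + L l \<le> j \<and> j < block_start L (Suc l) then 1 / 2 ^ l else (0::real)) = 0" by simp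
    qed
  qed (use kj in auto)
  then show ?thesis using assms by simp
qed

lemma speed_nonneg: "speed L j \<ge> 0"
  unfolding speed_def by (intro sum_nonneg) auto

lemma slow_time_Suc: "slow_time L (Suc m) = slow_time L m + speed L m"
  by (simp add: slow_time_def)

lemma slow_time_mono: "m \<le> n \<Longrightarrow> slow_time L m \<le> slow_time L n"
  by (rule lift_Suc_mono_le) (auto simp: slow_time_Suc speed_nonneg)

lemma slow_time_nonneg: "slow_time L m \<ge> 0"
  using slow_time_mono[of 0 m L] by (simp add: slow_time_def)

lemma slow_time_rest:
  assumes "i \<le> L k"
  shows "slow_time L (block_start L k + i) = slow_time L (block_start L k)"
  using assms
proof (induction i)
  case (Suc i)
  have "speed L (block_start L k + i) = 0"
    using Suc.prems by (subst speed_eq[of L k]) (auto simp: block_start_Suc)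
  then show ?case using Suc by (simp add: slow_time_Suc)
qed simp

text \<open>\<open>2^k\<close> steps of size \<open>2^(-k)\<close> advance the clock by exactly 1,
  so the \<open>k\<close>-th plateau rests at time \<open>k\<close>, whatever its length.\<close>

lemma slow_time_block_start: "slow_time L (block_start L k) = real k"
proof (induction k)
  case (Suc k)
  have "i \<le> 2 ^ k \<Longrightarrow> slow_time L (block_start L k + L k + i) = real k + real i / 2 ^ k" for i
  proof (induction i)
    case 0
    show ?case using slow_time_rest[of "L k" L k] Suc by simp
  next
    case (Suc i)
    have "speed L (block_start L k + L k + i) = 1 / 2 ^ k"
      using Suc.prems by (subst speed_eq[of L k]) (auto simp: block_start_Suc)
    then show ?case using Suc by (simp add: slow_time_Suc add_divide_distrib)
  qed
  from this[of "2 ^ k"] show ?case by (simp add: block_start_Suc)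
qed (simp add: block_start_def slow_time_def)

lemma slow_time_at_top: "filterlim (slow_time L) at_top sequentially"
  unfolding filterlim_at_top_ge[of _ _ 0]
proof (intro allI impI)
  fix Z :: real assume "0 \<le> Z"
  show "\<forall>\<^sub>F m in sequentially. Z \<le> slow_time L m"
    using eventually_ge_at_top[of "block_start L (nat \<lceil>Z\<rceil>)"]
  proof eventually_elim
    case (elim m)
    have "Z \<le> real (nat \<lceil>Z\<rceil>)" by (rule real_nat_ceiling_ge)
    also have "\<dots> \<le> slow_time L m"
      using slow_time_mono[OF elim, of L] by (simp add: slow_time_block_start)
    finally show ?case .
  qed
qed

lemma block_start_cong: "(\<And>i. i < k \<Longrightarrow> L i = L' i) \<Longrightarrow> block_start L k = block_start L' k"
  unfolding block_start_def by (intro sum.cong) auto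

lemma speed_cong:
  assumes eq: "\<And>i. i < k \<Longrightarrow> L i = L' i" and j: "j < block_start L k"
  shows "speed L j = speed L' j"
proof -
  obtain l where l: "block_start L l \<le> j" "j < block_start L (Suc l)" by (rule block_exists)
  have lk: "l < k"
  proof (rule ccontr)
    assume "\<not> l < k"
    then have "block_start L k \<le> block_start L l" by (intro block_start_mono) simp
    then show False using l(1) j by simp
  qed
  have e: "block_start L l = block_start L' l" "block_start L (Suc l) = block_start L' (Suc l)" "L l = L' l"
    using lk eq by (auto intro!: block_start_cong)
  show ?thesis
    unfolding speed_eq[OF l] speed_eq[OF l[unfolded e]] unfolding e ..
qed

text \<open>The clock up to the start of the \<open>k\<close>-th plateau knows only the earlier
  lengths, as the recursive choice of \<open>L\<close> requires.\<close>

lemma slow_time_cong: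
  assumes "\<And>i. i < k \<Longrightarrow> L i = L' i" "m \<le> block_start L k"
  shows "slow_time L m = slow_time L' m"
  unfolding slow_time_def using assms by (intro sum.cong speed_cong[of k]) auto

section \<open>Summability of the speed and of its jumps\<close>

lemma summable_blocks:
  fixes f :: "nat \<Rightarrow> real"
  assumes f: "\<And>j. 0 \<le> f j" and C: "0 \<le> C"
    and blk: "\<And>k. (\<Sum>j=block_start L k..<block_start L (Suc k). f j) \<le> C * (1 / 2) ^ k"
  shows "summable f"
proof (rule summableI_nonneg_bounded[OF f])
  fix n
  have "(\<Sum>j<block_start L k. f j) \<le> (\<Sum>i<k. C * (1 / 2) ^ i)" for k
  proof (induction k)
    case (Suc k)
    have "(\<Sum>j<block_start L (Suc k). f j) =
        (\<Sum>j<block_start L k. f j) + (\<Sum>j=block_start L k..<block_start L (Suc k). f j)"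
      unfolding lessThan_atLeast0 by (subst sum.atLeastLessThan_concat) (auto simp: block_start_Suc)
    then show ?case using Suc blk[of k] by simp
  qed (simp add: block_start_def)
  moreover have "(\<Sum>i<k. C * (1 / 2) ^ i) \<le> C * 2" for k
  proof -
    have "(\<Sum>i<k. (1 / 2 :: real) ^ i) = 2 - 2 * (1 / 2) ^ k"
      by (induction k) auto
    then have "(\<Sum>i<k. (1 / 2 :: real) ^ i) \<le> 2" by simp
    then show ?thesis
      unfolding sum_distrib_left[symmetric] using C by (rule mult_left_mono)
  qed
  moreover have "(\<Sum>j<n. f j) \<le> (\<Sum>j<block_start L n. f j)"
    using f le_block_start[of n L] by (intro sum_mono2) auto
  ultimately show "(\<Sum>j<n. f j) \<le> C * 2" by (meson order.trans)
qed

text \<open>The variation of the speed plus its squares at both adjacent steps, as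
  \<open>slow_scale\<close> demands of a second order scale.\<close>

definition curv :: "(nat \<Rightarrow> nat) \<Rightarrow> nat \<Rightarrow> real" where
  "curv L j = \<bar>speed L (Suc j) - speed L j\<bar> + (speed L j)\<^sup>2 + (speed L (Suc j))\<^sup>2"

text \<open>The moving part of block \<open>k\<close> contributes \<open>2^k * 4^(-k)\<close> and
  the rest contributes 0, for every \<open>L\<close>.\<close>

lemma summable_speed_square: "summable (\<lambda>j. (speed L j)\<^sup>2)"
proof (rule summable_blocks[of _ 1 L])
  fix k
  let ?s = "block_start L k"
  have "(\<Sum>j=?s..<block_start L (Suc k). (speed L j)\<^sup>2) =
      (\<Sum>j\<in>{?s + L k..<block_start L (Suc k)}. (1 / 2 ^ k)\<^sup>2)"
    by (rule sum.mono_neutral_cong_right) (auto simp: speed_eq[of L k])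
  also have "\<dots> = (1 / 2) ^ k"
    by (simp add: block_start_Suc power2_eq_square power_divide)
  finally show "(\<Sum>j=?s..<block_start L (Suc k). (speed L j)\<^sup>2) \<le> 1 * (1 / 2) ^ k" by simp
qed auto

text \<open>In block \<open>k\<close> the speed jumps only twice, each time by
  \<open>2^(-k)\<close>: when the rest ends and when the next rest begins. A rest of length at least
  1 makes the second jump go to 0.\<close>

lemma summable_speed_diff:
  assumes L: "\<And>k. L k \<ge> 1"
  shows "summable (\<lambda>j. \<bar>speed L (Suc j) - speed L j\<bar>)"
proof (rule summable_blocks[of _ 2 L])
  fix k
  let ?s = "block_start L k" and ?t = "block_start L (Suc k)"
  have next0: "speed L ?t = 0"
    using L[of "Suc k"] by (subst speed_eq[of L "Suc k"]) (auto simp: block_start_Suc)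
  have st: "?t = ?s + L k + 2 ^ k" by (rule block_start_Suc)
  have "(\<Sum>j=?s..<?t. \<bar>speed L (Suc j) - speed L j\<bar>) \<le>
      (\<Sum>j=?s..<?t. (if j = ?s + L k - 1 then (1 / 2) ^ k else 0) + (if j = ?t - 1 then (1 / 2) ^ k else 0))"
  proof (rule sum_mono)
    fix j assume j: "j \<in> {?s..<?t}"
    show "\<bar>speed L (Suc j) - speed L j\<bar> \<le>
      (if j = ?s + L k - 1 then (1 / 2) ^ k else 0) + (if j = ?t - 1 then (1 / 2) ^ k else 0)"
    proof (cases "Suc j = ?t")
      case True
      have "\<bar>speed L j\<bar> \<le> (1 / 2) ^ k"
        using j by (auto simp: speed_eq[of L k] power_divide)
      moreover have "speed L (Suc j) = 0" using next0 True by simp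
      moreover have "(if j = ?t - 1 then (1 / 2) ^ k else 0) = (1 / 2 :: real) ^ k" using True by auto
      moreover have "(if j = ?s + L k - 1 then (1 / 2) ^ k else 0) \<ge> (0 :: real)" by simp
      ultimately show ?thesis by linarith
    next
      case False
      have v: "speed L (Suc j) = (if ?s + L k \<le> Suc j then 1 / 2 ^ k else 0)"
        "speed L j = (if ?s + L k \<le> j then 1 / 2 ^ k else 0)"
        by (rule speed_eq; use j False in auto)+
      show ?thesis
      proof (cases "Suc j = ?s + L k")
        case True
        then have "(if j = ?s + L k - 1 then (1 / 2) ^ k else 0) = (1 / 2 :: real) ^ k" by auto
        moreover have "(if j = ?t - 1 then (1 / 2) ^ k else 0) \<ge> (0 :: real)" by simp
        moreover have "\<bar>speed L (Suc j) - speed L j\<bar> \<le> (1 / 2) ^ k"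
          unfolding v by (simp add: power_divide)
        ultimately show ?thesis by linarith
      next
        case False
        then have "speed L (Suc j) - speed L j = 0" unfolding v by auto
        then show ?thesis by simp
      qed
    qed
  qed
  also have "\<dots> = 2 * (1 / 2) ^ k"
  proof -
    have "(2 :: nat) ^ k \<ge> 1" by simp
    then have "?s + L k - 1 \<in> {?s..<?t}" "?t - 1 \<in> {?s..<?t}"
      using L[of k] unfolding st atLeastLessThan_iff by linarith+
    then show ?thesis
      unfolding sum.distrib by (simp only: sum.delta finite_atLeastLessThan if_True mult_2 distrib_right mult_1)
  qed
  finally show "(\<Sum>j=?s..<?t. \<bar>speed L (Suc j) - speed L j\<bar>) \<le> 2 * (1 / 2) ^ k" .
qed auto

lemma slow_scale_speed:
  assumes "\<And>k. L k \<ge> 1"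
  shows "slow_scale (speed L) (curv L)"
proof
  show "summable (curv L)"
    unfolding curv_def
    by (intro summable_add summable_speed_diff summable_speed_square assms)
       (use summable_speed_square[of L] in \<open>simp only: summable_Suc_iff[of "\<lambda>j. (speed L j)\<^sup>2"]\<close>)
qed (auto simp: speed_nonneg curv_def)

text \<open>Chain rule for sampling along the clock: the second difference consists of the jump of
  the speed times \<open>f'\<close> and of products of speeds times \<open>f''\<close>.\<close>

lemma slow_compose_time:
  assumes L: "\<And>k. L k \<ge> 1"
    and f1: "\<And>t. t \<ge> 0 \<Longrightarrow> (f has_real_derivative f' t) (at t)"
    and f2: "\<And>t. t \<ge> 0 \<Longrightarrow> (f' has_real_derivative f'' t) (at t)"
    and bd: "\<And>t. t \<ge> 0 \<Longrightarrow> \<bar>f t\<bar> \<le> C" "\<And>t. t \<ge> 0 \<Longrightarrow> \<bar>f' t\<bar> \<le> C" "\<And>t. t \<ge> 0 \<Longrightarrow> \<bar>f'' t\<bar> \<le> C"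
  shows "slow (speed L) (curv L) K (\<lambda>m x. of_real (f (slow_time L m)))"
proof -
  interpret slow_scale "speed L" "curv L" by (rule slow_scale_speed[OF L])
  have C0: "C \<ge> 0" using bd(1)[of 0] by linarith
  have mvt: "\<exists>\<xi>. t \<le> \<xi> \<and> \<xi> \<le> t + r \<and> f (t + r) - f t = r * f' \<xi>" if "t \<ge> 0" "r \<ge> 0" for t r
  proof (cases "r = 0")
    case False
    have "\<exists>\<xi>>t. \<xi> < t + r \<and> f (t + r) - f t = (t + r - t) * f' \<xi>"
      by (rule MVT2) (use that False f1 in auto)
    then show ?thesis by (auto intro: less_imp_le)
  qed (use that in auto)
  have lip: "\<bar>f' u - f' v\<bar> \<le> C * \<bar>u - v\<bar>" if "u \<ge> 0" "v \<ge> 0" for u v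
  proof -
    have "norm (f' u - f' v) \<le> C * norm (u - v)"
    proof (rule field_differentiable_bound[of "{0..}"])
      show "(f' has_field_derivative f'' t) (at t within {0..})" if "t \<in> {0..}" for t
        using f2[of t] that by (auto intro: has_field_derivative_at_within)
    qed (use bd that in \<open>auto simp: convex_real_interval\<close>)
    then show ?thesis by simp
  qed
  show ?thesis
  proof (rule slowI)
    show "\<forall>\<^sub>F m in sequentially. \<forall>x\<in>K. cmod (of_real (f (slow_time L m))) \<le> C"
      by (simp add: bd slow_time_nonneg)
    show "\<forall>\<^sub>F m in sequentially. \<forall>x\<in>K. cmod (of_real (f (slow_time L (Suc m))) - of_real (f (slow_time L m))) \<le> C * speed L m"
    proof (intro always_eventually allI ballI)
      fix m x
      obtain \<xi> where \<xi>: "slow_time L m \<le> \<xi>"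
        "f (slow_time L m + speed L m) - f (slow_time L m) = speed L m * f' \<xi>"
        using mvt[OF slow_time_nonneg[of L m] speed_nonneg[of L m]] by blast
      have "of_real (f (slow_time L (Suc m))) - of_real (f (slow_time L m)) = complex_of_real (speed L m * f' \<xi>)"
        unfolding slow_time_Suc \<xi>(2)[symmetric] by simp
      moreover have "\<bar>speed L m * f' \<xi>\<bar> \<le> C * speed L m"
        using mult_left_mono[OF bd(2)[of \<xi>] speed_nonneg[of L m]] \<xi>(1) slow_time_nonneg[of L m]
          speed_nonneg[of L m] by (simp add: abs_mult mult.commute)
      ultimately show "cmod (of_real (f (slow_time L (Suc m))) - of_real (f (slow_time L m))) \<le> C * speed L m"
        by (simp only: norm_of_real)
    qed
    show "\<forall>\<^sub>F m in sequentially. \<forall>x\<in>K. cmod (of_real (f (slow_time L (Suc (Suc m)))) - 2 * of_real (f (slow_time L (Suc m)))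
        + of_real (f (slow_time L m))) \<le> (2 * C) * curv L m"
    proof (intro always_eventually allI ballI)
      fix m x
      let ?t = "slow_time L m" and ?r = "speed L m" and ?r' = "speed L (Suc m)"
      note r = speed_nonneg[of L m] speed_nonneg[of L "Suc m"]
      have t: "?t \<ge> 0" "?t + ?r \<ge> 0" using slow_time_nonneg[of L m] r by auto
      obtain u where u: "?t \<le> u" "u \<le> ?t + ?r" "f (?t + ?r) - f ?t = ?r * f' u"
        using mvt[OF t(1) r(1)] by blast
      obtain v where v: "?t + ?r \<le> v" "v \<le> ?t + ?r + ?r'" "f (?t + ?r + ?r') - f (?t + ?r) = ?r' * f' v"
        using mvt[OF t(2) r(2)] by blast
      have uv: "u \<ge> 0" "v \<ge> 0" "\<bar>v - u\<bar> \<le> ?r + ?r'" using u v t by auto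
      \<comment> \<open>Two mean values of \<open>f'\<close> occur; splitting off the jump of the
        speed leaves a difference of \<open>f'\<close>, which is Lipschitz.\<close>
      have "f (?t + ?r + ?r') - 2 * f (?t + ?r) + f ?t = (?r' - ?r) * f' v + ?r * (f' v - f' u)"
        using u(3) v(3) by (simp add: algebra_simps)
      also have "\<bar>\<dots>\<bar> \<le> \<bar>?r' - ?r\<bar> * C + ?r * (C * (?r + ?r'))"
      proof (rule order.trans[OF abs_triangle_ineq add_mono])
        show "\<bar>(?r' - ?r) * f' v\<bar> \<le> \<bar>?r' - ?r\<bar> * C"
          unfolding abs_mult using bd(2)[OF uv(2)] by (intro mult_left_mono) auto
        have "\<bar>f' v - f' u\<bar> \<le> C * (?r + ?r')"
          using lip[OF uv(2,1)] mult_left_mono[OF uv(3) C0] by linarith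
        then show "\<bar>?r * (f' v - f' u)\<bar> \<le> ?r * (C * (?r + ?r'))"
          unfolding abs_mult using r by (intro mult_mono) auto
      qed
      also have "\<dots> = C * (\<bar>?r' - ?r\<bar> + ?r\<^sup>2 + ?r * ?r')" by (simp add: algebra_simps power2_eq_square)
      also have "\<dots> \<le> C * (2 * curv L m)"
      proof (rule mult_left_mono[OF _ C0])
        have sq: "2 * (?r * ?r') \<le> ?r\<^sup>2 + ?r'\<^sup>2" using sum_squares_bound[of ?r ?r'] by simp
        have ineq: "a + p + w \<le> 2 * (a + p + s)" if "2 * w \<le> p + s" "0 \<le> p" "0 \<le> s" "0 \<le> a" for a p s w :: real
          using that by (simp add: algebra_simps)
        show "\<bar>?r' - ?r\<bar> + ?r\<^sup>2 + ?r * ?r' \<le> 2 * curv L m"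
          unfolding curv_def by (rule ineq[OF sq]) simp_all
      qed
      finally have "\<bar>f (?t + ?r + ?r') - 2 * f (?t + ?r) + f ?t\<bar> \<le> (2 * C) * curv L m" by simp
      moreover have "of_real (f (?t + ?r + ?r')) - 2 * of_real (f (?t + ?r)) + of_real (f ?t) =
          complex_of_real (f (?t + ?r + ?r') - 2 * f (?t + ?r) + f ?t)" by simp
      ultimately show "cmod (of_real (f (slow_time L (Suc (Suc m)))) - 2 * of_real (f (slow_time L (Suc m)))
        + of_real (f ?t)) \<le> (2 * C) * curv L m"
        unfolding slow_time_Suc by (simp only: norm_of_real)
    qed
  qed
qed

text \<open>The logarithm slows the oscillation down: unit increments are at most
  \<open>lam / (1 + t)\<close>, that is \<open>lam\<close> times the square of
  \<open>amplitude t\<close>, and still the whole range is swept infinitely often.\<close>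

definition profile :: "real \<Rightarrow> real \<Rightarrow> real" where
  "profile lam t = lam * sin (ln (1 + t))"

definition amplitude :: "real \<Rightarrow> real" where
  "amplitude t = (1 + t) powr (- 1 / 2)"

text \<open>The subtraction aligns the groups of \<open>q\<close> sites with the numbering from
  1.\<close>

definition potential :: "real \<Rightarrow> nat \<Rightarrow> (nat \<Rightarrow> nat) \<Rightarrow> nat \<Rightarrow> real" where
  "potential lam q L n = profile lam (slow_time L ((n - 1) div q)) +
     (if (n - 1) mod q = 0 then amplitude (slow_time L ((n - 1) div q)) else 0)"

lemma profile_bound: "0 \<le> lam \<Longrightarrow> \<bar>profile lam t\<bar> \<le> lam"
  unfolding profile_def abs_mult using abs_sin_le_one[of "ln (1 + t)"] by (simp add: mult_left_le)

lemma amplitude_bounds: "0 \<le> t \<Longrightarrow> 0 < amplitude t" "0 \<le> t \<Longrightarrow> amplitude t \<le> 1"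
  unfolding amplitude_def using powr_mono[of "-1/2" 0 "1 + t"] by auto

lemma amplitude_tendsto_0: "(amplitude \<longlongrightarrow> 0) at_top"
  unfolding amplitude_def by real_asymp

lemma slow_profile:
  assumes L: "\<And>k. L k \<ge> 1" and lam: "0 \<le> lam"
  shows "slow (speed L) (curv L) K (\<lambda>m x. of_real (profile lam (slow_time L m)))"
proof (rule slow_compose_time[OF L])
  fix t :: real assume t: "t \<ge> 0"
  show "(profile lam has_real_derivative lam * (cos (ln (1 + t)) / (1 + t))) (at t)"
    unfolding profile_def[abs_def] using t by (auto intro!: derivative_eq_intros simp: field_simps)
  show "((\<lambda>t. lam * (cos (ln (1 + t)) / (1 + t))) has_real_derivative
      lam * ((- sin (ln (1 + t)) - cos (ln (1 + t))) / (1 + t)\<^sup>2)) (at t)"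
  proof -
    have a: "((\<lambda>t. cos (ln (1 + t))) has_real_derivative - sin (ln (1 + t)) / (1 + t)) (at t)"
      using t by (auto intro!: derivative_eq_intros)
    have b: "((\<lambda>t. 1 + t) has_real_derivative 1) (at t)"
      by (auto intro!: derivative_eq_intros)
    show ?thesis
      by (rule DERIV_cong[OF DERIV_cmult[OF DERIV_divide[OF a b]]]) (use t in \<open>auto simp: power2_eq_square\<close>)
  qed
  have frac: "\<bar>lam * (u / v)\<bar> \<le> 2 * lam" if "\<bar>u\<bar> \<le> 2" "v \<ge> 1" for u v :: real
  proof -
    have "\<bar>u\<bar> / v \<le> 2 / 1" using that by (intro frac_le) auto
    then have "lam * (\<bar>u\<bar> / v) \<le> lam * 2" using lam by (intro mult_left_mono) auto
    then show ?thesis using that lam by (simp add: abs_mult abs_divide mult.commute)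
  qed
  show "\<bar>profile lam t\<bar> \<le> 2 * lam" using profile_bound[OF lam, of t] lam by linarith
  show "\<bar>lam * (cos (ln (1 + t)) / (1 + t))\<bar> \<le> 2 * lam"
    using abs_cos_le_one[of "ln (1 + t)"] t by (intro frac) linarith+
  have "(1 + t)\<^sup>2 \<ge> 1" using t by (simp add: one_le_power)
  then show "\<bar>lam * ((- sin (ln (1 + t)) - cos (ln (1 + t))) / (1 + t)\<^sup>2)\<bar> \<le> 2 * lam"
    using abs_cos_le_one[of "ln (1 + t)"] abs_sin_le_one[of "ln (1 + t)"] by (intro frac) linarith+
qed

lemma slow_amplitude:
  assumes L: "\<And>k. L k \<ge> 1"
  shows "slow (speed L) (curv L) K (\<lambda>m x. of_real (amplitude (slow_time L m)))"
proof (rule slow_compose_time[OF L])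
  fix t :: real assume t: "t \<ge> 0"
  show "(amplitude has_real_derivative (- 1 / 2) * (1 + t) powr (- 3 / 2)) (at t)"
    unfolding amplitude_def[abs_def] using t by (auto intro!: derivative_eq_intros)
  show "((\<lambda>t. (- 1 / 2) * (1 + t) powr (- 3 / 2)) has_real_derivative (3 / 4) * (1 + t) powr (- 5 / 2)) (at t)"
    using t by (auto intro!: derivative_eq_intros)
  have p: "(1 + t) powr a \<le> 1" if "a \<le> 0" for a
    using powr_mono[of a 0 "1 + t"] t that by simp
  show "\<bar>amplitude t\<bar> \<le> 1" using amplitude_bounds[OF t] by simp
  show "\<bar>(- 1 / 2) * (1 + t) powr (- 3 / 2)\<bar> \<le> 1" using p[of "-3/2"] by (simp add: abs_mult)
  show "\<bar>(3 / 4) * (1 + t) powr (- 5 / 2)\<bar> \<le> 1" using p[of "-5/2"] by (simp add: abs_mult)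
qed

lemma potential_block:
  assumes "1 \<le> i" "i \<le> q"
  shows "potential lam q L (m * q + i) = profile lam (slow_time L m) + (if i = 1 then amplitude (slow_time L m) else 0)"
proof -
  have "(m * q + i - 1) div q = m" "(m * q + i - 1) mod q = i - 1"
  proof -
    have e: "m * q + i - 1 = (i - 1) + q * m" using assms by (simp add: mult.commute)
    have "i - 1 < q" using assms by simp
    then show "(m * q + i - 1) div q = m" "(m * q + i - 1) mod q = i - 1" unfolding e by simp_all
  qed
  then show ?thesis using assms unfolding potential_def by auto
qed

lemma orth_potential_step:
  fixes x lam :: real and L :: "nat \<Rightarrow> nat"
  assumes q: "q \<ge> 2"
  defines "y \<equiv> \<lambda>m. x - profile lam (slow_time L m)" and "e \<equiv> \<lambda>m. amplitude (slow_time L m)"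
  shows "orth (potential lam q L) (Suc (Suc m * q)) x =
      T11 q (e m) (y m) * orth (potential lam q L) (Suc (m * q)) x + T12 q (y m) * orth (potential lam q L) (m * q) x"
    and "orth (potential lam q L) (Suc m * q) x =
      T21 q (e m) (y m) * orth (potential lam q L) (Suc (m * q)) x + T22 q (y m) * orth (potential lam q L) (m * q) x"
proof -
  have b1: "potential lam q L (Suc (m * q)) = profile lam (slow_time L m) + e m"
    using potential_block[of 1 q lam L m] q by (simp add: e_def)
  have b2: "potential lam q L (m * q + i) = profile lam (slow_time L m)" if "2 \<le> i" "i \<le> q" for i
    using potential_block[of i q lam L m] that by simp
  have s: "Suc m * q = m * q + q" by simp
  show "orth (potential lam q L) (Suc (Suc m * q)) x =
      T11 q (e m) (y m) * orth (potential lam q L) (Suc (m * q)) x + T12 q (y m) * orth (potential lam q L) (m * q) x"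
    "orth (potential lam q L) (Suc m * q) x =
      T21 q (e m) (y m) * orth (potential lam q L) (Suc (m * q)) x + T22 q (y m) * orth (potential lam q L) (m * q) x"
    unfolding s y_def by (rule orth_block[OF q b1 b2]; assumption)+
qed

text \<open>By \<open>T_trace\<close> the trace of the matrix that is repeated on the
  \<open>k\<close>-th plateau, where the clock shows \<open>k\<close>; the point \<open>x\<close>
  lies in the gap of the plateau when its modulus is at least 2.\<close>

definition plateau_disc :: "real \<Rightarrow> nat \<Rightarrow> nat \<Rightarrow> real \<Rightarrow> real" where
  "plateau_disc lam q k x = disc q (x - profile lam (real k)) - amplitude (real k) * cheb q (x - profile lam (real k))"

context slow_scale
begin

lemma slow_cheb:
  assumes "slow \<delta> \<eta> K (\<lambda>m x. of_real (y m x))"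
  shows "slow \<delta> \<eta> K (\<lambda>m x. of_real (cheb n (y m x)))"
proof (induction n rule: induct_nat_012)
  case (ge2 n)
  have "slow \<delta> \<eta> K (\<lambda>m x. of_real (y m x) * of_real (cheb (Suc n) (y m x)) - of_real (cheb n (y m x)))"
    by (intro slow_diff slow_mult assms ge2)
  then show ?case unfolding cheb_Suc_Suc by simp
qed (auto intro: slow_const)

end

text \<open>Compactness of the interval times \<open>[-lam, lam]\<close> turns pointwise ellipticity
  into a uniform distance from 2, half of which absorbs the decaying bump.\<close>

lemma orth_bounded_on_stable_interval:
  assumes L: "\<And>k. L k \<ge> 1" and lam: "0 \<le> lam" and q: "q \<ge> 2"
    and stable: "\<And>x \<beta>. x \<in> {c..d} \<Longrightarrow> \<beta> \<in> {-lam..lam} \<Longrightarrow> \<bar>disc q (x - \<beta>)\<bar> < 2"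
  shows "\<exists>M. \<forall>\<^sub>F m in sequentially. \<forall>x\<in>{c..d}. orth_norm2 (potential lam q L) (m * q) x \<le> M"
proof -
  interpret slow_scale "speed L" "curv L" by (rule slow_scale_speed[OF L])
  let ?b = "potential lam q L" and ?K = "{c..d}"
  define y where "y = (\<lambda>m x. x - profile lam (slow_time L m))"
  define e where "e = (\<lambda>m. amplitude (slow_time L m))"
  define A where "A = (\<lambda>m x. T11 q (e m) (y m x))"
  define B where "B = (\<lambda>m x. T12 q (y m x))"
  define C where "C = (\<lambda>m x. T21 q (e m) (y m x))"
  define D where "D = (\<lambda>m x. T22 q (y m x))"
  have slowx: "slow (speed L) (curv L) ?K (\<lambda>m x. complex_of_real x)"
    by (rule slow_of_bounded[where C = "max \<bar>c\<bar> \<bar>d\<bar>"]) auto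
  have slowy: "slow (speed L) (curv L) ?K (\<lambda>m x. of_real (y m x))"
    using slow_diff[OF slowx slow_profile[OF L lam]] unfolding y_def by simp
  have slowe: "slow (speed L) (curv L) ?K (\<lambda>m x. of_real (e m))"
    unfolding e_def by (rule slow_amplitude[OF L])
  note sc = slow_cheb[OF slowy]
  have "slow (speed L) (curv L) ?K (\<lambda>m x. of_real (A m x))"
    using slow_diff[OF sc[of "Suc q"] slow_mult[OF slowe sc[of q]]] unfolding A_def T11_def by simp
  moreover have "slow (speed L) (curv L) ?K (\<lambda>m x. of_real (B m x))"
    using slow_minus[OF sc[of q]] unfolding B_def T12_def by simp
  moreover have "slow (speed L) (curv L) ?K (\<lambda>m x. of_real (C m x))"
    using slow_diff[OF sc[of q] slow_mult[OF slowe sc[of "q - 1"]]] unfolding C_def T21_def by simp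
  moreover have "slow (speed L) (curv L) ?K (\<lambda>m x. of_real (D m x))"
    using slow_minus[OF sc[of "q - 1"]] unfolding D_def T22_def by simp
  moreover have "A m x * D m x - B m x * C m x = 1" for m x
    unfolding A_def B_def C_def D_def using q by (intro T_det) simp
  moreover obtain \<tau> where "\<tau> > 0" "\<forall>\<^sub>F m in sequentially. \<forall>x\<in>?K. \<bar>A m x + D m x\<bar> \<le> 2 - \<tau>"
  proof (cases "c \<le> d")
    case True
    let ?P = "?K \<times> {-lam..lam}"
    have cpt: "compact ?P" by (intro compact_Times) auto
    have ne: "?P \<noteq> {}" using True lam by auto
    have "continuous_on ?P (\<lambda>p. \<bar>disc q (fst p - snd p)\<bar>)" by (intro continuous_intros)
    from continuous_attains_sup[OF cpt ne this]
    obtain p where p: "p \<in> ?P" "\<And>r. r \<in> ?P \<Longrightarrow> \<bar>disc q (fst r - snd r)\<bar> \<le> \<bar>disc q (fst p - snd p)\<bar>" by blast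
    define \<tau> where "\<tau> = (2 - \<bar>disc q (fst p - snd p)\<bar>) / 2"
    have "\<bar>disc q (fst p - snd p)\<bar> < 2" using p(1) by (intro stable) auto
    then have \<tau>: "\<tau> > 0" by (simp add: \<tau>_def)
    have \<tau>2: "2 - 2 * \<tau> = \<bar>disc q (fst p - snd p)\<bar>" unfolding \<tau>_def by (simp add: field_simps)
    have "continuous_on ?P (\<lambda>p. \<bar>cheb q (fst p - snd p)\<bar>)" by (intro continuous_intros)
    from continuous_attains_sup[OF cpt ne this]
    obtain p' where p': "p' \<in> ?P" "\<And>r. r \<in> ?P \<Longrightarrow> \<bar>cheb q (fst r - snd r)\<bar> \<le> \<bar>cheb q (fst p' - snd p')\<bar>" by blast
    define Q where "Q = \<bar>cheb q (fst p' - snd p')\<bar> + 1"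
    have Q: "Q > 0" by (simp add: Q_def)
    have "(\<lambda>m. e m) \<longlonglongrightarrow> 0"
      unfolding e_def by (rule filterlim_compose[OF amplitude_tendsto_0 slow_time_at_top])
    then have "\<forall>\<^sub>F m in sequentially. e m < \<tau> / Q"
      by (rule order_tendstoD) (use \<tau> Q in simp)
    then have "\<forall>\<^sub>F m in sequentially. \<forall>x\<in>?K. \<bar>A m x + D m x\<bar> \<le> 2 - \<tau>"
    proof eventually_elim
      case (elim m)
      show ?case
      proof
        fix x assume x: "x \<in> ?K"
        have \<beta>: "profile lam (slow_time L m) \<in> {-lam..lam}"
          using profile_bound[OF lam, of "slow_time L m"] by (simp add: abs_le_iff)
        have em: "e m > 0" unfolding e_def by (intro amplitude_bounds slow_time_nonneg)
        have "\<bar>disc q (y m x)\<bar> \<le> 2 - 2 * \<tau>"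
          unfolding \<tau>2 using p(2)[of "(x, profile lam (slow_time L m))"] x \<beta> by (simp add: y_def)
        moreover have "\<bar>e m * cheb q (y m x)\<bar> \<le> \<tau> / Q * Q"
          unfolding abs_mult using p'(2)[of "(x, profile lam (slow_time L m))"] x \<beta> em elim
          by (intro mult_mono) (auto simp: y_def Q_def)
        ultimately show "\<bar>A m x + D m x\<bar> \<le> 2 - \<tau>"
          unfolding A_def D_def T_trace using Q by simp
      qed
    qed
    then show thesis using \<tau> by (rule that[rotated])
  next
    case False
    then show thesis using that[of 1] by simp
  qed
  moreover have "orth ?b (Suc (Suc m * q)) x = A m x * orth ?b (Suc (m * q)) x + B m x * orth ?b (m * q) x"
    "orth ?b (Suc m * q) x = C m x * orth ?b (Suc (m * q)) x + D m x * orth ?b (m * q) x" for m x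
    unfolding A_def B_def C_def D_def y_def e_def by (rule orth_potential_step[OF q])+
  moreover have "\<exists>r. \<forall>x\<in>?K. (orth ?b (Suc (m * q)) x)\<^sup>2 + (orth ?b (m * q) x)\<^sup>2 \<le> r" for m
  proof -
    have "compact ((\<lambda>x. (orth ?b (Suc (m * q)) x)\<^sup>2 + (orth ?b (m * q) x)\<^sup>2) ` ?K)"
      by (intro compact_continuous_image continuous_intros) auto
    then have "bdd_above ((\<lambda>x. (orth ?b (Suc (m * q)) x)\<^sup>2 + (orth ?b (m * q) x)\<^sup>2) ` ?K)"
      by (intro bounded_imp_bdd_above compact_imp_bounded)
    then show ?thesis unfolding bdd_above_def by blast
  qed
  ultimately show ?thesis
    unfolding orth_norm2_def
    by (rule elliptic_bounded[where V = "\<lambda>m x. orth ?b (Suc (m * q)) x" and W = "\<lambda>m x. orth ?b (m * q) x"])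
qed

section \<open>Lebesgue decomposition\<close>

text \<open>The singular part lives on a Lebesgue null set of maximal \<open>\<mu>\<close>-measure.\<close>

lemma lebesgue_decomposition_exists:
  assumes fin: "finite_measure \<mu>" and sets: "sets \<mu> = sets borel"
  obtains f \<mu>s where "lebesgue_decomposition \<mu> f \<mu>s"
proof -
  interpret finite_measure \<mu> by fact
  have [measurable_cong, simp]: "sets \<mu> = sets borel" by fact
  have sp: "space \<mu> = UNIV" using sets by (metis sets_eq_imp_space_eq space_borel)
  define S where "S = (\<lambda>N. measure \<mu> N) ` null_sets lborel"
  have ne: "S \<noteq> {}" unfolding S_def by (auto intro: exI[of _ "{}"])
  have bdd: "bdd_above S"
    unfolding S_def by (intro bdd_aboveI[of _ "measure \<mu> (space \<mu>)"]) (auto intro: bounded_measure)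
  have "\<exists>N. N \<in> null_sets lborel \<and> Sup S - 1 / Suc n < measure \<mu> N" for n
    using less_cSup_iff[OF ne bdd, of "Sup S - 1 / Suc n"] by (auto simp: S_def)
  then obtain N where N: "\<And>n. N n \<in> null_sets lborel" "\<And>n. Sup S - 1 / Suc n < measure \<mu> (N n)" by metis
  define M where "M = (\<Union>n. N n)"
  have M: "M \<in> null_sets lborel" unfolding M_def using N(1) by (intro null_sets_UN) auto
  then have Mb: "M \<in> sets borel" by (auto simp: null_sets_def)
  have Nb: "N n \<in> sets borel" for n using N(1)[of n] by (auto simp: null_sets_def)
  have supM: "Sup S \<le> measure \<mu> M"
  proof (rule field_le_epsilon)
    fix e :: real assume "e > 0"
    then obtain n where n: "1 / Suc n < e" using nat_approx_posE by blast
    have "measure \<mu> (N n) \<le> measure \<mu> M"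
      unfolding M_def using Nb by (intro finite_measure_mono) auto
    then show "Sup S \<le> measure \<mu> M + e" using N(2)[of n] n by linarith
  qed
  define \<nu> where "\<nu> = density \<mu> (indicator (- M))"
  have \<nu>_A: "emeasure \<nu> A = emeasure \<mu> (A - M)" if "A \<in> sets borel" for A
  proof -
    have "emeasure \<nu> A = (\<integral>\<^sup>+x. indicator (A - M) x \<partial>\<mu>)"
      unfolding \<nu>_def using that Mb
      by (subst emeasure_density) (auto intro!: nn_integral_cong split: split_indicator simp del: nn_integral_indicator)
    then show ?thesis using that Mb by simp
  qed
  have "absolutely_continuous lborel \<nu>"
    unfolding absolutely_continuous_def
  proof
    fix A assume A: "A \<in> null_sets (lborel :: real measure)"
    then have Ab: "A \<in> sets borel" by (auto simp: null_sets_def)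
    \<comment> \<open>Adjoining \<open>A\<close> to \<open>M\<close> gives another null set, so
      maximality of \<open>M\<close> leaves no mass for \<open>A - M\<close>.\<close>
    have AM: "M \<union> A \<in> null_sets lborel" using M A by (rule null_sets.Un)
    then have "measure \<mu> (M \<union> A) \<le> Sup S"
      by (intro cSup_upper bdd) (auto simp: S_def)
    moreover have "measure \<mu> (M \<union> (A - M)) = measure \<mu> M + measure \<mu> (A - M)"
      using Mb Ab by (intro finite_measure_Union) auto
    ultimately have "measure \<mu> (A - M) = 0"
      using supM measure_nonneg[of \<mu> "A - M"] by (simp only: Un_Diff_cancel)
    then have "emeasure \<nu> A = 0" unfolding \<nu>_A[OF Ab] by (simp add: emeasure_eq_measure)
    then show "A \<in> null_sets \<nu>" using Ab by (auto simp: null_sets_def \<nu>_def)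
  qed
  from sigma_finite_measure.Radon_Nikodym[OF sigma_finite_lborel this] obtain f where f: "f \<in> borel_measurable lborel" "density lborel f = \<nu>"
    by (auto simp: \<nu>_def)
  define \<mu>s where "\<mu>s = density \<mu> (indicator M)"
  have s_A: "emeasure \<mu>s A = emeasure \<mu> (A \<inter> M)" if "A \<in> sets borel" for A
  proof -
    have "emeasure \<mu>s A = (\<integral>\<^sup>+x. indicator (A \<inter> M) x \<partial>\<mu>)"
      unfolding \<mu>s_def using that Mb
      by (subst emeasure_density) (auto intro!: nn_integral_cong split: split_indicator simp del: nn_integral_indicator)
    then show ?thesis using that Mb by simp
  qed
  have "lebesgue_decomposition \<mu> f \<mu>s"
    unfolding lebesgue_decomposition_def
  proof (intro conjI ballI)
    show "f \<in> borel_measurable borel" using f by simp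
    show "sets \<mu>s = sets borel" by (simp add: \<mu>s_def)
    show "\<exists>N\<in>null_sets lborel. emeasure \<mu>s (- N) = 0"
      using M Mb by (intro bexI[of _ M]) (auto simp: s_A)
    fix A :: "real set" assume A: "A \<in> sets borel"
    have "emeasure \<mu> A = emeasure \<mu> (A - M) + emeasure \<mu> (A \<inter> M)"
      using A Mb by (subst plus_emeasure) (auto simp: Int_commute intro!: arg_cong[of _ _ "emeasure \<mu>"])
    then show "emeasure \<mu> A = emeasure (density lborel f) A + emeasure \<mu>s A"
      using A by (simp add: f(2) \<nu>_A s_A)
  qed
  then show thesis by (rule that)
qed

lemma lebesgue_decomposition_density_le:
  "lebesgue_decomposition \<mu> f \<mu>s \<Longrightarrow> A \<in> sets borel \<Longrightarrow> emeasure (density lborel f) A \<le> emeasure \<mu> A"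
  unfolding lebesgue_decomposition_def by auto

text \<open>Off a null set that carries the singular part, the zeros of \<open>f\<close> have no
  \<open>\<mu>\<close> mass and hence, by the bound, no Lebesgue mass.\<close>

lemma density_pos_of_lower_bound:
  assumes dec: "lebesgue_decomposition \<mu> f \<mu>s" and \<kappa>: "\<kappa> > 0"
    and lower: "\<And>A. A \<in> sets borel \<Longrightarrow> A \<subseteq> {c..d} \<Longrightarrow> ennreal \<kappa> * emeasure lborel A \<le> emeasure \<mu> A"
  shows "AE x in lborel. x \<in> {c..d} \<longrightarrow> f x > 0"
proof -
  have [measurable]: "f \<in> borel_measurable borel" using dec by (simp add: lebesgue_decomposition_def)
  obtain N where N: "N \<in> null_sets lborel" "emeasure \<mu>s (- N) = 0" and s: "sets \<mu>s = sets borel"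
    using dec by (auto simp: lebesgue_decomposition_def)
  have Nb[measurable]: "N \<in> sets borel" using N(1) by (auto simp: null_sets_def)
  define A where "A = {x \<in> {c..d}. f x = 0} - N"
  have A: "A \<in> sets borel" unfolding A_def by measurable
  have z: "(\<lambda>x. f x * indicator A x) = (\<lambda>x. 0)"
    by (rule ext) (auto simp: A_def split: split_indicator)
  have "emeasure (density lborel f) A = 0"
    using A by (subst emeasure_density) (auto simp: z)
  moreover have "emeasure \<mu>s A \<le> emeasure \<mu>s (- N)"
    using s by (intro emeasure_mono) (auto simp: A_def)
  ultimately have "emeasure \<mu> A = 0"
    using dec A N(2) by (auto simp: lebesgue_decomposition_def)
  moreover have "ennreal \<kappa> * emeasure lborel A \<le> emeasure \<mu> A"
    by (intro lower A) (auto simp: A_def)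
  ultimately have "emeasure lborel A = 0" using \<kappa> by simp
  then have "A \<in> null_sets lborel" using A by (auto simp: null_sets_def)
  then have "A \<union> N \<in> null_sets lborel" using N(1) by (rule null_sets.Un)
  then show ?thesis
    by (rule AE_I') (auto simp: A_def not_gr_zero)
qed

text \<open>Borel-Cantelli is used twice: on \<open>A\<close> with the absolutely continuous part,
  whose almost everywhere statements concern the points where \<open>f\<close> is positive, and on
  \<open>B\<close> with Lebesgue measure.\<close>

lemma density_zero_limsup:
  assumes dec: "lebesgue_decomposition \<mu> f \<mu>s"
    and A: "\<And>k. A k \<in> sets borel" "\<And>k. k \<ge> k0 \<Longrightarrow> emeasure \<mu> (A k) \<le> ennreal ((1 / 2) ^ k)"
    and B: "\<And>k. B k \<in> sets borel" "\<And>k. k \<ge> k0 \<Longrightarrow> emeasure lborel (B k) \<le> ennreal ((1 / 2) ^ k)"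
  shows "AE x in lborel. (\<exists>\<^sub>F k in sequentially. x \<in> A k \<union> B k) \<longrightarrow> f x = 0"
proof -
  have [measurable]: "f \<in> borel_measurable borel" using dec by (simp add: lebesgue_decomposition_def)
  have sum: "summable (\<lambda>k. measure M (C (k + k0)))" "\<And>k. emeasure M (C (k + k0)) < \<infinity>"
    if le: "\<And>k. emeasure M (C (k + k0)) \<le> ennreal ((1 / 2) ^ (k + k0))" for M and C :: "nat \<Rightarrow> real set"
  proof -
    show "emeasure M (C (k + k0)) < \<infinity>" for k
      using order.strict_trans1[OF le ennreal_less_top] by simp
    have "measure M (C (k + k0)) \<le> (1 / 2) ^ (k + k0)" for k
      unfolding measure_def by (rule enn2real_leI[OF _ le]) simp
    then have "\<And>k. norm (measure M (C (k + k0))) \<le> (1 / 2) ^ (k + k0)"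
      unfolding real_norm_def abs_of_nonneg[OF measure_nonneg] .
    moreover have "summable (\<lambda>k. (1 / 2 :: real) ^ (k + k0))"
      by (rule summable_ignore_initial_segment) (simp add: summable_geometric)
    ultimately show "summable (\<lambda>k. measure M (C (k + k0)))"
      by (rule summable_comparison_test'[rotated])
  qed
  have A': "emeasure (density lborel f) (A (k + k0)) \<le> ennreal ((1 / 2) ^ (k + k0))" for k
    using lebesgue_decomposition_density_le[OF dec A(1)[of "k + k0"]] A(2)[of "k + k0"] by (auto intro: order.trans)
  have B': "emeasure lborel (B (k + k0)) \<le> ennreal ((1 / 2) ^ (k + k0))" for k
    using B(2)[of "k + k0"] by simp
  have "AE x in density lborel f. \<forall>\<^sub>F k in sequentially. x \<in> space (density lborel f) - A (k + k0)"
    by (rule borel_cantelli_AE1)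
       (use A(1) sum[of _ A, OF A'] in auto)
  then have a: "AE x in lborel. 0 < f x \<longrightarrow> (\<forall>\<^sub>F k in sequentially. x \<notin> A (k + k0))"
    by (subst (asm) AE_density) auto
  have "AE x in lborel. \<forall>\<^sub>F k in sequentially. x \<in> space lborel - B (k + k0)"
    by (rule borel_cantelli_AE1)
       (use B(1) sum[of _ B, OF B'] in auto)
  then have b: "AE x in lborel. \<forall>\<^sub>F k in sequentially. x \<notin> B (k + k0)"
    by simp
  show ?thesis
    using a b
  proof eventually_elim
    case (elim x)
    show ?case
    proof (rule impI, rule ccontr)
      assume fr: "\<exists>\<^sub>F k in sequentially. x \<in> A k \<union> B k" and "f x \<noteq> 0"
      then have "\<forall>\<^sub>F k in sequentially. x \<notin> A (k + k0)" using elim by (simp add: zero_less_iff_neq_zero)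
      with elim have "\<forall>\<^sub>F k in sequentially. x \<notin> A (k + k0) \<union> B (k + k0)"
        by (auto elim: eventually_elim2)
      then have "\<forall>\<^sub>F k in sequentially. x \<notin> A k \<union> B k"
        by (rule eventually_sequentially_seg[THEN iffD1])
      then show False using fr by (simp add: frequently_def)
    qed
  qed
qed

text \<open>The sublevel sets in a bounded interval decrease to a finite set of roots, so continuity
  from above applies.\<close>

lemma small_polynomial_set:
  fixes W :: "real poly"
  assumes W: "W \<noteq> 0" and \<epsilon>: "\<epsilon> > 0"
  obtains \<eta> where "\<eta> > 0" "emeasure lborel {x \<in> {-R..R}. \<bar>poly W x\<bar> < \<eta>} \<le> ennreal \<epsilon>"
proof -
  have [measurable]: "poly W \<in> borel_measurable borel"
    by (intro borel_measurable_continuous_onI continuous_intros)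
  define X where "X = (\<lambda>n. {x \<in> {-R..R}. \<bar>poly W x\<bar> < 1 / real (Suc n)})"
  have Xm: "X n \<in> sets lborel" for n unfolding X_def by measurable
  have "emeasure lborel (X n) \<le> emeasure lborel {-R..R}" for n
    unfolding X_def by (intro emeasure_mono) auto
  then have fin: "emeasure lborel (X n) \<noteq> \<infinity>" for n
    by (metis emeasure_lborel_Icc_eq ennreal_less_top infinity_ennreal_def le_less_trans less_irrefl)
  have dec: "decseq X"
    unfolding decseq_def X_def
  proof (safe)
    fix m n :: nat and x assume "m \<le> n" "\<bar>poly W x\<bar> < 1 / real (Suc n)"
    moreover have "1 / real (Suc n) \<le> 1 / real (Suc m)" using \<open>m \<le> n\<close> by (intro divide_left_mono) auto
    ultimately show "\<bar>poly W x\<bar> < 1 / real (Suc m)" by linarith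
  qed
  have "(\<Inter>n. X n) \<subseteq> {x. poly W x = 0}"
  proof
    fix x assume x: "x \<in> (\<Inter>n. X n)"
    show "x \<in> {x. poly W x = 0}"
    proof (rule ccontr)
      assume "x \<notin> {x. poly W x = 0}"
      then have "\<bar>poly W x\<bar> > 0" by simp
      then obtain n where "1 / real (Suc n) < \<bar>poly W x\<bar>" using nat_approx_posE by blast
      then show False using x by (auto simp: X_def dest!: spec[of _ n])
    qed
  qed
  then have "emeasure lborel (\<Inter>n. X n) = 0"
    using emeasure_lborel_countable[OF countable_finite[OF finite_subset[OF _ poly_roots_finite[OF W]]]] by blast
  then have "(\<lambda>n. emeasure lborel (X n)) \<longlonglongrightarrow> 0"
    using Lim_emeasure_decseq[of X lborel] Xm dec fin by auto
  then have "\<forall>\<^sub>F n in sequentially. emeasure lborel (X n) < ennreal \<epsilon>"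
    by (rule order_tendstoD) (use \<epsilon> in simp)
  then obtain n where "emeasure lborel (X n) < ennreal \<epsilon>" by (auto simp: eventually_sequentially)
  then show thesis using that[of "1 / real (Suc n)"] unfolding X_def by simp
qed

section \<open>Absence of absolutely continuous spectrum on the gaps\<close>

text \<open>This polynomial vanishes exactly where the vector entering the \<open>k\<close>-th plateau is an eigenvector of
  the \<open>q\<close>-step transfer matrix of that plateau.\<close>

definition plateau_poly :: "real \<Rightarrow> nat \<Rightarrow> (nat \<Rightarrow> nat) \<Rightarrow> nat \<Rightarrow> real poly" where
  "plateau_poly lam q L k = (let b = potential lam q L; s = block_start L k in
     orth_poly b (Suc (s * q)) * orth_poly b (Suc s * q) - orth_poly b (s * q) * orth_poly b (Suc (Suc s * q)))"

text \<open>The polynomial reads the potential only up to the first \<open>q\<close> sites of the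
  \<open>k\<close>-th plateau, where the clock has just reached \<open>k\<close>; the length
  \<open>L k\<close> itself is not seen.\<close>

lemma plateau_poly_cong:
  assumes eq: "\<And>i. i < k \<Longrightarrow> L i = L' i" and q: "q \<ge> 1"
  shows "plateau_poly lam q L k = plateau_poly lam q L' k"
proof -
  have s: "block_start L k = block_start L' k" by (rule block_start_cong[OF eq])
  have pot: "potential lam q L n = potential lam q L' n" if "1 \<le> n" "n \<le> Suc (block_start L k) * q" for n
  proof -
    have "n - 1 < Suc (block_start L k) * q" using that by linarith
    then have "(n - 1) div q \<le> block_start L k" using q by (simp add: less_mult_imp_div_less less_Suc_eq_le[symmetric])
    then have "slow_time L ((n - 1) div q) = slow_time L' ((n - 1) div q)" by (intro slow_time_cong eq)
    then show ?thesis by (simp add: potential_def)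
  qed
  have "orth_poly (potential lam q L) n = orth_poly (potential lam q L') n" if "n \<le> Suc (Suc (block_start L k) * q)" for n
    using that by (intro orth_cong pot) linarith+
  then show ?thesis
    unfolding plateau_poly_def Let_def s[symmetric] by simp
qed

text \<open>An elliptic real matrix has no real eigenvector, and the incoming vector never
  vanishes.\<close>

lemma plateau_poly_nonzero:
  assumes q: "q \<ge> 2" and x: "\<bar>plateau_disc lam q k x\<bar> < 2"
  shows "plateau_poly lam q L k \<noteq> 0"
proof
  assume z: "plateau_poly lam q L k = 0"
  let ?b = "potential lam q L" and ?s = "block_start L k"
  define V where "V = orth ?b (Suc (?s * q)) x"
  define W where "W = orth ?b (?s * q) x"
  define y where "y = x - profile lam (real k)"
  define e where "e = amplitude (real k)"
  define A where "A = T11 q e y"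
  define B where "B = T12 q y"
  define C where "C = T21 q e y"
  define D where "D = T22 q y"
  have "V * (C * V + D * W) - W * (A * V + B * W) = 0"
    using z orth_potential_step[OF q, of lam L ?s x]
    unfolding plateau_poly_def Let_def V_def W_def A_def B_def C_def D_def y_def e_def slow_time_block_start
    by (metis poly_0 poly_diff poly_mult)
  then have w: "C * V\<^sup>2 + (D - A) * (V * W) - B * W\<^sup>2 = 0"
    by (simp add: algebra_simps power2_eq_square)
  have det: "A * D - B * C = 1" unfolding A_def B_def C_def D_def using q by (intro T_det) simp
  have tr: "\<bar>A + D\<bar> < 2"
    using x unfolding plateau_disc_def A_def D_def T_trace y_def e_def .
  then have tr2: "(A + D)\<^sup>2 < 4" using abs_less_square_iff[of "A + D" 2] by simp
  \<comment> \<open>Completing the square: the coefficient of the second square is positive because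
    the trace is less than 2 in modulus.\<close>
  have "4 * C * (C * V\<^sup>2 + (D - A) * (V * W) - B * W\<^sup>2) = (2 * C * V + (D - A) * W)\<^sup>2 + (4 * (A * D - B * C) - (A + D)\<^sup>2) * W\<^sup>2"
    by (simp add: algebra_simps power2_eq_square)
  then have sq: "(2 * C * V + (D - A) * W)\<^sup>2 + (4 - (A + D)\<^sup>2) * W\<^sup>2 = 0" unfolding w det by simp
  have "(4 - (A + D)\<^sup>2) * W\<^sup>2 \<ge> 0" using tr2 by simp
  then have "(4 - (A + D)\<^sup>2) * W\<^sup>2 = 0" using sq zero_le_power2[of "2 * C * V + (D - A) * W"] by linarith
  then have W0: "W = 0" using tr2 by simp
  have V0: "V \<noteq> 0" using orth_consecutive_nonzero[of ?b "?s * q" x] W0 by (simp add: V_def W_def)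
  \<comment> \<open>What remains is the first basis vector as an eigenvector; the matrix is then
    triangular with real eigenvalues \<open>A\<close> and \<open>D\<close>.\<close>
  have "C * V\<^sup>2 = 0" using w W0 by simp
  then have "C = 0" using V0 by simp
  then have "A * D = 1" using det by simp
  then have "(A + D)\<^sup>2 = (A - D)\<^sup>2 + 4" by (simp add: power2_eq_square algebra_simps)
  then show False using tr2 zero_le_power2[of "A - D"] by linarith
qed

text \<open>For a repeated matrix of trace \<open>t\<close>, Cayley-Hamilton gives the area spanned
  by the incoming vector and its \<open>i\<close>-th image as \<open>cheb i t\<close> times the area
  for \<open>i = 1\<close>. In the closed gap this factor has modulus at least \<open>i\<close>, and
  an area is at most half the sum of the squared lengths.\<close>

lemma plateau_growth:
  assumes q: "q \<ge> 2" and x: "\<bar>plateau_disc lam q k x\<bar> \<ge> 2"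
  shows "real (L k) * \<bar>poly (plateau_poly lam q L k) x\<bar> \<le>
    ((orth (potential lam q L) (Suc (block_start L k * q)) x)\<^sup>2 + (orth (potential lam q L) (block_start L k * q) x)\<^sup>2 +
     (orth (potential lam q L) (Suc ((block_start L k + L k) * q)) x)\<^sup>2 + (orth (potential lam q L) ((block_start L k + L k) * q) x)\<^sup>2) / 2"
proof -
  let ?b = "potential lam q L" and ?s = "block_start L k"
  define V where "V = (\<lambda>i. orth ?b (Suc ((?s + i) * q)) x)"
  define W where "W = (\<lambda>i. orth ?b ((?s + i) * q) x)"
  define y where "y = x - profile lam (real k)"
  define e where "e = amplitude (real k)"
  define A where "A = T11 q e y"
  define B where "B = T12 q y"
  define C where "C = T21 q e y"
  define D where "D = T22 q y"
  define t where "t = plateau_disc lam q k x"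
  have step: "V (Suc i) = A * V i + B * W i" "W (Suc i) = C * V i + D * W i" if "i \<le> L k" for i
    using orth_potential_step[OF q, of lam L "?s + i" x] slow_time_rest[of i L k, OF that]
    unfolding V_def W_def A_def B_def C_def D_def y_def e_def slow_time_block_start by simp_all
  have det: "A * D - B * C = 1" unfolding A_def B_def C_def D_def using q by (intro T_det) simp
  have tr: "A + D = t"
    unfolding plateau_disc_def A_def D_def T_trace y_def e_def t_def ..
  have rec: "V (Suc (Suc i)) = t * V (Suc i) - V i" "W (Suc (Suc i)) = t * W (Suc i) - W i" if "Suc i \<le> L k" for i
  proof -
    note s1 = step[of i] and s2 = step[of "Suc i"]
    have "V (Suc (Suc i)) = (A + D) * V (Suc i) - (A * D - B * C) * V i"
      using s1 s2 that by (simp add: algebra_simps)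
    then show "V (Suc (Suc i)) = t * V (Suc i) - V i" unfolding tr det by simp
    have "W (Suc (Suc i)) = (A + D) * W (Suc i) - (A * D - B * C) * W i"
      using s1 s2 that by (simp add: algebra_simps)
    then show "W (Suc (Suc i)) = t * W (Suc i) - W i" unfolding tr det by simp
  qed
  define w where "w = poly (plateau_poly lam q L k) x"
  have w: "w = V 0 * W 1 - W 0 * V 1"
    unfolding w_def plateau_poly_def Let_def V_def W_def by simp
  have "i \<le> L k \<Longrightarrow> V 0 * W i - W 0 * V i = cheb i t * w" for i
  proof (induction i rule: induct_nat_012)
    case (ge2 i)
    have "V 0 * W (Suc (Suc i)) - W 0 * V (Suc (Suc i)) =
        t * (V 0 * W (Suc i) - W 0 * V (Suc i)) - (V 0 * W i - W 0 * V i)"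
      using ge2.prems by (simp add: rec algebra_simps)
    also have "\<dots> = cheb (Suc (Suc i)) t * w"
      using ge2 unfolding cheb_Suc_Suc by (simp add: algebra_simps del: orth_poly.simps)
    finally show ?case .
  qed (use w in auto)
  from this[OF order_refl] have "cheb (L k) t * w = V 0 * W (L k) - W 0 * V (L k)" by simp
  then have c1: "\<bar>cheb (L k) t\<bar> * \<bar>w\<bar> = \<bar>V 0 * W (L k) - W 0 * V (L k)\<bar>" by (simp add: abs_mult[symmetric])
  have c2: "real (L k) * \<bar>w\<bar> \<le> \<bar>cheb (L k) t\<bar> * \<bar>w\<bar>"
    using cheb_ge[of t "L k"] x by (intro mult_right_mono) (auto simp: t_def)
  have c3: "\<bar>a * d - c * f\<bar> \<le> (a\<^sup>2 + c\<^sup>2 + f\<^sup>2 + d\<^sup>2) / 2" for a c d f :: real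
  proof -
    have "0 \<le> (a - d)\<^sup>2 + (c + f)\<^sup>2" "0 \<le> (a + d)\<^sup>2 + (c - f)\<^sup>2" by simp_all
    then have "a * d - c * f \<le> (a\<^sup>2 + c\<^sup>2 + f\<^sup>2 + d\<^sup>2) / 2" "- (a * d - c * f) \<le> (a\<^sup>2 + c\<^sup>2 + f\<^sup>2 + d\<^sup>2) / 2"
      by (simp_all add: power2_eq_square algebra_simps)
    then show ?thesis by (rule abs_leI)
  qed
  have "real (L k) * \<bar>w\<bar> \<le> ((V 0)\<^sup>2 + (W 0)\<^sup>2 + (V (L k))\<^sup>2 + (W (L k))\<^sup>2) / 2"
    by (rule order.trans[OF c2]) (unfold c1, rule c3)
  then show ?thesis unfolding w_def V_def W_def by simp
qed

lemma measurable_plateau_disc [measurable]: "plateau_disc lam q k \<in> borel_measurable borel"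
  unfolding plateau_disc_def by (intro borel_measurable_continuous_onI continuous_intros)

text \<open>Each of the four polynomials in the growth bound has norm at most 1 in the spectral
  measure, so the bound has integral at most 2 and Markov's inequality applies.\<close>

lemma spectral_measure_plateau:
  assumes q: "q \<ge> 2" and \<mu>: "spectral_measure_of (\<lambda>_. 1) (potential lam q L) \<mu>"
    and L: "L k \<ge> 1" and \<eta>: "\<eta> > 0"
  shows "emeasure \<mu> {x. \<bar>plateau_disc lam q k x\<bar> \<ge> 2 \<and> \<bar>poly (plateau_poly lam q L k) x\<bar> \<ge> \<eta>} \<le> ennreal (2 / (real (L k) * \<eta>))"
proof -
  let ?b = "potential lam q L" and ?s = "block_start L k"
  interpret finite_measure \<mu> using \<mu> by (simp add: spectral_measure_of_def)
  have [measurable_cong]: "sets \<mu> = sets borel" using \<mu> by (simp add: spectral_measure_of_def)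
  have sp: "space \<mu> = UNIV" by (metis \<open>sets \<mu> = sets borel\<close> sets_eq_imp_space_eq space_borel)
  have int: "integrable \<mu> (\<lambda>x. (orth ?b n x)\<^sup>2)" for n
    using spectral_integrable_poly[OF \<mu>, of "orth_poly ?b n * orth_poly ?b n"]
    by (simp add: poly_mult[abs_def] power2_eq_square)
  have le1: "(\<integral>x. (orth ?b n x)\<^sup>2 \<partial>\<mu>) \<le> 1" for n
    using spectral_orthonormal[OF \<mu>, of n n] by (cases "n = 0") (auto simp: power2_eq_square)
  define h where "h = (\<lambda>x. ((orth ?b (Suc (?s * q)) x)\<^sup>2 + (orth ?b (?s * q) x)\<^sup>2 +
     (orth ?b (Suc ((?s + L k) * q)) x)\<^sup>2 + (orth ?b ((?s + L k) * q) x)\<^sup>2) / 2)"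
  have hint: "integrable \<mu> h" unfolding h_def
    by (intro Bochner_Integration.integrable_add integrable_divide int)
  have "(\<integral>x. h x \<partial>\<mu>) = ((\<integral>x. (orth ?b (Suc (?s * q)) x)\<^sup>2 \<partial>\<mu>) + (\<integral>x. (orth ?b (?s * q) x)\<^sup>2 \<partial>\<mu>) +
     (\<integral>x. (orth ?b (Suc ((?s + L k) * q)) x)\<^sup>2 \<partial>\<mu>) + (\<integral>x. (orth ?b ((?s + L k) * q) x)\<^sup>2 \<partial>\<mu>)) / 2"
    unfolding h_def
    by (simp add: int Bochner_Integration.integral_add Bochner_Integration.integrable_add del: orth_poly.simps)
  also have "\<dots> \<le> (1 + 1 + 1 + 1) / 2"
    by (intro divide_right_mono add_mono le1) simp
  finally have h2: "(\<integral>x. h x \<partial>\<mu>) \<le> 2" by simp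
  have pos: "real (L k) * \<eta> > 0" using L \<eta> by simp
  have [measurable]: "h \<in> borel_measurable \<mu>" using hint by auto
  have "emeasure \<mu> {x. \<bar>plateau_disc lam q k x\<bar> \<ge> 2 \<and> \<bar>poly (plateau_poly lam q L k) x\<bar> \<ge> \<eta>} \<le>
      emeasure \<mu> {x \<in> space \<mu>. h x \<ge> real (L k) * \<eta>}"
  proof (intro emeasure_mono subsetI)
    fix x assume "x \<in> {x. \<bar>plateau_disc lam q k x\<bar> \<ge> 2 \<and> \<bar>poly (plateau_poly lam q L k) x\<bar> \<ge> \<eta>}"
    then have x: "\<bar>plateau_disc lam q k x\<bar> \<ge> 2" "\<bar>poly (plateau_poly lam q L k) x\<bar> \<ge> \<eta>" by auto
    have "real (L k) * \<eta> \<le> real (L k) * \<bar>poly (plateau_poly lam q L k) x\<bar>"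
      using x(2) by (intro mult_left_mono) auto
    also have "\<dots> \<le> h x" unfolding h_def by (rule plateau_growth[OF q x(1)])
    finally show "x \<in> {x \<in> space \<mu>. h x \<ge> real (L k) * \<eta>}" by (simp add: sp)
  qed measurable
  also have "\<dots> = ennreal (measure \<mu> {x \<in> space \<mu>. h x \<ge> real (L k) * \<eta>})"
    by (rule emeasure_eq_measure)
  also have "\<dots> \<le> ennreal ((\<integral>x. h x \<partial>\<mu>) / (real (L k) * \<eta>))"
    by (intro ennreal_leI integral_Markov_inequality_measure[where A = UNIV] hint)
       (use pos in \<open>auto simp: h_def sp intro!: AE_I2\<close>)
  also have "\<dots> \<le> ennreal (2 / (real (L k) * \<eta>))"
    using h2 pos by (intro ennreal_leI divide_right_mono) auto
  finally show ?thesis .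
qed

text \<open>The window is bounded so that the set can be made small, and it grows with
  \<open>k\<close> so that every point is eventually inside.\<close>

definition small_root_set :: "real \<Rightarrow> nat \<Rightarrow> (nat \<Rightarrow> nat) \<Rightarrow> nat \<Rightarrow> real \<Rightarrow> real set" where
  "small_root_set lam q L k \<eta> = {x \<in> {- real k..real k}. \<bar>poly (plateau_poly lam q L k) x\<bar> < \<eta>}"

text \<open>The length of a plateau is chosen after everything before it, hence the well-founded choice.\<close>

lemma plateau_lengths_exist:
  assumes q: "q \<ge> 1"
  obtains L where "\<And>k. L k \<ge> 1"
    "\<And>k. plateau_poly lam q L k \<noteq> 0 \<Longrightarrow> \<exists>\<eta>>0. emeasure lborel (small_root_set lam q L k \<eta>) \<le> ennreal ((1 / 2) ^ k) \<and>
        2 / (real (L k) * \<eta>) \<le> (1 / 2) ^ k"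
proof -
  define P where "P = (\<lambda>L k r. r \<ge> (1 :: nat) \<and> (plateau_poly lam q L k \<noteq> 0 \<longrightarrow>
     (\<exists>\<eta>>0. emeasure lborel (small_root_set lam q L k \<eta>) \<le> ennreal ((1 / 2) ^ k) \<and> 2 / (real r * \<eta>) \<le> (1 / 2) ^ k)))"
  have "\<exists>L. \<forall>k. P L k (L k)"
  proof (rule dependent_wf_choice[of less_than P])
    show "wf less_than" by simp
    fix L L' :: "nat \<Rightarrow> nat" and k r
    assume "\<And>z. (z, k) \<in> less_than \<Longrightarrow> L z = L' z"
    then have "plateau_poly lam q L k = plateau_poly lam q L' k"
      using q by (intro plateau_poly_cong) auto
    then show "P L k r = P L' k r" unfolding P_def small_root_set_def by simp
  next
    fix k and L :: "nat \<Rightarrow> nat"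
    show "\<exists>r. P L k r"
    proof (cases "plateau_poly lam q L k = 0")
      case True
      then show ?thesis by (auto simp: P_def)
    next
      case False
      have "(1 / 2 :: real) ^ k > 0" by simp
      then obtain \<eta> where \<eta>: "\<eta> > 0" "emeasure lborel (small_root_set lam q L k \<eta>) \<le> ennreal ((1 / 2) ^ k)"
        unfolding small_root_set_def using small_polynomial_set[OF False] by blast
      \<comment> \<open>Chosen after \<open>\<eta>\<close>, and so large that the bound of
        \<open>spectral_measure_plateau\<close> is at most \<open>2^(-k)\<close>.\<close>
      define r where "r = nat \<lceil>2 * 2 ^ k / \<eta>\<rceil> + 1"
      have r0: "r > 0" by (simp add: r_def)
      have "2 * 2 ^ k / \<eta> \<le> real r" unfolding r_def using real_nat_ceiling_ge[of "2 * 2 ^ k / \<eta>"] by linarith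
      then have "2 * 2 ^ k \<le> real r * \<eta>" using \<eta>(1) by (simp add: pos_divide_le_eq)
      then have "2 / (real r * \<eta>) \<le> 2 / (2 * 2 ^ k)" 
        by (intro divide_left_mono mult_pos_pos) (use \<eta>(1) r0 in simp_all)
      then have "2 / (real r * \<eta>) \<le> (1 / 2) ^ k" by (simp add: power_divide)
      then show ?thesis using \<eta> by (intro exI[of _ r]) (auto simp: P_def r_def)
    qed
  qed
  then obtain L where "\<And>k. P L k (L k)" by blast
  then show thesis by (intro that[of L]) (auto simp: P_def)
qed

text \<open>Shifting an elliptic point of the free trace by the plateau value gives an elliptic
  point of the plateau once the bump is small. The threshold is the same for all
  \<open>L\<close>.\<close>

lemma plateau_poly_eventually_nonzero:
  assumes q: "q \<ge> 2" and lam: "0 \<le> lam"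
  shows "\<forall>\<^sub>F k in sequentially. \<forall>L. plateau_poly lam q L k \<noteq> 0"
proof -
  obtain y where y: "\<bar>disc q y\<bar> < 2" using exists_elliptic[of q] q by auto
  have "(\<lambda>k. disc q y - amplitude (real k) * cheb q y) \<longlonglongrightarrow> disc q y - 0 * cheb q y"
    by (intro tendsto_intros filterlim_compose[OF amplitude_tendsto_0 filterlim_real_sequentially])
  then have "(\<lambda>k. \<bar>disc q y - amplitude (real k) * cheb q y\<bar>) \<longlonglongrightarrow> \<bar>disc q y\<bar>"
    by (intro tendsto_rabs) simp
  then have "\<forall>\<^sub>F k in sequentially. \<bar>disc q y - amplitude (real k) * cheb q y\<bar> < 2"
    by (rule order_tendstoD) (rule y)
  then show ?thesis
  proof eventually_elim
    case (elim k)
    have "\<bar>plateau_disc lam q k (y + profile lam (real k))\<bar> < 2"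
      using elim by (simp add: plateau_disc_def)
    then show ?case using plateau_poly_nonzero[OF q] by blast
  qed
qed

text \<open>In the gap of plateau \<open>k\<close>, the points with a large plateau polynomial have
  small spectral measure, and the other points of \<open>[-k, k]\<close> have small Lebesgue
  measure; both bounds are summable in \<open>k\<close>.\<close>

lemma density_zero_on_gaps:
  assumes q: "q \<ge> 2" and lam: "0 \<le> lam" and L: "\<And>k. L k \<ge> 1"
    and len: "\<And>k. plateau_poly lam q L k \<noteq> 0 \<Longrightarrow> \<exists>\<eta>>0. emeasure lborel (small_root_set lam q L k \<eta>) \<le> ennreal ((1 / 2) ^ k) \<and>
        2 / (real (L k) * \<eta>) \<le> (1 / 2) ^ k"
    and \<mu>: "spectral_measure_of (\<lambda>_. 1) (potential lam q L) \<mu>" and dec: "lebesgue_decomposition \<mu> f \<mu>s"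
  shows "AE x in lborel. (\<exists>\<^sub>F k in sequentially. \<bar>plateau_disc lam q k x\<bar> \<ge> 2) \<longrightarrow> f x = 0"
proof -
  obtain k0 where k0: "\<And>k. k \<ge> k0 \<Longrightarrow> plateau_poly lam q L k \<noteq> 0"
    using plateau_poly_eventually_nonzero[OF q lam] by (auto simp: eventually_sequentially)
  have "\<exists>\<eta>. k \<ge> k0 \<longrightarrow> (\<eta> > 0 \<and> emeasure lborel (small_root_set lam q L k \<eta>) \<le> ennreal ((1 / 2) ^ k) \<and>
        2 / (real (L k) * \<eta>) \<le> (1 / 2) ^ k)" for k
    using len[OF k0[of k]] by blast
  then obtain \<eta> where \<eta>: "\<And>k. k \<ge> k0 \<Longrightarrow> \<eta> k > 0"
    "\<And>k. k \<ge> k0 \<Longrightarrow> emeasure lborel (small_root_set lam q L k (\<eta> k)) \<le> ennreal ((1 / 2) ^ k)"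
    "\<And>k. k \<ge> k0 \<Longrightarrow> 2 / (real (L k) * \<eta> k) \<le> (1 / 2) ^ k" by metis
  define A where "A = (\<lambda>k. {x. \<bar>plateau_disc lam q k x\<bar> \<ge> 2 \<and> \<bar>poly (plateau_poly lam q L k) x\<bar> \<ge> \<eta> k})"
  define B where "B = (\<lambda>k. small_root_set lam q L k (\<eta> k))"
  have [measurable]: "poly p \<in> borel_measurable borel" for p :: "real poly"
    by (intro borel_measurable_continuous_onI continuous_intros)
  have "AE x in lborel. (\<exists>\<^sub>F k in sequentially. x \<in> A k \<union> B k) \<longrightarrow> f x = 0"
  proof (rule density_zero_limsup[OF dec, where ?k0.0 = k0])
    show "A k \<in> sets borel" "B k \<in> sets borel" for k
      unfolding A_def B_def small_root_set_def by measurable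
    show "emeasure lborel (B k) \<le> ennreal ((1 / 2) ^ k)" if "k \<ge> k0" for k
      unfolding B_def by (rule \<eta>(2)[OF that])
    show "emeasure \<mu> (A k) \<le> ennreal ((1 / 2) ^ k)" if "k \<ge> k0" for k
      unfolding A_def
      by (rule order.trans[OF spectral_measure_plateau[OF q \<mu> L \<eta>(1)[OF that]] ennreal_leI[OF \<eta>(3)[OF that]]])
  qed
  then show ?thesis
  proof eventually_elim
    case (elim x)
    have "\<forall>\<^sub>F k in sequentially. x \<in> {- real k..real k}"
      using eventually_ge_at_top[of "nat \<lceil>\<bar>x\<bar>\<rceil>"]
      by eventually_elim (auto simp: nat_le_iff ceiling_le_iff)
    then have ev: "\<forall>\<^sub>F k in sequentially. \<bar>plateau_disc lam q k x\<bar> \<ge> 2 \<longrightarrow> x \<in> A k \<union> B k"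
      by eventually_elim (auto simp: A_def B_def small_root_set_def)
    show ?case
    proof
      assume "\<exists>\<^sub>F k in sequentially. \<bar>plateau_disc lam q k x\<bar> \<ge> 2"
      then have "\<exists>\<^sub>F k in sequentially. x \<in> A k \<union> B k"
        using ev by (rule frequently_rev_mp)
      then show "f x = 0" using elim by blast
    qed
  qed
qed

section \<open>Spectra of constant Jacobi matrices\<close>

lemma transfer_const:
  "transfer (const_jacobi 1 \<beta>) (Suc n) x =
    vector [vector [cheb (Suc (Suc n)) (x - \<beta>), - cheb (Suc n) (x - \<beta>)],
            vector [cheb (Suc n) (x - \<beta>), - cheb n (x - \<beta>)]]"
proof (induction n)
  case 0
  show ?case
    by (simp add: const_jacobi_def transfer_step_def matrix_mul_rid)
next
  case (Suc n)
  show ?case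
    unfolding transfer.simps(2)[of _ "Suc n"] Suc cheb_Suc_Suc[of "Suc n"]
    by (simp add: const_jacobi_def transfer_step_def vec_eq_iff forall_2 matrix_matrix_mult_def sum_2
        cheb_Suc_Suc algebra_simps del: orth_poly.simps(3))
qed

lemma discriminant_const: "q \<ge> 1 \<Longrightarrow> discriminant (const_jacobi 1 \<beta>) q x = disc q (x - \<beta>)"
  unfolding discriminant_def
  by (cases q) (simp_all add: transfer_const disc_def trace_def sum_2 del: orth_poly.simps transfer.simps)

lemma q_int_spectrum_const:
  "q \<ge> 1 \<Longrightarrow> q_int_spectrum q (const_jacobi 1 \<beta>) = {x. \<bar>disc q (x - \<beta>)\<bar> < 2}"
  by (auto simp: q_int_spectrum_def discriminant_const)

lemma finite_support_l2Z:
  assumes "finite A" "\<And>n. n \<notin> A \<Longrightarrow> u n = 0"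
  shows "u \<in> l2Z" and "l2Z_norm u = sqrt (\<Sum>n\<in>A. (cmod (u n))\<^sup>2)"
proof -
  have "(\<lambda>n. (cmod (u n))\<^sup>2) summable_on UNIV \<longleftrightarrow> (\<lambda>n. (cmod (u n))\<^sup>2) summable_on A"
    using assms(2) by (intro summable_on_cong_neutral) auto
  then show "u \<in> l2Z" using assms(1) by (simp add: l2Z_def)
  have "(\<Sum>\<^sub>\<infinity>n. (cmod (u n))\<^sup>2) = (\<Sum>\<^sub>\<infinity>n\<in>A. (cmod (u n))\<^sup>2)"
    using assms(2) by (intro infsum_cong_neutral) auto
  then show "l2Z_norm u = sqrt (\<Sum>n\<in>A. (cmod (u n))\<^sup>2)"
    using assms(1) by (simp add: l2Z_norm_def)
qed

text \<open>Truncated plane waves are approximate eigenvectors.\<close>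

lemma const_jacobi_spectrum:
  assumes "\<bar>x - \<beta>\<bar> < 2"
  shows "x \<in> jacobi_spectrum (const_jacobi 1 \<beta>)"
proof (rule ccontr)
  assume "x \<notin> jacobi_spectrum (const_jacobi 1 \<beta>)"
  then obtain C where C: "\<And>u. u \<in> l2Z \<Longrightarrow>
      l2Z_norm u \<le> C * l2Z_norm (jacobi_shifted (const_jacobi 1 \<beta>) (of_real x) u)"
    by (auto simp: jacobi_spectrum_def jacobi_resolvent_set_def)
  \<comment> \<open>The quasimomentum of \<open>x\<close>: the plane wave \<open>w\<close> solves
    the eigenvalue equation exactly on the whole line.\<close>
  define t where "t = arccos ((x - \<beta>) / 2)"
  have t: "2 * cos t = x - \<beta>" using assms by (simp add: t_def)
  define w where "w = (\<lambda>n::int. cis (t * of_int n))"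
  have w: "w (n - 1) + w (n + 1) = of_real (x - \<beta>) * w n" for n
  proof -
    have "w (n - 1) = w n * cis (- t)" "w (n + 1) = w n * cis t"
      by (simp_all add: w_def cis_mult algebra_simps)
    then have "w (n - 1) + w (n + 1) = w n * (cis (- t) + cis t)" by (simp add: algebra_simps)
    also have "cis (- t) + cis t = of_real (2 * cos t)" by (simp add: complex_eq_iff)
    finally show ?thesis unfolding t by simp
  qed
  have bound: "sqrt (real N) \<le> \<bar>C\<bar> * 8" if N: "N \<ge> 2" for N :: nat
  proof -
    define u where "u = (\<lambda>n::int. if 1 \<le> n \<and> n \<le> int N then w n else 0)"
    have cw: "cmod (w n) = 1" for n by (simp add: w_def)
    have u1: "cmod (u n) \<le> 1" for n by (simp add: u_def cw)
    have u: "u \<in> l2Z" by (rule finite_support_l2Z(1)[of "{1..int N}"]) (auto simp: u_def)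
    have nu0: "l2Z_norm u = sqrt (\<Sum>n\<in>{1..int N}. (cmod (u n))\<^sup>2)"
      by (rule finite_support_l2Z(2)) (auto simp: u_def)
    have "(\<Sum>n\<in>{1..int N}. (cmod (u n))\<^sup>2) = (\<Sum>n\<in>{1..int N}. 1)"
      by (intro sum.cong refl) (simp add: u_def cw)
    then have nu: "l2Z_norm u = sqrt (real N)" using nu0 by simp
    let ?v = "jacobi_shifted (const_jacobi 1 \<beta>) (of_real x) u"
    \<comment> \<open>Truncation spoils the equation only at these sites, by at most 4 at each.
      Hence the residual has norm at most 8, while \<open>u\<close> has norm
      \<open>sqrt N\<close>.\<close>
    let ?A = "{0, 1, int N, int N + 1}"
    have v: "?v n = u (n - 1) - of_real (x - \<beta>) * u n + u (n + 1)" for n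
      by (simp add: jacobi_shifted_def const_jacobi_def algebra_simps)
    have v0: "?v n = 0" if n: "n \<notin> ?A" for n
    proof -
      consider "n < 0" | "n > int N + 1" | "2 \<le> n" "n \<le> int N - 1" using n by fastforce
      then show ?thesis
      proof cases
        case 3
        then have "u (n - 1) = w (n - 1)" "u n = w n" "u (n + 1) = w (n + 1)" by (auto simp: u_def)
        then show ?thesis unfolding v using w[of n] by (simp add: algebra_simps)
      qed (unfold v, auto simp: u_def)
    qed
    have v4: "cmod (?v n) \<le> 4" for n
    proof -
      have "cmod (?v n) \<le> cmod (u (n - 1) - of_real (x - \<beta>) * u n) + cmod (u (n + 1))"
        unfolding v by (rule norm_triangle_ineq)
      also have "cmod (u (n - 1) - of_real (x - \<beta>) * u n) \<le> cmod (u (n - 1)) + cmod (of_real (x - \<beta>) * u n)"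
        by (rule norm_triangle_ineq4)
      also have "cmod (of_real (x - \<beta>) * u n) \<le> 2 * 1"
        unfolding norm_mult norm_of_real using assms u1 by (intro mult_mono) auto
      finally show ?thesis using u1[of "n - 1"] u1[of "n + 1"] by linarith
    qed
    have "l2Z_norm ?v = sqrt (\<Sum>n\<in>?A. (cmod (?v n))\<^sup>2)"
      by (rule finite_support_l2Z(2)) (use v0 in auto)
    also have "\<dots> \<le> sqrt (\<Sum>n\<in>?A. 4\<^sup>2)"
      by (intro real_sqrt_le_mono sum_mono power_mono v4) auto
    also have "\<dots> \<le> sqrt (8\<^sup>2)"
    proof (intro real_sqrt_le_mono)
      have "card ?A \<le> 4" by (intro order.trans[OF card_insert_le_m1]) auto
      then have "real (card ?A) \<le> 4" by simp
      then show "(\<Sum>n\<in>?A. 4\<^sup>2) \<le> (8\<^sup>2 :: real)" unfolding sum_constant by simp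
    qed
    finally have nv: "l2Z_norm ?v \<le> 8" by simp
    have nv0: "l2Z_norm ?v \<ge> 0" unfolding l2Z_norm_def by (simp add: infsum_nonneg)
    have "l2Z_norm u \<le> C * l2Z_norm ?v" by (rule C[OF u])
    also have "\<dots> \<le> \<bar>C\<bar> * 8" using nv nv0 by (intro mult_mono) auto
    finally show ?thesis unfolding nu .
  qed
  obtain N :: nat where N: "(\<bar>C\<bar> * 8)\<^sup>2 + 2 < real N" using reals_Archimedean2 by blast
  then have "N \<ge> 2" using zero_le_power2[of "\<bar>C\<bar> * 8"] by linarith
  from bound[OF this] have "(sqrt (real N))\<^sup>2 \<le> (\<bar>C\<bar> * 8)\<^sup>2" by (intro power_mono) auto
  then show False using N by simp
qed

section \<open>Covering by gaps\<close>

text \<open>The times given by \<open>1 + t = X i\<close> solve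
  \<open>profile lam t = \<beta>\<close> exactly; rounding to integers moves the logarithm by at
  most \<open>1 / X i\<close>.\<close>

lemma profile_cluster:
  assumes lam: "0 < lam" and \<beta>: "\<beta> \<in> {-lam..lam}"
  obtains k :: "nat \<Rightarrow> nat" where "filterlim k at_top sequentially" "(\<lambda>i. profile lam (real (k i))) \<longlonglongrightarrow> \<beta>"
proof -
  define \<phi> where "\<phi> = arcsin (\<beta> / lam)"
  have \<phi>: "lam * sin \<phi> = \<beta>"
    unfolding \<phi>_def using lam \<beta> by (subst sin_arcsin) (auto simp: field_simps)
  define X where "X = (\<lambda>i::nat. exp (\<phi> + 2 * pi * real i))"
  define k where "k = (\<lambda>i. nat \<lfloor>X i\<rfloor>)"
  have X0: "X i > 0" for i by (simp add: X_def)
  have Xtop: "filterlim X at_top sequentially"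
    unfolding X_def
    by (intro filterlim_compose[OF exp_at_top] filterlim_tendsto_add_at_top[OF tendsto_const]
        filterlim_tendsto_pos_mult_at_top[OF tendsto_const] filterlim_real_sequentially) auto
  have k: "X i - 1 \<le> real (k i)" "real (k i) \<le> X i" for i
    unfolding k_def using X0[of i] by (auto simp: of_nat_nat)
  show thesis
  proof
    have "filterlim (\<lambda>i. - 1 + X i) at_top sequentially"
      by (rule filterlim_tendsto_add_at_top[OF tendsto_const Xtop])
    then have "filterlim (\<lambda>i. real (k i)) at_top sequentially"
      by (rule filterlim_at_top_mono) (use k in auto)
    then show "filterlim k at_top sequentially"
      by (simp add: filterlim_sequentially_iff_filterlim_real)
    have lo: "0 \<le> ln (1 + real (k i)) - ln (X i)" for i
      using k(1)[of i] X0[of i] by simp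
    have up: "ln (1 + real (k i)) - ln (X i) \<le> 1 / X i" for i
    proof -
      have "ln (1 + real (k i)) - ln (X i) = ln ((1 + real (k i)) / X i)"
        using X0[of i] by (simp add: ln_div add_pos_nonneg)
      also have "\<dots> \<le> (1 + real (k i)) / X i - 1"
        using X0[of i] by (intro ln_le_minus_one) (auto simp: add_pos_nonneg)
      also have "\<dots> \<le> 1 / X i" using k(2)[of i] X0[of i] by (simp add: field_simps)
      finally show ?thesis .
    qed
    have "(\<lambda>i. ln (1 + real (k i)) - ln (X i)) \<longlonglongrightarrow> 0"
    proof (rule tendsto_sandwich[OF _ _ tendsto_const])
      show "(\<lambda>i. 1 / X i) \<longlonglongrightarrow> 0"
        by (intro tendsto_divide_0[OF tendsto_const] filterlim_at_top_imp_at_infinity Xtop)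
    qed (use lo up in auto)
    then have "(\<lambda>i. ln (1 + real (k i)) - ln (X i) + \<phi>) \<longlonglongrightarrow> 0 + \<phi>"
      by (intro tendsto_add tendsto_const)
    then have "(\<lambda>i. lam * sin (ln (1 + real (k i)) - ln (X i) + \<phi>)) \<longlonglongrightarrow> lam * sin (0 + \<phi>)"
      by (intro tendsto_mult tendsto_const tendsto_sin)
    moreover have "lam * sin (ln (1 + real (k i)) - ln (X i) + \<phi>) = profile lam (real (k i))" for i
    proof -
      have e1: "ln (1 + real (k i)) - ln (X i) + \<phi> = ln (1 + real (k i)) - 2 * pi * real i"
        by (simp add: X_def)
      have e2: "sin (u - 2 * pi * real i) = sin u" for u
      proof -
        have "2 * pi * real i = 2 * real i * pi" by simp
        then show ?thesis by (simp only: sin_diff sin_2npi cos_2npi)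
      qed
      show ?thesis unfolding e1 e2 profile_def ..
    qed
    ultimately show "(\<lambda>i. profile lam (real (k i))) \<longlonglongrightarrow> \<beta>" using \<phi> by simp
  qed
qed

text \<open>A discrete intermediate value argument between a time near \<open>- lam\<close> and a
  later one near \<open>lam\<close>. Upward crossings are wanted because \<open>gap_opening\<close>
  yields the gap to the right of the touching point, that is for profile values just below the
  critical one.\<close>

lemma profile_crossing:
  assumes lam: "0 < lam" and y: "- lam < y" "y < lam"
  shows "\<exists>\<^sub>F k in sequentially. profile lam (real k) < y \<and> y \<le> profile lam (real (Suc k))"
  unfolding frequently_sequentially
proof
  fix N
  obtain k1 :: "nat \<Rightarrow> nat" where k1: "filterlim k1 at_top sequentially" "(\<lambda>i. profile lam (real (k1 i))) \<longlonglongrightarrow> - lam"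
    using profile_cluster[OF lam, of "- lam"] lam by auto
  obtain k2 :: "nat \<Rightarrow> nat" where k2: "filterlim k2 at_top sequentially" "(\<lambda>i. profile lam (real (k2 i))) \<longlonglongrightarrow> lam"
    using profile_cluster[OF lam, of lam] lam by auto
  have "\<forall>\<^sub>F i in sequentially. N \<le> k1 i \<and> profile lam (real (k1 i)) < y"
    using filterlim_at_top[THEN iffD1, OF k1(1), rule_format, of N] order_tendstoD(2)[OF k1(2) y(1)]
    by eventually_elim simp
  then obtain n1 where n1: "N \<le> n1" "profile lam (real n1) < y"
    using eventually_happens' sequentially_bot by blast
  have "\<forall>\<^sub>F i in sequentially. n1 \<le> k2 i \<and> y < profile lam (real (k2 i))"
    using filterlim_at_top[THEN iffD1, OF k2(1), rule_format, of n1] order_tendstoD(1)[OF k2(2) y(2)]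
    by eventually_elim simp
  then obtain n2 where n2: "n1 \<le> n2" "y < profile lam (real n2)"
    using eventually_happens' sequentially_bot by blast
  define P where "P = (\<lambda>n. n1 \<le> n \<and> y \<le> profile lam (real n))"
  define n where "n = (LEAST n. P n)"
  have "P n" unfolding n_def by (rule LeastI[of _ n2]) (use n2 in \<open>auto simp: P_def\<close>)
  then have n: "n1 < n" "y \<le> profile lam (real n)" using n1(2) by (auto simp: P_def le_less)
  then obtain m where m: "n = Suc m" by (cases n) auto
  have "\<not> P m" using not_less_Least[of m P] m unfolding n_def by simp
  then have "profile lam (real m) < y" using n(1) m by (auto simp: P_def)
  then show "\<exists>m\<ge>N. profile lam (real m) < y \<and> y \<le> profile lam (real (Suc m))"
    using n m n1(1) by (intro exI[of _ m]) auto
qed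

lemma profile_increment:
  assumes "0 \<le> lam" "0 \<le> t" "0 \<le> r"
  shows "\<bar>profile lam (t + r) - profile lam t\<bar> \<le> lam / (1 + t) * r"
proof -
  have "norm (profile lam (t + r) - profile lam t) \<le> lam / (1 + t) * norm (t + r - t)"
  proof (rule field_differentiable_bound[of "{t..}"])
    fix u assume u: "u \<in> {t..}"
    show "(profile lam has_field_derivative lam * (cos (ln (1 + u)) / (1 + u))) (at u within {t..})"
      unfolding profile_def[abs_def] using u assms by (auto intro!: derivative_eq_intros simp: field_simps)
    have "lam * \<bar>cos (ln (1 + u))\<bar> / (1 + u) \<le> lam * 1 / (1 + t)"
      using u assms abs_cos_le_one by (intro frac_le mult_left_mono) auto
    then show "norm (lam * (cos (ln (1 + u)) / (1 + u))) \<le> lam / (1 + t)"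
      using u assms by (simp add: abs_mult abs_divide)
  qed (use assms in \<open>auto simp: convex_real_interval\<close>)
  then show ?thesis using assms by simp
qed

text \<open>Identifies the bound of \<open>profile_increment\<close> as \<open>lam\<close> times the
  squared bump.\<close>

lemma amplitude_square: "0 \<le> t \<Longrightarrow> amplitude t * amplitude t = 1 / (1 + t)"
  unfolding amplitude_def by (simp add: powr_add[symmetric] powr_minus_divide)

definition stable_set :: "real \<Rightarrow> nat \<Rightarrow> real set" where
  "stable_set lam q = {x. \<forall>\<beta>\<in>{-lam..lam}. \<bar>disc q (x - \<beta>)\<bar> < 2}"

text \<open>The points at which a critical \<open>\<beta>\<close> may be an endpoint
  \<open>lam\<close> or \<open>- lam\<close>, which the profile need not cross.\<close>

definition exceptional_set :: "real \<Rightarrow> nat \<Rightarrow> real set" where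
  "exceptional_set lam q = {2 - lam, lam - 2} \<union> (\<lambda>z. z + lam) ` {z. cheb q z = 0} \<union> (\<lambda>z. z - lam) ` {z. cheb q z = 0}"

lemma finite_exceptional_set: "q \<ge> 1 \<Longrightarrow> finite (exceptional_set lam q)"
  unfolding exceptional_set_def by (simp add: finite_cheb_zeros)

text \<open>Outside the common band the trace exceeds 2 strictly for a suitable
  \<open>\<beta>0\<close>, and this survives a small bump at times clustering there. For a touching
  point, the time just before an upward crossing places \<open>x\<close> inside the opened
  gap.\<close>

lemma unstable_frequently_gap:
  assumes lam: "0 < lam" and q: "q \<ge> 1" and x: "x \<notin> stable_set lam q" "x \<notin> exceptional_set lam q"
  shows "\<exists>\<^sub>F k in sequentially. \<bar>plateau_disc lam q k x\<bar> \<ge> 2"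
proof -
  obtain \<beta> where \<beta>: "\<beta> \<in> {-lam..lam}" "\<bar>disc q (x - \<beta>)\<bar> \<ge> 2"
    using x(1) by (auto simp: stable_set_def not_less)
  have far: "\<exists>\<^sub>F k in sequentially. \<bar>plateau_disc lam q k x\<bar> \<ge> 2"
    if \<beta>0: "\<beta>0 \<in> {-lam..lam}" "\<bar>x - \<beta>0\<bar> > 2" for \<beta>0
  proof -
    obtain k :: "nat \<Rightarrow> nat" where k: "filterlim k at_top sequentially" "(\<lambda>i. profile lam (real (k i))) \<longlonglongrightarrow> \<beta>0"
      by (rule profile_cluster[OF lam \<beta>0(1)])
    have amp: "(\<lambda>i. amplitude (real (k i))) \<longlonglongrightarrow> 0"
      by (intro filterlim_compose[OF amplitude_tendsto_0] filterlim_compose[OF filterlim_real_sequentially] k)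
    have c: "isCont (disc q) y" "isCont (cheb q) y" for y
      using continuous_on_disc[of UNIV "\<lambda>x. x" q] by (auto simp: continuous_on_eq_continuous_at)
    have "(\<lambda>i. disc q (x - profile lam (real (k i))) - amplitude (real (k i)) * cheb q (x - profile lam (real (k i))))
        \<longlonglongrightarrow> disc q (x - \<beta>0) - 0 * cheb q (x - \<beta>0)"
      by (intro tendsto_intros amp isCont_tendsto_compose[OF c(1)] isCont_tendsto_compose[OF c(2)] k)
    then have "(\<lambda>i. \<bar>plateau_disc lam q (k i) x\<bar>) \<longlonglongrightarrow> \<bar>disc q (x - \<beta>0)\<bar>"
      unfolding plateau_disc_def by (intro tendsto_rabs) simp
    then have "\<forall>\<^sub>F i in sequentially. \<bar>plateau_disc lam q (k i) x\<bar> > 2"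
      by (rule order_tendstoD) (rule disc_gt_2[OF q \<beta>0(2)])
    then have ev: "\<forall>\<^sub>F i in sequentially. \<bar>plateau_disc lam q (k i) x\<bar> \<ge> 2"
      by eventually_elim simp
    show ?thesis
      unfolding frequently_sequentially
    proof
      fix N
      have "\<forall>\<^sub>F i in sequentially. N \<le> k i \<and> \<bar>plateau_disc lam q (k i) x\<bar> \<ge> 2"
        using filterlim_at_top[THEN iffD1, OF k(1), rule_format, of N] ev by eventually_elim simp
      then show "\<exists>n\<ge>N. \<bar>plateau_disc lam q n x\<bar> \<ge> 2"
        using eventually_happens' sequentially_bot by blast
    qed
  qed
  consider "\<bar>x - \<beta>\<bar> \<ge> 2" | "cheb q (x - \<beta>) = 0" using disc_ge_2_cases[OF q \<beta>(2)] by blast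
  then show ?thesis
  proof cases
    case 1
    have ne: "x \<noteq> 2 - lam" "x \<noteq> lam - 2" using x(2) by (auto simp: exceptional_set_def)
    have "x > 2 - lam \<or> x < lam - 2" using 1 \<beta>(1) ne by (auto simp: abs_if split: if_splits)
    then show ?thesis using far[of "- lam"] far[of lam] lam by auto
  next
    case 2
    define z where "z = x - \<beta>"
    have z: "cheb q z = 0" using 2 by (simp add: z_def)
    obtain \<kappa> where \<kappa>: "\<kappa> > 0"
      "\<And>\<epsilon> h. 0 < \<epsilon> \<Longrightarrow> \<epsilon> \<le> 1 \<Longrightarrow> 0 < h \<Longrightarrow> h \<le> \<kappa> * \<epsilon> \<Longrightarrow> 2 \<le> \<bar>disc q (z + h) - \<epsilon> * cheb q (z + h)\<bar>"
      using gap_opening[OF q z] by metis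
    have "\<beta> \<noteq> lam" "\<beta> \<noteq> - lam"
    proof -
      show "\<beta> \<noteq> lam"
      proof
        assume "\<beta> = lam"
        then have "x = z + lam" by (simp add: z_def)
        then show False using x(2) z by (auto simp: exceptional_set_def)
      qed
      show "\<beta> \<noteq> - lam"
      proof
        assume "\<beta> = - lam"
        then have "x = z - lam" by (simp add: z_def)
        then show False using x(2) z by (auto simp: exceptional_set_def)
      qed
    qed
    then have \<beta>': "- lam < \<beta>" "\<beta> < lam" using \<beta>(1) by auto
    have "(\<lambda>k. lam * amplitude (real k)) \<longlonglongrightarrow> lam * 0"
      by (intro tendsto_intros filterlim_compose[OF amplitude_tendsto_0 filterlim_real_sequentially])
    then have "\<forall>\<^sub>F k in sequentially. lam * amplitude (real k) < \<kappa>"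
      by (rule order_tendstoD) (use \<kappa> in simp)
    then have "\<forall>\<^sub>F k in sequentially. profile lam (real k) < \<beta> \<and> \<beta> \<le> profile lam (real (Suc k)) \<longrightarrow>
        \<bar>plateau_disc lam q k x\<bar> \<ge> 2"
    proof eventually_elim
      case (elim k)
      show ?case
      proof
        assume cr: "profile lam (real k) < \<beta> \<and> \<beta> \<le> profile lam (real (Suc k))"
        \<comment> \<open>The distance to the critical value is at most one unit increment, hence of
          the order of the squared bump, and so it falls below the gap width
          \<open>\<kappa> * amplitude (real k)\<close>.\<close>
        define h where "h = \<beta> - profile lam (real k)"
        have h0: "h > 0" using cr by (simp add: h_def)
        have "h \<le> profile lam (real k + 1) - profile lam (real k)"
          using cr by (simp add: h_def add.commute)
        also have "\<dots> \<le> lam / (1 + real k) * 1"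
          using profile_increment[of lam "real k" 1] lam by linarith
        also have "\<dots> = lam * amplitude (real k) * amplitude (real k)"
          using amplitude_square[of "real k"] by (simp add: mult.assoc)
        also have "\<dots> \<le> \<kappa> * amplitude (real k)"
          using elim amplitude_bounds(1)[of "real k"] by (intro mult_right_mono) auto
        finally have h: "h \<le> \<kappa> * amplitude (real k)" .
        have "x - profile lam (real k) = z + h" by (simp add: z_def h_def)
        then show "\<bar>plateau_disc lam q k x\<bar> \<ge> 2"
          using \<kappa>(2)[OF _ _ h0 h] amplitude_bounds[of "real k"] by (simp add: plateau_disc_def)
      qed
    qed
    then show ?thesis
      by (rule frequently_rev_mp[OF profile_crossing[OF lam \<beta>']])
  qed
qed

text \<open>The complement is the sum of a compact and a closed set.\<close>

lemma open_stable_set: "open (stable_set lam q)"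
proof -
  have "closed {y. \<bar>disc q y\<bar> \<ge> 2}" by (intro closed_Collect_le continuous_intros)
  then have "closed (\<Union>\<beta>\<in>{-lam..lam}. \<Union>y\<in>{y. \<bar>disc q y\<bar> \<ge> 2}. {\<beta> + y})"
    by (intro compact_closed_sums) auto
  also have "(\<Union>\<beta>\<in>{-lam..lam}. \<Union>y\<in>{y. \<bar>disc q y\<bar> \<ge> 2}. {\<beta> + y}) = - stable_set lam q"
  proof (intro set_eqI iffI)
    fix x assume "x \<in> - stable_set lam q"
    then obtain \<beta> where "\<beta> \<in> {-lam..lam}" "\<bar>disc q (x - \<beta>)\<bar> \<ge> 2"
      by (auto simp: stable_set_def not_less)
    then show "x \<in> (\<Union>\<beta>\<in>{-lam..lam}. \<Union>y\<in>{y. \<bar>disc q y\<bar> \<ge> 2}. {\<beta> + y})"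
      by (intro UN_I[of \<beta>] UN_I[of "x - \<beta>"]) auto
  next
    fix x assume "x \<in> (\<Union>\<beta>\<in>{-lam..lam}. \<Union>y\<in>{y. \<bar>disc q y\<bar> \<ge> 2}. {\<beta> + y})"
    then obtain \<beta> y where "\<beta> \<in> {-lam..lam}" "2 \<le> \<bar>disc q y\<bar>" "x = \<beta> + y" by auto
    then show "x \<in> - stable_set lam q"
      by (auto simp: stable_set_def not_less intro!: bexI[of _ \<beta>])
  qed
  finally show ?thesis by (simp add: open_closed)
qed

section \<open>Right limits and square summable variation\<close>

lemma potential_near_profile:
  "\<bar>potential lam q L n - profile lam (slow_time L ((n - 1) div q))\<bar> \<le> amplitude (slow_time L ((n - 1) div q))"
  using amplitude_bounds(1)[OF slow_time_nonneg[of L "(n - 1) div q"]] by (simp add: potential_def)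

lemma potential_bound: "0 \<le> lam \<Longrightarrow> \<bar>potential lam q L n\<bar> \<le> lam + 1"
  using potential_near_profile[of lam q L n] profile_bound[of lam "slow_time L ((n - 1) div q)"]
    amplitude_bounds(2)[OF slow_time_nonneg[of L "(n - 1) div q"]] by linarith

lemma filterlim_block_index: "q \<ge> 1 \<Longrightarrow> filterlim (\<lambda>n. (n - 1) div q) at_top sequentially"
  unfolding filterlim_at_top
proof
  fix Z :: nat assume q: "q \<ge> 1"
  show "\<forall>\<^sub>F n in sequentially. Z \<le> (n - 1) div q"
    using eventually_ge_at_top[of "Z * q + 1"]
  proof eventually_elim
    case (elim n)
    then have "Z * q \<le> n - 1" by simp
    then show ?case using div_le_mono[of "Z * q" "n - 1" q] q by simp
  qed
qed

lemma amplitude_block_tendsto_0: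
  "q \<ge> 1 \<Longrightarrow> (\<lambda>n. amplitude (slow_time L ((n - 1) div q))) \<longlonglongrightarrow> 0"
  by (rule filterlim_compose[OF amplitude_tendsto_0 filterlim_compose[OF slow_time_at_top filterlim_block_index]])

lemma speed_tendsto_0: "speed L \<longlonglongrightarrow> 0"
proof -
  have "(\<lambda>j. (speed L j)\<^sup>2) \<longlonglongrightarrow> 0"
    by (rule summable_LIMSEQ_zero[OF summable_speed_square])
  then show ?thesis by (simp add: tendsto_power_zero power_tendsto_0_iff)
qed

lemma profile_slow_time_step:
  assumes "0 \<le> lam"
  shows "\<bar>profile lam (slow_time L (Suc m)) - profile lam (slow_time L m)\<bar> \<le> lam * speed L m"
proof -
  have "\<bar>profile lam (slow_time L (Suc m)) - profile lam (slow_time L m)\<bar> \<le> lam / (1 + slow_time L m) * speed L m"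
    unfolding slow_time_Suc by (rule profile_increment[OF assms slow_time_nonneg speed_nonneg])
  also have "\<dots> \<le> lam / 1 * speed L m"
    using assms slow_time_nonneg[of L m] speed_nonneg[of L m] by (intro mult_right_mono divide_left_mono) auto
  finally show ?thesis by simp
qed

lemma amplitude_slow_time_step:
  "\<bar>amplitude (slow_time L (Suc m)) - amplitude (slow_time L m)\<bar> \<le> speed L m"
proof -
  let ?t = "slow_time L m"
  have "norm (amplitude (?t + speed L m) - amplitude ?t) \<le> 1 * norm (?t + speed L m - ?t)"
  proof (rule field_differentiable_bound[of "{0..}"])
    fix u :: real assume u: "u \<in> {0..}"
    show "(amplitude has_field_derivative (- 1 / 2) * (1 + u) powr (- 3 / 2)) (at u within {0..})"
      unfolding amplitude_def[abs_def] using u by (auto intro!: derivative_eq_intros)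
    show "norm ((- 1 / 2) * (1 + u) powr (- 3 / 2)) \<le> 1"
      using powr_mono[of "-3/2" 0 "1 + u"] u by (simp add: abs_mult)
  qed (use slow_time_nonneg[of L m] speed_nonneg[of L m] in \<open>auto simp: convex_real_interval\<close>)
  then show ?thesis using speed_nonneg[of L m] by (simp add: slow_time_Suc)
qed

text \<open>Forces every right limit to be constant. Neighbouring sites lie in the same or in
  adjacent groups, and both the bumps and the steps of the profile die out.\<close>

lemma potential_increment_tendsto_0:
  assumes q: "q \<ge> 1" and lam: "0 \<le> lam"
  shows "(\<lambda>n. potential lam q L (Suc n) - potential lam q L n) \<longlonglongrightarrow> 0"
proof -
  define m where "m = (\<lambda>n. (n - 1) div q)"
  define E where "E = (\<lambda>n. amplitude (slow_time L (m (Suc n))) + lam * speed L (m n) + amplitude (slow_time L (m n)))"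
  have bound: "norm (potential lam q L (Suc n) - potential lam q L n) \<le> E n" for n
  proof -
    have "m (Suc n) = m n \<or> m (Suc n) = Suc (m n)"
    proof (cases n)
      case (Suc i)
      then show ?thesis using div_Suc[of i q] by (simp add: m_def)
    qed (simp add: m_def)
    then have "\<bar>profile lam (slow_time L (m (Suc n))) - profile lam (slow_time L (m n))\<bar> \<le> lam * speed L (m n)"
      using profile_slow_time_step[OF lam, of L "m n"] lam speed_nonneg[of L "m n"] by auto
    then show ?thesis
      using potential_near_profile[of lam q L n] potential_near_profile[of lam q L "Suc n"]
      unfolding E_def m_def real_norm_def by linarith
  qed
  have "(\<lambda>n. amplitude (slow_time L (m n))) \<longlonglongrightarrow> 0"
    unfolding m_def by (rule amplitude_block_tendsto_0[OF q])
  moreover from this have "(\<lambda>n. amplitude (slow_time L (m (Suc n)))) \<longlonglongrightarrow> 0"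
    by (rule LIMSEQ_Suc)
  moreover have "(\<lambda>n. speed L (m n)) \<longlonglongrightarrow> 0"
    unfolding m_def by (rule filterlim_compose[OF speed_tendsto_0 filterlim_block_index[OF q]])
  ultimately have "E \<longlonglongrightarrow> 0 + lam * 0 + 0"
    unfolding E_def by (intro tendsto_intros)
  then show ?thesis
    by (intro Lim_null_comparison[OF always_eventually[OF allI[OF bound]]]) simp
qed

text \<open>Vanishing increments make the limits constant, and vanishing bumps keep them in
  \<open>[-lam, lam]\<close>. Conversely each \<open>\<beta>\<close> is approached at plateau times,
  and vanishing increments spread the limit to all sites.\<close>

lemma right_limits_potential:
  assumes q: "q \<ge> 1" and lam: "0 < lam"
  shows "right_limits (\<lambda>_. 1) (potential lam q L) = {const_jacobi 1 \<beta> | \<beta>. \<beta> \<in> {-lam..lam}}"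
proof -
  let ?b = "potential lam q L"
  have q0: "q > 0" and lam0: "0 \<le> lam" using q lam by auto
  have nat_top: "filterlim (\<lambda>j. nat (n + N j)) at_top sequentially"
    if "filterlim N at_top sequentially" for N :: "nat \<Rightarrow> int" and n
  proof -
    have "filterlim (\<lambda>j. n + N j) at_top sequentially"
      unfolding filterlim_at_top
    proof
      fix Z
      show "\<forall>\<^sub>F j in sequentially. Z \<le> n + N j"
        using filterlim_at_top[THEN iffD1, OF that, rule_format, of "Z - n"] by eventually_elim simp
    qed
    then show ?thesis by (rule filterlim_compose[OF filterlim_nat_sequentially])
  qed
  have shift: "(\<lambda>j. ?b (nat (n + 1 + N j)) - ?b (nat (n + N j))) \<longlonglongrightarrow> 0"
    if N: "filterlim N at_top sequentially" for N :: "nat \<Rightarrow> int" and n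
  proof (rule Lim_transform_eventually)
    show "(\<lambda>j. ?b (Suc (nat (n + N j))) - ?b (nat (n + N j))) \<longlonglongrightarrow> 0"
      by (rule filterlim_compose[OF potential_increment_tendsto_0[OF q lam0] nat_top[OF N]])
    show "\<forall>\<^sub>F j in sequentially. ?b (Suc (nat (n + N j))) - ?b (nat (n + N j)) =
        ?b (nat (n + 1 + N j)) - ?b (nat (n + N j))"
      using filterlim_at_top[THEN iffD1, OF N, rule_format, of "- n"]
    proof eventually_elim
      case (elim j)
      then have "nat (n + 1 + N j) = Suc (nat (n + N j))" by linarith
      then show ?case by simp
    qed
  qed
  show ?thesis
  proof (intro set_eqI iffI)
    fix J assume "J \<in> right_limits (\<lambda>_. 1) ?b"
    then obtain a' b' N where J: "J = (a', b')" and N: "filterlim N at_top sequentially"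
      and a: "\<And>n. (\<lambda>j. 1) \<longlonglongrightarrow> a' n" and b: "\<And>n :: int. (\<lambda>j. ?b (nat (n + N j))) \<longlonglongrightarrow> b' n"
      by (auto simp: right_limits_def)
    have a1: "a' = (\<lambda>_. 1)"
      using LIMSEQ_unique[OF tendsto_const a] by (intro ext) simp
    have step: "b' (n + 1) = b' n" for n
      using LIMSEQ_unique[OF shift[OF N] tendsto_diff[OF b[of "n + 1"] b[of n]]] by simp
    have "b' n = b' 0" for n
    proof (induction n rule: int_induct[where k = 0])
      case (step2 i)
      then show ?case using step[of "i - 1"] by simp
    qed (use step in simp_all)
    then have b0: "b' = (\<lambda>_. b' 0)" by (rule ext)
    have M: "filterlim (\<lambda>j. nat (0 + N j)) at_top sequentially" by (rule nat_top[OF N])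
    have amp: "(\<lambda>j. amplitude (slow_time L ((nat (0 + N j) - 1) div q))) \<longlonglongrightarrow> 0"
      by (rule filterlim_compose[OF amplitude_block_tendsto_0[OF q] M])
    have "\<bar>b' 0\<bar> \<le> lam + 0"
    proof (rule LIMSEQ_le)
      show "(\<lambda>j. \<bar>?b (nat (0 + N j))\<bar>) \<longlonglongrightarrow> \<bar>b' 0\<bar>" by (intro tendsto_rabs b)
      show "(\<lambda>j. lam + amplitude (slow_time L ((nat (0 + N j) - 1) div q))) \<longlonglongrightarrow> lam + 0"
        by (intro tendsto_add tendsto_const amp)
      have le: "\<bar>?b n\<bar> \<le> lam + amplitude (slow_time L ((n - 1) div q))" for n
        using potential_near_profile[of lam q L n] profile_bound[OF lam0, of "slow_time L ((n - 1) div q)"] by linarith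
      then show "\<exists>N0. \<forall>j\<ge>N0. \<bar>?b (nat (0 + N j))\<bar> \<le> lam + amplitude (slow_time L ((nat (0 + N j) - 1) div q))"
        by blast
    qed
    then have "b' 0 \<in> {-lam..lam}" by (auto simp: abs_le_iff)
    moreover have "J = const_jacobi 1 (b' 0)" unfolding J const_jacobi_def using a1 b0 by simp
    ultimately show "J \<in> {const_jacobi 1 \<beta> | \<beta>. \<beta> \<in> {-lam..lam}}" by blast
  next
    fix J assume "J \<in> {const_jacobi 1 \<beta> | \<beta>. \<beta> \<in> {-lam..lam}}"
    then obtain \<beta> where \<beta>: "\<beta> \<in> {-lam..lam}" and J: "J = const_jacobi 1 \<beta>" by blast
    obtain k :: "nat \<Rightarrow> nat" where k: "filterlim k at_top sequentially" "(\<lambda>i. profile lam (real (k i))) \<longlonglongrightarrow> \<beta>"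
      by (rule profile_cluster[OF lam \<beta>])
    \<comment> \<open>First site of the plateau numbered \<open>k i\<close>, where the clock shows
      exactly \<open>k i\<close>.\<close>
    define n0 where "n0 = (\<lambda>i. block_start L (k i) * q + 1)"
    define N where "N = (\<lambda>i. int (n0 i))"
    have b_n0: "?b (n0 i) = profile lam (real (k i)) + amplitude (real (k i))" for i
      unfolding n0_def using potential_block[of 1 q lam L "block_start L (k i)"] q
      by (simp add: slow_time_block_start)
    have k_le: "k i \<le> n0 i" for i
    proof -
      have "k i * 1 \<le> block_start L (k i) * q" using le_block_start[of "k i" L] q by (intro mult_le_mono) auto
      then show ?thesis by (simp add: n0_def)
    qed
    have "filterlim n0 at_top sequentially"
      by (rule filterlim_at_top_mono[OF k(1)]) (use k_le in auto)
    then have N: "filterlim N at_top sequentially"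
      unfolding N_def by (rule filterlim_compose[OF filterlim_int_sequentially])
    have amp: "(\<lambda>i. amplitude (real (k i))) \<longlonglongrightarrow> 0"
      by (intro filterlim_compose[OF amplitude_tendsto_0] filterlim_compose[OF filterlim_real_sequentially] k)
    have "(\<lambda>i. ?b (n0 i)) \<longlonglongrightarrow> \<beta> + 0"
      unfolding b_n0 by (intro tendsto_add k amp)
    then have base: "(\<lambda>j. ?b (nat (0 + N j))) \<longlonglongrightarrow> \<beta>" by (simp add: N_def)
    have all: "(\<lambda>j. ?b (nat (n + N j))) \<longlonglongrightarrow> \<beta>" for n
    proof (induction n rule: int_induct[where k = 0])
      case (step1 i)
      from tendsto_add[OF shift[OF N, of i] step1(2)] show ?case by simp
    next
      case (step2 i)
      from tendsto_diff[OF step2(2) shift[OF N, of "i - 1"]] show ?case by simp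
    qed (rule base)
    show "J \<in> right_limits (\<lambda>_. 1) ?b"
      unfolding right_limits_def J const_jacobi_def using N all by auto
  qed
qed

text \<open>A shift by \<open>q\<close> keeps the position within the group, so bumps are compared
  with bumps and the difference is at most \<open>lam + 1\<close> times the speed; each speed counts
  for \<open>q\<close> consecutive sites.\<close>

lemma potential_q_variation_summable:
  assumes q: "q \<ge> 1" and lam: "0 \<le> lam"
  shows "(\<lambda>n. \<bar>potential lam q L (n + q) - potential lam q L n\<bar>\<^sup>2) summable_on {1..}"
proof -
  define C where "C = (lam + 1)\<^sup>2"
  define h where "h = (\<lambda>n. (speed L (n div q))\<^sup>2)"
  have sumh: "summable h"
  proof (rule summableI_nonneg_bounded)
    show "0 \<le> h n" for n by (simp add: h_def)
    fix n
    have "(\<Sum>i<n. h i) \<le> (\<Sum>i<n * q. h i)"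
      using q by (intro sum_mono2) (auto simp: h_def)
    also have "\<dots> = (\<Sum>m<n. \<Sum>i\<in>{m * q..<m * q + q}. h i)"
      by (simp add: sum.nat_group)
    also have "\<dots> = (\<Sum>m<n. real q * (speed L m)\<^sup>2)"
    proof (intro sum.cong refl)
      fix m
      have "(\<Sum>i\<in>{m * q..<m * q + q}. h i) = (\<Sum>i\<in>{m * q..<m * q + q}. (speed L m)\<^sup>2)"
      proof (intro sum.cong refl)
        fix i assume "i \<in> {m * q..<m * q + q}"
        then have "i div q = m" by (intro div_nat_eqI) (auto simp: mult.commute)
        then show "h i = (speed L m)\<^sup>2" by (simp add: h_def)
      qed
      then show "(\<Sum>i\<in>{m * q..<m * q + q}. h i) = real q * (speed L m)\<^sup>2" by simp
    qed
    also have "\<dots> \<le> real q * (\<Sum>m. (speed L m)\<^sup>2)"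
      unfolding sum_distrib_left[symmetric]
      by (intro mult_left_mono sum_le_suminf summable_speed_square) auto
    finally show "(\<Sum>i<n. h i) \<le> real q * (\<Sum>m. (speed L m)\<^sup>2)" .
  qed
  have le: "\<bar>potential lam q L (Suc n + q) - potential lam q L (Suc n)\<bar>\<^sup>2 \<le> C * h n" for n
  proof -
    define m where "m = n div q"
    have mq: "(n + q) div q = Suc m" "(n + q) mod q = n mod q" using q by (auto simp: m_def)
    have "potential lam q L (Suc n + q) - potential lam q L (Suc n) =
      (profile lam (slow_time L (Suc m)) - profile lam (slow_time L m)) +
      (if n mod q = 0 then amplitude (slow_time L (Suc m)) - amplitude (slow_time L m) else 0)"
      unfolding potential_def by (simp add: mq m_def[symmetric])
    then have "\<bar>potential lam q L (Suc n + q) - potential lam q L (Suc n)\<bar> \<le> lam * speed L m + speed L m"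
      using profile_slow_time_step[OF lam, of L m] amplitude_slow_time_step[of L m] speed_nonneg[of L m]
      by (auto split: if_splits)
    also have "\<dots> = (lam + 1) * speed L m" by (simp add: algebra_simps)
    finally have "\<bar>potential lam q L (Suc n + q) - potential lam q L (Suc n)\<bar>\<^sup>2 \<le> ((lam + 1) * speed L m)\<^sup>2"
      by (intro power_mono) auto
    then show ?thesis by (simp add: C_def h_def m_def power_mult_distrib)
  qed
  have "summable (\<lambda>n. \<bar>potential lam q L (Suc n + q) - potential lam q L (Suc n)\<bar>\<^sup>2)"
    by (rule summable_comparison_test'[OF summable_mult[OF sumh, of C], of 0]) (use le in simp)
  then have "summable (\<lambda>n. \<bar>potential lam q L (n + q) - potential lam q L n\<bar>\<^sup>2)"
    by (subst summable_Suc_iff[symmetric])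
  then have "(\<lambda>n. \<bar>potential lam q L (n + q) - potential lam q L n\<bar>\<^sup>2) summable_on UNIV"
    by (subst summable_on_UNIV_nonneg_real_iff) auto
  then show ?thesis by (rule summable_on_subset_banach) simp
qed

section \<open>The essential support of the absolutely continuous spectrum\<close>

text \<open>Countably many rational intervals exhaust the open set, so the null sets of the single
  intervals can be united.\<close>

lemma density_pos_on_stable_set:
  assumes dec: "lebesgue_decomposition \<mu> f \<mu>s" and G: "open G"
    and lower: "\<And>c d. {c..d} \<subseteq> G \<Longrightarrow> \<exists>\<kappa>>0. \<forall>A\<in>sets borel. A \<subseteq> {c..d} \<longrightarrow> ennreal \<kappa> * emeasure lborel A \<le> emeasure \<mu> A"
  shows "AE x in lborel. x \<in> G \<longrightarrow> f x > 0"
proof -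
  define Q where "Q = {p \<in> \<rat> \<times> \<rat>. {fst p..snd p} \<subseteq> G}"
  have "countable Q"
    by (rule countable_subset[of _ "\<rat> \<times> \<rat>"]) (auto simp: Q_def countable_rat)
  moreover have "AE x in lborel. x \<in> {fst p..snd p} \<longrightarrow> f x > 0" if p: "p \<in> Q" for p
  proof -
    obtain \<kappa> where \<kappa>: "\<kappa> > 0"
      "\<And>A. A \<in> sets borel \<Longrightarrow> A \<subseteq> {fst p..snd p} \<Longrightarrow> ennreal \<kappa> * emeasure lborel A \<le> emeasure \<mu> A"
      using lower[of "fst p" "snd p"] p by (auto simp: Q_def)
    show ?thesis by (rule density_pos_of_lower_bound[OF dec \<kappa>])
  qed
  ultimately have "AE x in lborel. \<forall>p\<in>Q. x \<in> {fst p..snd p} \<longrightarrow> f x > 0"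
    unfolding AE_ball_countable[OF \<open>countable Q\<close>] by blast
  then show ?thesis
  proof eventually_elim
    case (elim x)
    show ?case
    proof
      assume "x \<in> G"
      then obtain e where e: "e > 0" "cball x e \<subseteq> G" using G open_contains_cball by blast
      obtain c where c: "c \<in> \<rat>" "x - e < c" "c < x" using Rats_dense_in_real[of "x - e" x] e by auto
      obtain d where d: "d \<in> \<rat>" "x < d" "d < x + e" using Rats_dense_in_real[of x "x + e"] e by auto
      have "{c..d} \<subseteq> cball x e" using c d by (auto simp: dist_real_def)
      then have "(c, d) \<in> Q" using c d e by (auto simp: Q_def)
      then show "f x > 0" using elim c d by fastforce
    qed
  qed
qed

text \<open>For \<open>x\<close> near a touching point \<open>z\<close>, the matrix with
  \<open>\<beta> = x - z\<close> has \<open>x\<close> inside its spectrum but not in its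
  \<open>q\<close>-interior.\<close>

lemma stable_set_not_ae_spectrum:
  assumes q: "q > 1" and lam: "0 < lam" "lam < 2"
  shows "\<not> eq_mod_null (stable_set lam q) (\<Inter>\<beta>\<in>{-lam..lam}. jacobi_spectrum (const_jacobi 1 \<beta>))"
proof
  assume eq: "eq_mod_null (stable_set lam q) (\<Inter>\<beta>\<in>{-lam..lam}. jacobi_spectrum (const_jacobi 1 \<beta>))"
  obtain z where z: "cheb q z = 0" "\<bar>z\<bar> < 2" using exists_cheb_zero[OF q] .
  \<comment> \<open>\<open>c\<close> and \<open>d\<close> cut out the points with
    \<open>|x| < 2 - lam\<close> and \<open>|x - z| < lam\<close>; some exist because
    \<open>|z| < 2\<close> and \<open>lam\<close> lies strictly between 0 and 2.\<close>
  define c where "c = max (z - lam) (lam - 2)"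
  define d where "d = min (z + lam) (2 - lam)"
  have cd: "c < d" using z lam by (auto simp: c_def d_def)
  have in_spec: "x \<in> (\<Inter>\<beta>\<in>{-lam..lam}. jacobi_spectrum (const_jacobi 1 \<beta>))" if "x \<in> {c<..<d}" for x
  proof (intro INT_I const_jacobi_spectrum)
    fix \<beta> assume "\<beta> \<in> {-lam..lam}"
    then show "\<bar>x - \<beta>\<bar> < 2" using that by (auto simp: c_def d_def)
  qed
  have not_stable: "x \<notin> stable_set lam q" if "x \<in> {c<..<d}" for x
  proof -
    have "x - z \<in> {-lam..lam}" using that by (auto simp: c_def d_def)
    moreover have "\<bar>disc q (x - (x - z))\<bar> = 2" using disc_cheb_zero[of q z] q z(1) by simp
    ultimately show ?thesis by (auto simp: stable_set_def intro!: bexI[of _ "x - z"])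
  qed
  have "AE x in lborel. x \<notin> {c<..<d}"
    using eq unfolding eq_mod_null_def by eventually_elim (use in_spec not_stable in blast)
  moreover have "{x \<in> space lborel. \<not> x \<notin> {c<..<d}} = {c<..<d}" by auto
  ultimately have "emeasure lborel {c<..<d} = 0"
    using AE_iff_measurable[of "{c<..<d}" lborel "\<lambda>x. x \<notin> {c<..<d}"] by (simp only: sets_lborel borel_open open_greaterThanLessThan)
  then show False using cd by simp
qed

theorem theorem1p5:
  fixes lam :: real and q :: nat
  assumes "0 < lam" and "lam < 2" and "q > 1"
  shows "\<exists>(a :: nat \<Rightarrow> real) (b :: nat \<Rightarrow> real).
    (\<forall>n\<ge>1. a n = 1) \<and>
    bdd_above ((\<lambda>n. \<bar>b n\<bar>) ` {1..}) \<and>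
    (\<lambda>n. \<bar>b (n + q) - b n\<bar>\<^sup>2) summable_on {1..} \<and>
    right_limits a b = {const_jacobi 1 \<beta> | \<beta>. \<beta> \<in> {-lam..lam}} \<and>
    (\<exists>S. is_Sigma_ac a b S \<and>
       eq_mod_null (\<Inter>J \<in> right_limits a b. q_int_spectrum q J) S \<and>
       \<not> eq_mod_null S (\<Inter>J \<in> right_limits a b. jacobi_spectrum J))"
proof -
  have q: "q \<ge> 1" "q \<ge> 2" and lam: "0 \<le> lam" using assms by auto
  obtain L where L: "\<And>k. L k \<ge> 1"
    and len: "\<And>k. plateau_poly lam q L k \<noteq> 0 \<Longrightarrow> \<exists>\<eta>>0. emeasure lborel (small_root_set lam q L k \<eta>) \<le> ennreal ((1 / 2) ^ k) \<and>
        2 / (real (L k) * \<eta>) \<le> (1 / 2) ^ k"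
    using plateau_lengths_exist[OF q(1), of lam] by metis
  define b where "b = potential lam q L"
  have rl: "right_limits (\<lambda>_. 1) b = {const_jacobi 1 \<beta> | \<beta>. \<beta> \<in> {-lam..lam}}"
    unfolding b_def by (rule right_limits_potential[OF q(1) assms(1)])
  have img: "{const_jacobi 1 \<beta> | \<beta>. \<beta> \<in> {-lam..lam}} = const_jacobi 1 ` {-lam..lam}" by auto
  have qint: "(\<Inter>J \<in> right_limits (\<lambda>_. 1) b. q_int_spectrum q J) = stable_set lam q"
    unfolding rl img by (auto simp: stable_set_def q_int_spectrum_const[OF q(1)])
  have spec: "(\<Inter>J \<in> right_limits (\<lambda>_. 1) b. jacobi_spectrum J) =
      (\<Inter>\<beta>\<in>{-lam..lam}. jacobi_spectrum (const_jacobi 1 \<beta>))"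
    unfolding rl img by auto
  \<comment> \<open>The solutions are controlled at the ends of groups of \<open>q\<close> sites, so
    the approximating measures are taken along multiples of \<open>q\<close>.\<close>
  have "strict_mono (\<lambda>m. m * q)" using q by (intro strict_monoI) simp
  then obtain \<mu> where \<mu>: "spectral_measure_of (\<lambda>_. 1) b \<mu>"
    and low: "\<And>A c d C. A \<in> sets borel \<Longrightarrow> A \<subseteq> {c..d} \<Longrightarrow> C > 0 \<Longrightarrow>
       (\<forall>\<^sub>F i in sequentially. \<forall>x\<in>{c..d}. orth_norm2 b (i * q) x \<le> C) \<Longrightarrow>
       ennreal (1 / (pi * C)) * emeasure lborel A \<le> emeasure \<mu> A"
    by (rule carmona_limit[of "\<lambda>m. m * q" b]) blast
  obtain f \<mu>s where dec: "lebesgue_decomposition \<mu> f \<mu>s"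
    using lebesgue_decomposition_exists \<mu> by (metis spectral_measure_of_def)
  have pos: "AE x in lborel. x \<in> stable_set lam q \<longrightarrow> f x > 0"
  proof (rule density_pos_on_stable_set[OF dec open_stable_set])
    fix c d assume cd: "{c..d} \<subseteq> stable_set lam q"
    have "\<exists>M. \<forall>\<^sub>F m in sequentially. \<forall>x\<in>{c..d}. orth_norm2 b (m * q) x \<le> M"
      unfolding b_def
      by (rule orth_bounded_on_stable_interval[of L, OF L lam q(2)]) (use cd in \<open>auto simp: stable_set_def\<close>)
    then obtain M where M: "\<forall>\<^sub>F m in sequentially. \<forall>x\<in>{c..d}. orth_norm2 b (m * q) x \<le> M" by blast
    have "\<forall>\<^sub>F m in sequentially. \<forall>x\<in>{c..d}. orth_norm2 b (m * q) x \<le> max M 1"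
      using M by eventually_elim (auto intro: max.coboundedI1)
    then show "\<exists>\<kappa>>0. \<forall>A\<in>sets borel. A \<subseteq> {c..d} \<longrightarrow> ennreal \<kappa> * emeasure lborel A \<le> emeasure \<mu> A"
      using low[of _ c d "max M 1"] by (intro exI[of _ "1 / (pi * max M 1)"]) auto
  qed
  have zero: "AE x in lborel. (\<exists>\<^sub>F k in sequentially. \<bar>plateau_disc lam q k x\<bar> \<ge> 2) \<longrightarrow> f x = 0"
    by (rule density_zero_on_gaps[OF q(2) lam L len \<mu>[unfolded b_def] dec])
  have exc: "AE x in lborel. x \<notin> exceptional_set lam q"
    using finite_exceptional_set[OF q(1)] by (intro AE_not_in finite_imp_null_set_lborel)
  have ae: "eq_mod_null (stable_set lam q) {x. f x > 0}"
    unfolding eq_mod_null_def using pos zero exc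
  proof eventually_elim
    case (elim x)
    have "f x = 0" if "x \<notin> stable_set lam q"
      using elim unstable_frequently_gap[OF assms(1) q(1) that] by blast
    then show ?case using elim by (cases "x \<in> stable_set lam q") auto
  qed
  have bdd: "bdd_above ((\<lambda>n. \<bar>b n\<bar>) ` {1..})"
    unfolding b_def by (intro bdd_aboveI2[of _ _ "lam + 1"] potential_bound lam)
  have sum: "(\<lambda>n. \<bar>b (n + q) - b n\<bar>\<^sup>2) summable_on {1..}"
    unfolding b_def by (rule potential_q_variation_summable[OF q(1) lam])
  have "is_Sigma_ac (\<lambda>_. 1) b {x. f x > 0}"
    using \<mu> dec unfolding is_Sigma_ac_def by blast
  moreover have "\<not> eq_mod_null {x. f x > 0} (\<Inter>\<beta>\<in>{-lam..lam}. jacobi_spectrum (const_jacobi 1 \<beta>))"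
  proof
    assume "eq_mod_null {x. f x > 0} (\<Inter>\<beta>\<in>{-lam..lam}. jacobi_spectrum (const_jacobi 1 \<beta>))"
    then have "eq_mod_null (stable_set lam q) (\<Inter>\<beta>\<in>{-lam..lam}. jacobi_spectrum (const_jacobi 1 \<beta>))"
      using ae unfolding eq_mod_null_def by eventually_elim blast
    then show False using stable_set_not_ae_spectrum[OF assms(3,1,2)] by blast
  qed
  ultimately show ?thesis
    using rl qint spec ae bdd sum by (intro exI[of _ "\<lambda>_. 1"] exI[of _ b] conjI exI[of _ "{x. f x > 0}"]) auto
qed

end
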